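(* Let $T$ be an isotropic spherical random field with harmonic coefficients $\{a_{\ell m}\}$ and angular power spectrum $\{C_\ell\}$, and let $V\in L^2(\mathbb{S}^2)$ be a deterministic real-valued function with zonal expansion $V(\mathbf{x})=\sum_{\ell\in\mathbb{N}_0}v_{\ell0}Y_{\ell0}(\mathbf{x})$. Let $T_V(\mathbf{x})=V(\mathbf{x})T(\mathbf{x})$. Then, for any $\ell\in\mathbb{N}_0$ and $m\in\{-\ell,\dots,\ell\}$, the harmonic coefficients $a_{\ell m,V}=\int_{\mathbb{S}^2}T_V(\mathbf{x})Y_{\ell m}^*(\mathbf{x})\,d\mathbf{s}(\mathbf{x})$ are equal to $$a_{\ell m,V}=(-1)^m\sum_{\ell_2\in\mathbb{N}_0}\sum_{\ell_1=|\ell_2-\ell|}^{\ell_2+\ell}v_{\ell_10}\,a_{\ell_2m}\sqrt{\tfrac{(2\ell_1+1)(2\ell_2+1)(2\ell+1)}{4\pi}}\begin{pmatrix}\ell_1&\ell_2&\ell\\0&0&0\end{pmatrix}\begin{pmatrix}\ell_1&\ell_2&\ell\\0&m&-m\end{pmatrix}.$$ Therefore the power spectrum $C_{\ell\ell'mm'}=\mathbf{E}(a_{\ell m,V}a^*_{\ell'm',V})$ of $T_V$ has the form $C_{\ell\ell'mm'}=\delta_m^{m'}C_{\ell\ell'm}$ with $$C_{\ell\ell'm}=\sum_{\ell_2\in\mathbb{N}_0}\sum_{\ell_1=|\ell_2-\ell|}^{\ell_2+\ell}\sum_{\ell_1'=|\ell_2-\ell'|}^{\ell_2+\ell'}v_{\ell_10}v_{\ell_1'0}\tfrac{2\ell_2+1}{4\pi}C_{\ell_2}\sqrt{(2\ell_1+1)(2\ell_1'+1)(2\ell+1)(2\ell'+1)}$$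 $$\times\begin{pmatrix}\ell_1&\ell_2&\ell\\0&0&0\end{pmatrix}\begin{pmatrix}\ell_1'&\ell_2&\ell'\\0&0&0\end{pmatrix}\begin{pmatrix}\ell_1&\ell_2&\ell\\0&m&-m\end{pmatrix}\begin{pmatrix}\ell_1'&\ell_2&\ell'\\0&m&-m\end{pmatrix}.$$
   Context: $T$ is a real-valued zero-mean second-order random field on the unit sphere $\mathbb{S}^2\subset\mathbb{R}^3$ with continuous, not identically constant covariance; isotropic means the covariance depends only on the great-circle distance. $d\mathbf{s}$ is the surface measure ($\sin\theta\,d\theta\,d\varphi$ in colatitude $\theta$ and longitude $\varphi$), $*$ is complex conjugation. $Y_{\ell m}$ are the standard complex orthonormal spherical harmonics, $Y_{\ell m}(\theta,\varphi)=e^{im\varphi}\left[\frac{(2\ell+1)(\ell-m)!}{4\pi(\ell+m)!}\right]^{1/2}P_\ell^m(\cos\theta)$ for $m\ge0$ and $Y_{\ell(-m)}=(-1)^mY_{\ell m}^*$. $T=\sum_{\ell}\sum_m a_{\ell m}Y_{\ell m}$ with $a_{\ell m}=\int_{\mathbb{S}^2}T\,Y_{\ell m}^*\,d\mathbf{s}$, and isotropy gives $\mathbf{E}a_{\ell m}a_{\ell'm'}^*=\delta_\ell^{\ell'}\delta_m^{m'}C_\ell$; $\{C_\ell\}$ is the angular power spectrum. Series of random variables converge in $L^2(\Omega)$. The $2\times3$ arrays are Wigner $3j$-symbols; terms whose indices violate the selection rules (including $a_{\ell_2 m}$ with $|m|>\ell_2$) are zero. *)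

theory Defs
  imports "HOL-Probability.Probability" "HOL-Computational_Algebra.Polynomial"
begin

section \<open>The unit sphere, its surface measure, and spherical harmonics\<close>

abbreviation S2 :: "(real^3) set" where
  "S2 \<equiv> sphere 0 1"

definition great_circle_dist :: "real^3 \<Rightarrow> real^3 \<Rightarrow> real" where
  "great_circle_dist x y = arccos (x \<bullet> y)"

definition sphere_point :: "real \<Rightarrow> real \<Rightarrow> real^3" where
  "sphere_point \<theta> \<phi> = vector [sin \<theta> * cos \<phi>, sin \<theta> * sin \<phi>, cos \<theta>]"

definition colatitude :: "real^3 \<Rightarrow> real" where
  "colatitude x = arccos (x $ 3)"

text \<open>At the two poles the longitude is \<open>0\<close> by convention; \<open>Y\<^sub>l\<^sub>m\<close> does not depend on
  the longitude there.\<close>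

definition longitude :: "real^3 \<Rightarrow> real" where
  "longitude x = Arg2pi (Complex (x $ 1) (x $ 2))"

text \<open>The measure \<open>sin \<theta> d\<theta> d\<phi>\<close> transported to the sphere; its space is
  \<^term>\<open>S2\<close> with the Borel sets.\<close>

definition surface_measure :: "(real^3) measure" where
  "surface_measure =
     distr (density (restrict_space lborel ({0..pi} \<times> {0..<2*pi})) (\<lambda>(\<theta>, \<phi>). ennreal (sin \<theta>)))
       (restrict_space borel S2) (\<lambda>(\<theta>, \<phi>). sphere_point \<theta> \<phi>)"

definition legendre_poly :: "nat \<Rightarrow> real poly" where
  "legendre_poly l = smult (1 / (2^l * fact l)) ((pderiv ^^ l) ([:-1, 0, 1:] ^ l))"

text \<open>Associated Legendre functions \<open>P\<^sub>l\<^sup>m\<close> on \<open>[-1,1]\<close> for \<open>m \<ge> 0\<close>, with the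
  Condon--Shortley phase; they vanish for \<open>m > l\<close>.\<close>

definition assoc_legendre :: "nat \<Rightarrow> nat \<Rightarrow> real \<Rightarrow> real" where
  "assoc_legendre l m t =
     (-1)^m * sqrt (1 - t\<^sup>2) ^ m * poly ((pderiv ^^ m) (legendre_poly l)) t"

definition sph_harm_nonneg :: "nat \<Rightarrow> nat \<Rightarrow> real^3 \<Rightarrow> complex" where
  "sph_harm_nonneg l m x =
     cis (real m * longitude x) *
     of_real (sqrt ((2 * real l + 1) * fact (l - m) / (4 * pi * fact (l + m))) *
              assoc_legendre l m (cos (colatitude x)))"

definition sph_harm :: "nat \<Rightarrow> int \<Rightarrow> real^3 \<Rightarrow> complex" where
  "sph_harm l m x =
     (if m \<ge> 0 then sph_harm_nonneg l (nat m) x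
      else (-1) ^ nat (- m) * cnj (sph_harm_nonneg l (nat (- m)) x))"


section \<open>Wigner 3j-symbols\<close>

text \<open>Racah's formula for integer angular momenta \<open>a\<close>, \<open>b\<close>, \<open>c\<close> with projections
  \<open>\<alpha>\<close>, \<open>\<beta>\<close>, \<open>\<gamma>\<close>; the symbol is zero when the selection rules fail. The summation
  range consists of the \<open>t\<close> for which no factorial has a negative argument.\<close>

abbreviation int_fact :: "int \<Rightarrow> real" where
  "int_fact k \<equiv> fact (nat k)"

definition wigner_3j_sum :: "int \<Rightarrow> int \<Rightarrow> int \<Rightarrow> int \<Rightarrow> int \<Rightarrow> real" where
  "wigner_3j_sum a b c \<alpha> \<beta> =
     (\<Sum>t \<in> {t. 0 \<le> t \<and> 0 \<le> c - b + t + \<alpha> \<and> 0 \<le> c - a + t - \<beta> \<and>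
               t \<le> a + b - c \<and> t \<le> a - \<alpha> \<and> t \<le> b + \<beta>}.
        (-1) powi t /
        (int_fact t * int_fact (c - b + t + \<alpha>) * int_fact (c - a + t - \<beta>) *
         int_fact (a + b - c - t) * int_fact (a - t - \<alpha>) * int_fact (b - t + \<beta>)))"

definition wigner_3j :: "nat \<Rightarrow> nat \<Rightarrow> nat \<Rightarrow> int \<Rightarrow> int \<Rightarrow> int \<Rightarrow> real" where
  "wigner_3j l1 l2 l3 \<alpha> \<beta> \<gamma> =
     (let a = int l1; b = int l2; c = int l3 in
      if \<alpha> + \<beta> + \<gamma> = 0 \<and> \<bar>\<alpha>\<bar> \<le> a \<and> \<bar>\<beta>\<bar> \<le> b \<and> \<bar>\<gamma>\<bar> \<le> c \<and> \<bar>a - b\<bar> \<le> c \<and> c \<le> a + b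
      then (-1) powi (a - b - \<gamma>) *
           sqrt (int_fact (a + b - c) * int_fact (a - b + c) * int_fact (- a + b + c) /
                 int_fact (a + b + c + 1)) *
           sqrt (int_fact (a + \<alpha>) * int_fact (a - \<alpha>) * int_fact (b + \<beta>) * int_fact (b - \<beta>) *
                 int_fact (c + \<gamma>) * int_fact (c - \<gamma>)) *
           wigner_3j_sum a b c \<alpha> \<beta>
      else 0)"


section \<open>Square-integrable random variables and mean-square integrals\<close>

definition L2_fun :: "'a measure \<Rightarrow> ('a \<Rightarrow> complex) \<Rightarrow> bool" where
  "L2_fun M f \<longleftrightarrow> f \<in> borel_measurable M \<and> integrable M (\<lambda>x. (cmod (f x))\<^sup>2)"

definition L2_norm :: "'a measure \<Rightarrow> ('a \<Rightarrow> complex) \<Rightarrow> real" where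
  "L2_norm M f = sqrt (\<integral>x. (cmod (f x))\<^sup>2 \<partial>M)"

definition L2_sums :: "'a measure \<Rightarrow> (nat \<Rightarrow> 'a \<Rightarrow> complex) \<Rightarrow> ('a \<Rightarrow> complex) \<Rightarrow> bool" where
  "L2_sums M f s \<longleftrightarrow>
     (\<forall>n. L2_fun M (f n)) \<and> L2_fun M s \<and>
     (\<lambda>n. L2_norm M (\<lambda>x. (\<Sum>k<n. f k x) - s x)) \<longlonglongrightarrow> 0"

text \<open>The Bochner integral, over \<open>M\<close>, of a function \<open>X\<close> with values in the Hilbert space
  of square-integrable random variables on \<open>P\<close>. It follows \<^const>\<open>has_bochner_integral\<close>:
  the simple functions are \<open>x \<mapsto> \<Sum>i<n k. 1\<^bsub>A k i\<^esub>(x) Z k i\<close>. No joint measurability of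
  \<open>(x, \<omega>) \<mapsto> X x \<omega>\<close> is needed; the integral is determined up to \<open>P\<close>-null sets.\<close>

definition has_ms_integral ::
    "'w measure \<Rightarrow> 'a measure \<Rightarrow> ('a \<Rightarrow> 'w \<Rightarrow> complex) \<Rightarrow> ('w \<Rightarrow> complex) \<Rightarrow> bool" where
  "has_ms_integral P M X I \<longleftrightarrow>
     (\<forall>x\<in>space M. L2_fun P (X x)) \<and> L2_fun P I \<and>
     (\<exists>(n :: nat \<Rightarrow> nat) (A :: nat \<Rightarrow> nat \<Rightarrow> 'a set) (Z :: nat \<Rightarrow> nat \<Rightarrow> 'w \<Rightarrow> complex).
        (\<forall>k. \<forall>i<n k. A k i \<in> sets M \<and> emeasure M (A k i) < \<infinity> \<and> L2_fun P (Z k i)) \<and>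
        (let err = (\<lambda>k x. L2_norm P (\<lambda>\<omega>. X x \<omega> - (\<Sum>i<n k. indicator (A k i) x * Z k i \<omega>))) in
           (\<forall>k. err k \<in> borel_measurable M) \<and>
           (\<lambda>k. \<integral>\<^sup>+x. ennreal (err k x) \<partial>M) \<longlonglongrightarrow> 0) \<and>
        (\<lambda>k. L2_norm P (\<lambda>\<omega>. (\<Sum>i<n k. of_real (measure M (A k i)) * Z k i \<omega>) - I \<omega>)) \<longlonglongrightarrow> 0)"

definition ms_integral ::
    "'w measure \<Rightarrow> 'a measure \<Rightarrow> ('a \<Rightarrow> 'w \<Rightarrow> complex) \<Rightarrow> 'w \<Rightarrow> complex" where
  "ms_integral P M X = (SOME I. has_ms_integral P M X I)"


section \<open>Random fields on the sphere\<close>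

definition centred_second_order_field :: "'w measure \<Rightarrow> (real^3 \<Rightarrow> 'w \<Rightarrow> real) \<Rightarrow> bool" where
  "centred_second_order_field P T \<longleftrightarrow>
     prob_space P \<and>
     (\<forall>x\<in>S2. T x \<in> borel_measurable P \<and> integrable P (\<lambda>\<omega>. (T x \<omega>)\<^sup>2) \<and> (\<integral>\<omega>. T x \<omega> \<partial>P) = 0)"

text \<open>Covariance of a centred field.\<close>

definition field_cov :: "'w measure \<Rightarrow> (real^3 \<Rightarrow> 'w \<Rightarrow> real) \<Rightarrow> real^3 \<Rightarrow> real^3 \<Rightarrow> real" where
  "field_cov P T x y = (\<integral>\<omega>. T x \<omega> * T y \<omega> \<partial>P)"

definition isotropic_field :: "'w measure \<Rightarrow> (real^3 \<Rightarrow> 'w \<Rightarrow> real) \<Rightarrow> bool" where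
  "isotropic_field P T \<longleftrightarrow>
     centred_second_order_field P T \<and>
     continuous_on (S2 \<times> S2) (\<lambda>(x, y). field_cov P T x y) \<and>
     \<not> (\<exists>c. \<forall>x\<in>S2. \<forall>y\<in>S2. field_cov P T x y = c) \<and>
     (\<exists>g. \<forall>x\<in>S2. \<forall>y\<in>S2. field_cov P T x y = g (great_circle_dist x y))"

text \<open>The coefficients \<open>a\<^sub>l\<^sub>m\<close> of a field; zero if \<open>\<bar>m\<bar> > l\<close>.\<close>

definition harmonic_coeff ::
    "'w measure \<Rightarrow> (real^3 \<Rightarrow> 'w \<Rightarrow> real) \<Rightarrow> nat \<Rightarrow> int \<Rightarrow> 'w \<Rightarrow> complex" where
  "harmonic_coeff P X l m =
     (if \<bar>m\<bar> \<le> int l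
      then ms_integral P surface_measure (\<lambda>x \<omega>. of_real (X x \<omega>) * cnj (sph_harm l m x))
      else (\<lambda>\<omega>. 0))"

definition coeff_cov ::
    "'w measure \<Rightarrow> (real^3 \<Rightarrow> 'w \<Rightarrow> real) \<Rightarrow> nat \<Rightarrow> nat \<Rightarrow> int \<Rightarrow> int \<Rightarrow> complex" where
  "coeff_cov P X l l' m m' =
     (\<integral>\<omega>. harmonic_coeff P X l m \<omega> * cnj (harmonic_coeff P X l' m' \<omega>) \<partial>P)"

text \<open>The unique sequence \<open>C\<close> with \<open>E(a\<^sub>l\<^sub>m a\<^sub>l\<^sub>'\<^sub>m\<^sub>'\<^sup>*) = \<delta>\<^sub>l\<^sub>l\<^sub>' \<delta>\<^sub>m\<^sub>m\<^sub>' C\<^sub>l\<close>. Such a sequence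
  exists for isotropic fields.\<close>

definition angular_power_spectrum :: "'w measure \<Rightarrow> (real^3 \<Rightarrow> 'w \<Rightarrow> real) \<Rightarrow> nat \<Rightarrow> real" where
  "angular_power_spectrum P T =
     (THE C. \<forall>l l' m m'. \<bar>m\<bar> \<le> int l \<longrightarrow> \<bar>m'\<bar> \<le> int l' \<longrightarrow>
        coeff_cov P T l l' m m' = (if l = l' \<and> m = m' then of_real (C l) else 0))"

text \<open>Zonal expansion \<open>V = \<Sum>\<^sub>l v\<^sub>l\<^sub>0 Y\<^sub>l\<^sub>0\<close> of a function in \<open>L\<^sup>2\<close> of the sphere, with
  convergence in that space. The coefficients are real since \<open>V\<close> and \<open>Y\<^sub>l\<^sub>0\<close> are.\<close>

definition has_zonal_expansion :: "(real^3 \<Rightarrow> real) \<Rightarrow> (nat \<Rightarrow> real) \<Rightarrow> bool" where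
  "has_zonal_expansion V v \<longleftrightarrow>
     L2_sums surface_measure (\<lambda>l x. of_real (v l) * sph_harm l 0 x) (\<lambda>x. of_real (V x))"

end

(*
The map f |-> int f T ds is bounded from L^1 of the sphere to L^2(Omega), since T is bounded in mean
square. So it suffices to expand V Y_lm^* in L^2 of the sphere. As Y_{l1,0} Y_lm is a finite combination
of the Y_{l2,m}, the zonal expansion of V puts V Y_lm^* into the closed span of the orthonormal functions
Y_{l2,m}^*; its coefficients are finite sums of integrals of three spherical harmonics.

Because the Legendre operator is self-adjoint, int P_a P_b^m P_c^m, suitably normalised, satisfies a
three-term recurrence in m, and a telescoping argument gives the same recurrence for Racah's sum. The two
are matched at m = 0, where Adams' formula evaluates the integral and Dixon's identity evaluates the sum.

The covariance of T is kappa(x . y) with kappa continuous. For kappa(s) = s^n, the kernel is diagonal in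
the Y_lm, with entries independent of m, by induction on n: with z = x_1 + i x_2 and w = y_1 + i y_2,
multiplication by x . y = x_3 y_3 + (z w^* + z^* w) / 2 shifts the degree and order on both sides, and the
off-diagonal contributions cancel. The general case follows by Weierstrass approximation.
*)

theory Submission
  imports Defs
begin

text \<open>The final series runs over \<open>l2\<close>, whereas \<open>V\<close> is given as a
  series over \<open>l1\<close>. No double series is rearranged: by the triangle rule, the
  coefficient belonging to degree \<open>k\<close> in a partial sum of \<open>V\<close> times a
  harmonic of degree \<open>l\<close> stops changing once the partial sum is longer than
  \<open>k + l\<close>.

  No joint measurability of \<open>T\<close> in point and outcome is assumed, so Fubini's theorem
  cannot be applied to sphere times probability space. Facts about mean-square integrals are
  therefore obtained by testing against a square-integrable \<open>W\<close>; what remains is the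
  integral of a continuous function, \<open>pairing W\<close>, against \<open>f\<close> over the
  sphere. This also makes it immaterial which representative the choice in
  \<open>ms_integral\<close> returns.

  A three-term recurrence in \<open>m\<close> asks for two initial values. When
  \<open>a + b + c\<close> is even, reflection symmetry of Racah's sum identifies its values at -1
  and 1, which replaces the second one. When the sum is odd or the triangle rule fails, the integral
  and the product of symbols both vanish.\<close>

section \<open>Legendre polynomials\<close>

text \<open>Products with explicit factors such as \<open>[:1, 0, -1:]\<close> are kept unexpanded.\<close>

declare mult_pCons_left [simp del] mult_pCons_right [simp del]

definition legendre_deriv :: "nat \<Rightarrow> nat \<Rightarrow> real poly" where
  "legendre_deriv l m = (pderiv ^^ m) (legendre_poly l)"

lemma pderiv_legendre_deriv [simp]: "pderiv (legendre_deriv l m) = legendre_deriv l (Suc m)"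
  by (simp add: legendre_deriv_def)

section \<open>From Rodrigues' formula to recurrences and the differential equation\<close>

lemma pderiv_poly_X: "pderiv [:0, 1::real:] = 1"
  by (simp add: pderiv_pCons one_pCons)

text \<open>Leibniz rule: the second derivative of the linear factor is zero, so two terms survive.
  The order is written \<open>Suc n\<close> to avoid a truncated \<open>n - 1\<close>.\<close>

lemma higher_pderiv_X_mult:
  "(pderiv ^^ Suc n) ([:0, 1::real:] * p) = [:0, 1:] * (pderiv ^^ Suc n) p +
      smult (real (Suc n)) ((pderiv ^^ n) p)"
proof (induction n)
  case 0
  then show ?case by (simp add: pderiv_mult pderiv_poly_X)
next
  case (Suc n)
  show ?case
    unfolding funpow.simps(2)[of "Suc n"] o_apply Suc.IH
    by (simp add: poly_eq_poly_eq_iff[symmetric] fun_eq_iff pderiv_mult pderiv_add pderiv_smult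
        pderiv_poly_X
        algebra_simps)
qed

lemma pderiv_rodrigues:
  "pderiv ([:-1, 0, 1::real:] ^ Suc l) = smult (2 * real (Suc l)) ([:0, 1:] * [:-1, 0, 1:] ^ l)"
  unfolding pderiv_power_Suc by (simp add: pderiv_pCons poly_eq_poly_eq_iff[symmetric] fun_eq_iff
      algebra_simps)

lemma legendre_poly_0: "legendre_poly 0 = 1"
  by (simp add: legendre_poly_def)

lemma legendre_poly_1: "legendre_poly (Suc 0) = [:0, 1:]"
  by (simp add: legendre_poly_def pderiv_pCons)

text \<open>One of the \<open>l + 1\<close> derivatives in Rodrigues' formula is spent on the power;
  it lowers the exponent and its factor \<open>2 * (l + 1)\<close> reduces the normalisation. The
  relations between neighbouring degrees start from this form.\<close>

lemma legendre_poly_Suc_eq: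
  "legendre_poly (Suc l) = smult (1 / (2 ^ l * fact l)) ((pderiv ^^ l) ([:0, 1:] * [:-1, 0, 1:] ^ l))"
proof -
  have "legendre_poly (Suc l) = smult (1 / (2 ^ Suc l * fact (Suc l))) ((pderiv ^^ l) (pderiv
      ([:-1, 0, 1:] ^ Suc l)))"
    by (simp only: legendre_poly_def funpow_Suc_right o_apply)
  also have "\<dots> = smult (1 / (2 ^ Suc l * fact (Suc l)) * (2 * real (Suc l))) ((pderiv ^^ l) ([:0, 1:] *
      [:-1, 0, 1:] ^ l))"
    by (simp only: pderiv_rodrigues higher_pderiv_smult smult_smult)
  also have "1 / (2 ^ Suc l * fact (Suc l)) * (2 * real (Suc l)) = (1 / (2 ^ l * fact l) :: real)"
    by (simp add: divide_simps)
  finally show ?thesis .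
qed

lemma legendre_deriv_Suc_1:
  "legendre_deriv (Suc l) 1 = [:0, 1:] * legendre_deriv l 1 + smult (real (Suc l)) (legendre_deriv l 0)"
proof -
  have "legendre_deriv (Suc l) 1 = smult (1 / (2 ^ l * fact l)) ((pderiv ^^ Suc l) ([:0, 1:] * [:-1, 0,
      1:] ^ l))"
    by (simp add: legendre_deriv_def legendre_poly_Suc_eq pderiv_smult)
  also have "\<dots> = [:0, 1:] * legendre_deriv l 1 + smult (real (Suc l)) (legendre_deriv l 0)"
    unfolding higher_pderiv_X_mult
    by (simp add: legendre_deriv_def legendre_poly_def pderiv_smult smult_add_right mult.commute)
  finally show ?thesis .
qed

text \<open>Writing \<open>t^2\<close> as \<open>(t^2 - 1) + 1\<close> splits the product-rule term
  into two powers; the lower one is what ties degree \<open>l + 2\<close> to degree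
  \<open>l\<close>.\<close>

lemma pderiv_X_rodrigues:
  "pderiv ([:0, 1:] * [:-1, 0, 1::real:] ^ Suc l) =
     smult (2 * real l + 3) ([:-1, 0, 1:] ^ Suc l) + smult (2 * real (Suc l)) ([:-1, 0, 1:] ^ l)"
proof -
  have "poly (pderiv ([:0, 1:] * [:-1, 0, 1::real:] ^ Suc l)) x =
     poly (smult (2 * real l + 3) ([:-1, 0, 1:] ^ Suc l) + smult (2 * real (Suc l))
         ([:-1, 0, 1:] ^ l)) x" for x
    unfolding pderiv_mult pderiv_rodrigues pderiv_poly_X
    by (simp add: algebra_simps)
  then show ?thesis by (simp add: poly_eq_poly_eq_iff[symmetric] fun_eq_iff)
qed

text \<open>The auxiliary polynomial \<open>q\<close> is \<open>D\<^sup>l (t\<^sup>2 - 1)\<^sup>l\<^sup>+\<^sup>1\<close>, suitably normalised; eliminating it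
  gives the three-term recurrence.\<close>

lemma legendre_poly_Suc_Suc:
  obtains q where
    "legendre_poly (Suc (Suc l)) = smult (2 * real l + 3) q + legendre_poly l"
    "legendre_poly (Suc (Suc l)) = [:0, 1:] * legendre_poly (Suc l) + smult (real (Suc l)) q"
    "pderiv q = legendre_poly (Suc l)"
proof
  define c where "c = (1 / (2 ^ Suc l * fact (Suc l)) :: real)"
  define q where "q = smult c ((pderiv ^^ l) ([:-1, 0, 1:] ^ Suc l))"
  have "legendre_poly (Suc (Suc l)) = smult c ((pderiv ^^ l) (pderiv ([:0, 1:] * [:-1, 0, 1:] ^ Suc
      l)))"
    by (simp only: legendre_poly_Suc_eq[of "Suc l"] c_def funpow_Suc_right o_apply)
  also have "\<dots> = smult (2 * real l + 3) q + smult (c * (2 * real (Suc l))) ((pderiv ^^ l) ([:-1, 0, 1:]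
      ^ l))"
    unfolding pderiv_X_rodrigues higher_pderiv_add higher_pderiv_smult smult_add_right q_def smult_smult
    by (simp add: mult.commute)
  also have "c * (2 * real (Suc l)) = 1 / (2 ^ l * fact l)"
    by (simp add: c_def divide_simps)
  finally show "legendre_poly (Suc (Suc l)) = smult (2 * real l + 3) q + legendre_poly l"
    by (simp add: legendre_poly_def)
  have "legendre_poly (Suc (Suc l)) = smult c ((pderiv ^^ Suc l) ([:0, 1:] * [:-1, 0, 1:] ^ Suc l))"
    by (simp only: legendre_poly_Suc_eq[of "Suc l"] c_def)
  also have "\<dots> = [:0, 1:] * legendre_poly (Suc l) + smult (real (Suc l)) q"
    unfolding higher_pderiv_X_mult
    by (simp add: legendre_poly_def q_def c_def smult_add_right mult.commute)
  finally show "legendre_poly (Suc (Suc l)) = [:0, 1:] * legendre_poly (Suc l) +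
      smult (real (Suc l)) q" .
  show "pderiv q = legendre_poly (Suc l)"
    by (simp add: q_def c_def legendre_poly_def pderiv_smult)
qed

lemma legendre_poly_three_term:
  "smult (real l + 2) (legendre_poly (Suc (Suc l))) =
     smult (2 * real l + 3) ([:0, 1:] * legendre_poly (Suc l)) - smult (real l + 1) (legendre_poly l)"
proof -
  obtain q where q: "legendre_poly (Suc (Suc l)) = smult (2 * real l + 3) q + legendre_poly l"
    "legendre_poly (Suc (Suc l)) = [:0, 1:] * legendre_poly (Suc l) + smult (real (Suc l)) q"
    by (rule legendre_poly_Suc_Suc)
  have "poly (smult (real l + 2) (legendre_poly (Suc (Suc l)))) x =
     poly (smult (2 * real l + 3) ([:0, 1:] * legendre_poly (Suc l)) - smult (real l + 1)
         (legendre_poly l)) x" for x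
  proof -
    have "poly (legendre_poly (Suc (Suc l))) x = (2 * real l + 3) * poly q x + poly (legendre_poly l) x"
      by (subst q(1)) simp
    moreover have "poly (legendre_poly (Suc (Suc l))) x = x * poly (legendre_poly (Suc l)) x +
        (real l + 1) * poly q x"
      by (subst q(2)) simp
    ultimately show ?thesis by simp algebra
  qed
  then show ?thesis by (simp add: poly_eq_poly_eq_iff[symmetric] fun_eq_iff)
qed

text \<open>The base case differentiates the relation containing \<open>q\<close>, whose derivative
  is \<open>legendre_poly (Suc l)\<close>; each higher order is one more derivative.\<close>

lemma legendre_deriv_diff:
  "smult (2 * real l + 3) (legendre_deriv (Suc l) m) = legendre_deriv (Suc (Suc l)) (Suc m) -
      legendre_deriv l (Suc m)"
proof (induction m)
  case 0
  obtain q where q: "legendre_poly (Suc (Suc l)) = smult (2 * real l + 3) q + legendre_poly l"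
    "pderiv q = legendre_poly (Suc l)"
    by (rule legendre_poly_Suc_Suc)
  show ?case by (simp add: legendre_deriv_def q pderiv_add pderiv_smult)
next
  case (Suc m)
  have "pderiv (smult (2 * real l + 3) (legendre_deriv (Suc l) m)) =
      pderiv (legendre_deriv (Suc (Suc l)) (Suc m) - legendre_deriv l (Suc m))"
    using Suc by simp
  then show ?case by (simp add: pderiv_smult pderiv_diff)
qed

lemma legendre_deriv_0_0: "legendre_deriv 0 0 = 1" "legendre_deriv 0 (Suc m) = 0"
proof -
  show "legendre_deriv 0 0 = 1" by (simp add: legendre_deriv_def legendre_poly_0)
  show "legendre_deriv 0 (Suc m) = 0"
    by (induction m) (simp_all add: legendre_deriv_def legendre_poly_0)
qed

lemma degree_legendre_poly_le: "degree (legendre_poly l) \<le> l"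
proof (induction l rule: less_induct)
  case (less l)
  consider "l = 0" | "l = 1" | k where "l = Suc (Suc k)"
    by (metis One_nat_def not0_implies_Suc)
  then show ?case
  proof cases
    case 3
    have "degree (smult (2 * real k + 3) ([:0, 1:] * legendre_poly (Suc k)) - smult (real k +
        1) (legendre_poly k)) \<le> Suc (Suc k)"
      using less[of "Suc k"] less[of k] 3
      by (intro degree_diff_le) (auto intro: order.trans[OF degree_smult_le] order.trans[OF
          degree_mult_le])
    then have "degree (smult (real k + 2) (legendre_poly (Suc (Suc k)))) \<le> Suc (Suc k)"
      by (simp only: legendre_poly_three_term)
    moreover have "real k + 2 \<noteq> 0" by linarith
    ultimately show ?thesis using 3 by simp
  qed (simp_all add: legendre_poly_0 legendre_poly_1)
qed

lemma legendre_deriv_eq_0: "l < m \<Longrightarrow> legendre_deriv l m = 0"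
proof -
  assume "l < m"
  then obtain k where m: "m = Suc k" "l \<le> k"
      by (metis less_eq_Suc_le not0_implies_Suc not_less_eq_eq not_less_zero)
  have "degree (legendre_deriv l k) = 0"
    using degree_legendre_poly_le[of l] m by (simp add: legendre_deriv_def degree_higher_pderiv)
  then have "pderiv (legendre_deriv l k) = 0" by (simp only: pderiv_eq_0_iff)
  then show ?thesis using m by simp
qed

text \<open>A first-order relation whose derivative is Legendre's equation. At \<open>l = 0\<close>
  the truncated \<open>l - 1\<close> does no harm, since the factor \<open>real l\<close> is
  zero.\<close>

lemma legendre_ode_base:
  "[:1, 0, -1:] * legendre_deriv l 1 = smult (real l) (legendre_deriv (l - 1) 0 - [:0, 1:] *
      legendre_deriv l 0)"
proof (cases l)
  case 0
  then show ?thesis by (simp add: legendre_deriv_0_0)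
next
  case l: (Suc k)
  have "poly ([:1, 0, -1:] * legendre_deriv (Suc k) 1) x =
     poly (smult (real (Suc k)) (legendre_deriv k 0 - [:0, 1:] * legendre_deriv (Suc k) 0)) x" for x
  proof -
    have 1: "poly (legendre_deriv (Suc k) 1) x = x * poly (legendre_deriv k 1) x +
        real (Suc k) * poly (legendre_deriv k 0) x"
      by (subst legendre_deriv_Suc_1) simp
    have 2: "poly (legendre_deriv (Suc (Suc k)) 1) x = x * poly (legendre_deriv (Suc k) 1) x +
        real (Suc (Suc k)) * poly (legendre_deriv (Suc k) 0) x"
      by (subst legendre_deriv_Suc_1) simp
    have 3: "(2 * real k + 3) * poly (legendre_deriv (Suc k) 0) x = poly (legendre_deriv (Suc (Suc k))
        1) x - poly (legendre_deriv k 1) x"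
      using arg_cong[OF legendre_deriv_diff[of k 0], of "\<lambda>p. poly p x"] by simp
    \<comment> \<open>The derivatives of degrees \<open>k\<close> and \<open>k + 2\<close> are
      eliminated from the three relations.\<close>
    show ?thesis using 1 2 3 by simp algebra
  qed
  then show ?thesis using l by (simp add: poly_eq_poly_eq_iff[symmetric] fun_eq_iff)
qed

text \<open>Legendre's equation differentiated \<open>m\<close> times. The first-order term
  contributes \<open>2 + 4 + ... + 2 * m\<close> in the course of this, which turns
  \<open>l * (l + 1)\<close> into \<open>(l - m) * (l + m + 1)\<close>.\<close>

lemma legendre_ode:
  "[:1, 0, -1:] * legendre_deriv l (Suc (Suc m)) =
     smult (2 * real (Suc m)) ([:0, 1:] * legendre_deriv l (Suc m))
     - smult ((real l - real m) * (real l + real m + 1)) (legendre_deriv l m)"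
proof (induction m)
  case 0
  show ?case
  proof (cases l)
    case 0
    then show ?thesis by (simp add: legendre_deriv_0_0)
  next
    case l: (Suc k)
    have "poly ([:1, 0, -1:] * legendre_deriv (Suc k) (Suc (Suc 0))) x = poly (smult (2 * real (Suc 0))
        ([:0, 1:] * legendre_deriv (Suc k) (Suc 0))
     - smult ((real (Suc k) - real 0) * (real (Suc k) + real 0 + 1)) (legendre_deriv
         (Suc k) 0)) x" for x
    proof -
      have 1: "poly (pderiv ([:1, 0, -1:] * legendre_deriv (Suc k) 1)) x =
          poly (pderiv (smult (real (Suc k)) (legendre_deriv k 0 - [:0, 1:] * legendre_deriv
          (Suc k) 0))) x"
        by (subst legendre_ode_base) simp
      have 2: "poly (legendre_deriv (Suc (Suc k)) 1) x = x * poly (legendre_deriv (Suc k) 1) x +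
          real (Suc (Suc k)) * poly (legendre_deriv (Suc k) 0) x"
        by (subst legendre_deriv_Suc_1) simp
      have 3: "(2 * real k + 3) * poly (legendre_deriv (Suc k) 0) x =
          poly (legendre_deriv (Suc (Suc k)) 1) x - poly (legendre_deriv k 1) x"
        using arg_cong[OF legendre_deriv_diff[of k 0], of "\<lambda>p. poly p x"] by simp
      show ?thesis using 1 2 3 by (simp add: pderiv_mult pderiv_smult pderiv_diff pderiv_pCons) algebra
    qed
    then show ?thesis using l by (simp add: poly_eq_poly_eq_iff[symmetric] fun_eq_iff)
  qed
next
  case (Suc m)
  have "poly ([:1, 0, -1:] * legendre_deriv l (Suc (Suc (Suc m)))) x =
     poly (smult (2 * real (Suc (Suc m))) ([:0, 1:] * legendre_deriv l (Suc (Suc m)))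
     - smult ((real l - real (Suc m)) * (real l + real (Suc m) + 1)) (legendre_deriv l
         (Suc m))) x" for x
    using arg_cong[OF Suc, of "\<lambda>p. poly (pderiv p) x"]
    by (simp add: pderiv_mult pderiv_smult pderiv_diff pderiv_pCons) algebra
  then show ?case by (simp add: poly_eq_poly_eq_iff[symmetric] fun_eq_iff)
qed

lemma poly_legendre_ode:
  "(1 - x\<^sup>2) * poly (legendre_deriv l (Suc (Suc m))) x =
     2 * (real m + 1) * x * poly (legendre_deriv l (Suc m)) x
     - (real l - real m) * (real l + real m + 1) * poly (legendre_deriv l m) x"
  using arg_cong[OF legendre_ode[of l m], of "\<lambda>p. poly p x"] by
      (simp add: algebra_simps power2_eq_square)

lemma poly_legendre_deriv_diff:
  "(2 * real l + 3) * poly (legendre_deriv (Suc l) m) x =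
     poly (legendre_deriv (Suc (Suc l)) (Suc m)) x - poly (legendre_deriv l (Suc m)) x"
  using arg_cong[OF legendre_deriv_diff[of l m], of "\<lambda>p. poly p x"] by simp

text \<open>Induction on the order: differentiating the product with \<open>x\<close> leaves an
  extra derivative of order \<open>m\<close>, which \<open>poly_legendre_deriv_diff\<close> converts
  into the two neighbouring degrees.\<close>

lemma poly_legendre_X:
  "(2 * real l + 3) * (x * poly (legendre_deriv (Suc l) m) x) =
     (real l + 2 - real m) * poly (legendre_deriv (Suc (Suc l)) m) x
     + (real l + 1 + real m) * poly (legendre_deriv l m) x"
proof -
  have *: "smult (real l + 2 - real m) (legendre_deriv (Suc (Suc l)) m) =
     smult (2 * real l + 3) ([:0, 1:] * legendre_deriv (Suc l) m) - smult (real l + 1 + real m)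
         (legendre_deriv l m)"
  proof (induction m)
    case 0
    show ?case using legendre_poly_three_term[of l] by (simp add: legendre_deriv_def)
  next
    case (Suc m)
    have "poly (smult (real l + 2 - real (Suc m)) (legendre_deriv (Suc (Suc l)) (Suc m))) x =
      poly (smult (2 * real l + 3) ([:0, 1:] * legendre_deriv (Suc l) (Suc m)) - smult
          (real l + 1 + real (Suc m)) (legendre_deriv l (Suc m))) x" for x
      using arg_cong[OF Suc, of "\<lambda>p. poly (pderiv p) x"] poly_legendre_deriv_diff[of l m x]
      by (simp add: pderiv_mult pderiv_smult pderiv_diff pderiv_pCons) algebra
    then show ?case by (simp add: poly_eq_poly_eq_iff[symmetric] fun_eq_iff)
  qed
  show ?thesis using arg_cong[OF *, of "\<lambda>p. poly p x"] by simp
qed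

text \<open>The order drops by one at the price of the weight \<open>1 - x^2\<close>; this is the
  relation behind multiplication by \<open>cnj (zonal_var x)\<close>.\<close>

lemma poly_legendre_lower:
  "(2 * real l + 3) * ((1 - x\<^sup>2) * poly (legendre_deriv (Suc l) (Suc m)) x) =
     (real l + 2 + real m) * (real l + 1 + real m) * poly (legendre_deriv l m) x
     - (real l + 1 - real m) * (real l + 2 - real m) * poly (legendre_deriv (Suc (Suc l)) m) x"
  using poly_legendre_deriv_diff[of l "Suc m" x] poly_legendre_deriv_diff[of l m x]
    poly_legendre_ode[of x "Suc (Suc l)" m] poly_legendre_ode[of x l m] poly_legendre_X[of l x m]
  by simp algebra

section \<open>Integrals of Legendre polynomials\<close>

definition poly_integral :: "real poly \<Rightarrow> real" where
  "poly_integral p = integral {-1..1} (poly p)"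

lemma poly_integrable_on: "poly p integrable_on {a..b::real}"
  by (intro integrable_continuous_real continuous_intros)

lemma poly_integral_add: "poly_integral (p + q) = poly_integral p + poly_integral q"
  by (simp add: poly_integral_def poly_add[abs_def] integral_add poly_integrable_on)

lemma poly_integral_diff: "poly_integral (p - q) = poly_integral p - poly_integral q"
  by (simp add: poly_integral_def poly_diff[abs_def] integral_diff poly_integrable_on)

lemma poly_integral_smult: "poly_integral (smult c p) = c * poly_integral p"
  by (simp add: poly_integral_def poly_smult[abs_def])

lemma poly_integral_1: "poly_integral 1 = 2"
  by (simp add: poly_integral_def poly_1[abs_def])

lemma poly_integral_pderiv: "poly_integral (pderiv p) = poly p 1 - poly p (-1)"
proof -
  have "(poly (pderiv p) has_integral poly p 1 - poly p (-1)) {-1..1}"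
    by (rule fundamental_theorem_of_calculus)
      (auto intro!: DERIV_subset[OF poly_DERIV] simp flip:
          has_real_derivative_iff_has_vector_derivative)
  then show ?thesis by (simp add: poly_integral_def integral_unique)
qed

text \<open>\<open>F\<close> is the weighted Wronskian of the two polynomials. Its derivative is the
  difference of the eigenvalues times the product, and the weight makes \<open>F\<close> vanish at
  both endpoints.\<close>

lemma poly_integral_legendre_orth:
  assumes "b \<noteq> c"
  shows "poly_integral (legendre_poly b * legendre_poly c) = 0"
proof -
  let ?w = "[:1, 0, -1:] :: real poly"
  let ?p = "legendre_deriv b" let ?q = "legendre_deriv c"
  define F where "F = ?w * (?p 1 * ?q 0 - ?p 0 * ?q 1)"
  have "poly (pderiv F) x = poly (smult (real c * (real c + 1) - real b * (real b + 1)) (?p 0 * ?q 0))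
      x" for x
    unfolding F_def using poly_legendre_ode[of x b 0] poly_legendre_ode[of x c 0]
    by (simp add: pderiv_mult pderiv_diff pderiv_pCons) algebra
  then have "pderiv F = smult (real c * (real c + 1) - real b * (real b + 1)) (?p 0 * ?q 0)"
    by (simp add: poly_eq_poly_eq_iff[symmetric] fun_eq_iff)
  moreover have "poly_integral (pderiv F) = 0"
    by (simp add: poly_integral_pderiv F_def)
  ultimately have "(real c * (real c + 1) - real b * (real b + 1)) * poly_integral (?p 0 * ?q 0) = 0"
    by (simp add: poly_integral_smult)
  moreover have "real c * (real c + 1) - real b * (real b + 1) = (real c - real b) * (real c + real b +
      1)"
    by (simp add: algebra_simps)
  moreover have "real c + real b + 1 \<noteq> 0" by linarith
  ultimately show ?thesis using assms by (auto simp: legendre_deriv_def)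
qed

text \<open>In the integral \<open>?X\<close> of \<open>t\<close> times two consecutive polynomials,
  \<open>t\<close> can be expanded against either factor; comparing the two results links the norms
  of degrees \<open>l\<close> and \<open>l + 1\<close>.\<close>

lemma poly_integral_legendre_norm: "poly_integral (legendre_poly l * legendre_poly l) =
    2 / (2 * real l + 1)"
proof (induction l)
  case 0
  then show ?case by (simp add: legendre_poly_0 poly_integral_1)
next
  case (Suc l)
  let ?I = "\<lambda>b c. poly_integral (legendre_poly b * legendre_poly c)"
  let ?X = "poly_integral ([:0, 1:] * legendre_poly l * legendre_poly (Suc l))"
  have 1: "(2 * real l + 3) * ?X = (real l + 1) * ?I l l"
  proof -
    have "smult (2 * real l + 3) ([:0, 1:] * legendre_poly l * legendre_poly (Suc l)) =
      legendre_poly l * (smult (real l + 2) (legendre_poly (Suc (Suc l))) + smult (real l + 1)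
          (legendre_poly l))"
      unfolding legendre_poly_three_term by (simp add: mult_ac)
    then have "(2 * real l + 3) * ?X = poly_integral (legendre_poly l * (smult (real l +
        2) (legendre_poly (Suc (Suc l))) + smult (real l + 1) (legendre_poly l)))"
      by (metis poly_integral_smult)
    then show ?thesis
      using poly_integral_legendre_orth[of l "Suc (Suc l)"] by
          (simp only: distrib_left poly_integral_add poly_integral_smult mult_smult_right)
  qed
  have 2: "(2 * real l + 1) * ?X = (real l + 1) * ?I (Suc l) (Suc l)"
  proof (cases l)
    case 0
    then show ?thesis by (simp add: legendre_poly_0 legendre_poly_1)
  next
    case (Suc k)
    have "smult (2 * real k + 3) ([:0, 1:] * legendre_poly (Suc k) * legendre_poly (Suc (Suc k))) =
      legendre_poly (Suc (Suc k)) * (smult (real k + 2) (legendre_poly (Suc (Suc k))) + smult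
          (real k + 1) (legendre_poly k))"
      unfolding legendre_poly_three_term by (simp add: mult_ac)
    then have "(2 * real k + 3) * ?X = poly_integral (legendre_poly (Suc (Suc k)) * (smult (real k +
        2) (legendre_poly (Suc (Suc k))) + smult (real k + 1) (legendre_poly k)))"
      unfolding Suc by (metis poly_integral_smult)
    then show ?thesis
      using poly_integral_legendre_orth[of "Suc (Suc k)" k]
      unfolding Suc by (simp only: distrib_left poly_integral_add poly_integral_smult mult_smult_right)
          (simp add: algebra_simps)
  qed
  have "(2 * real l + 3) * ?I (Suc l) (Suc l) = (2 * real l + 1) * ?I l l"
  proof -
    have "(real l + 1) * ((2 * real l + 3) * ?I (Suc l) (Suc l)) = (real l + 1) * ((2 * real l +
        1) * ?I l l)"
      using 1 2 by algebra
    then show ?thesis by (subst (asm) mult_left_cancel) linarith+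
  qed
  also have "\<dots> = 2" using Suc by (simp add: field_simps)
  finally show ?case by (simp add: field_simps)
qed

lemma poly_integral_legendre:
  "poly_integral (legendre_poly b * legendre_poly c) = (if b = c then 2 / (2 * real b + 1) else 0)"
  using poly_integral_legendre_orth poly_integral_legendre_norm by simp

lemma pderiv_weight_power:
  "pderiv ([:1, 0, -1::real:] ^ Suc m) = smult (- 2 * real (Suc m)) ([:0, 1:] * [:1, 0, -1:] ^ m)"
  unfolding pderiv_power_Suc by (simp add: poly_eq_poly_eq_iff[symmetric] fun_eq_iff pderiv_pCons
      algebra_simps)

text \<open>Integration by parts. By the differential equation, differentiating the weight of power
  \<open>m + 1\<close> times \<open>legendre_deriv b (Suc m)\<close> gives a multiple of the weight
  of power \<open>m\<close> times \<open>legendre_deriv b m\<close>.\<close>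

lemma poly_integral_assoc_legendre_Suc:
  "poly_integral ([:1, 0, -1:] ^ Suc m * (legendre_deriv b (Suc m) * legendre_deriv c (Suc m))) =
     (real b - real m) * (real b + real m + 1) *
       poly_integral ([:1, 0, -1:] ^ m * (legendre_deriv b m * legendre_deriv c m))"
proof -
  let ?w = "[:1, 0, -1:] :: real poly"
  define F where "F = ?w ^ Suc m * legendre_deriv b (Suc m) * legendre_deriv c m"
  have "poly (pderiv F) x = poly (?w ^ Suc m * (legendre_deriv b (Suc m) * legendre_deriv c (Suc m))
    - smult ((real b - real m) * (real b + real m + 1)) (?w ^ m *
        (legendre_deriv b m * legendre_deriv c m))) x" for x
  proof -
    define W where "W = (1 - x * x) ^ m"
    show ?thesis
      unfolding F_def pderiv_mult pderiv_weight_power using poly_legendre_ode[of x b m]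
      by (simp add: power2_eq_square flip: W_def) algebra
  qed
  then have "pderiv F = ?w ^ Suc m * (legendre_deriv b (Suc m) * legendre_deriv c (Suc m))
    - smult ((real b - real m) * (real b + real m + 1)) (?w ^ m *
        (legendre_deriv b m * legendre_deriv c m))"
    by (simp add: poly_eq_poly_eq_iff[symmetric] fun_eq_iff)
  moreover have "poly_integral (pderiv F) = 0"
    by (simp add: poly_integral_pderiv F_def)
  ultimately show ?thesis by (simp add: poly_integral_diff poly_integral_smult)
qed

lemma poly_integral_assoc_legendre:
  assumes "m \<le> l"
  shows "poly_integral ([:1, 0, -1:] ^ m * (legendre_deriv l m * legendre_deriv l' m)) =
     (if l = l' then 2 / (2 * real l + 1) * (fact (l + m) / fact (l - m)) else 0)"
  using assms
proof (induction m)
  case 0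
  then show ?case using poly_integral_legendre[of l l'] by (simp add: legendre_deriv_def)
next
  case (Suc m)
  have *: "fact (l + Suc m) / fact (l - Suc m) = (real l - real m) * (real l + real m + 1) * (fact (l +
      m) / fact (l - m) :: real)"
  proof -
    obtain k where k: "l = Suc (m + k)" using Suc.prems by (metis le_Suc_ex add_Suc)
    have "l - m = Suc k" "l - Suc m = k" using k by simp_all
    moreover have "real k + 1 \<noteq> 0" by linarith
    ultimately show ?thesis by (simp add: k divide_simps)
  qed
  show ?case
    unfolding poly_integral_assoc_legendre_Suc * using Suc by simp
qed

section \<open>Integrals of a Legendre polynomial and two associated Legendre functions of equal
  order\<close>

definition gaunt_integral :: "nat \<Rightarrow> nat \<Rightarrow> nat \<Rightarrow> nat \<Rightarrow> real" where
  "gaunt_integral a b c m =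
     poly_integral ([:1, 0, -1:] ^ m * (legendre_deriv a 0 * legendre_deriv b m * legendre_deriv c m))"

text \<open>Both recurrences express that the Legendre operator is self-adjoint and has \<open>P\<^sub>a\<close> as an
  eigenfunction.\<close>

lemma gaunt_integral_rec_0:
  "(real a * (real a + 1) - real b * (real b + 1) - real c * (real c + 1)) * gaunt_integral a b c 0
     + 2 * gaunt_integral a b c 1 = 0"
proof -
  let ?w = "[:1, 0, -1:] :: real poly"
  let ?p = "legendre_deriv a" let ?q = "legendre_deriv b" let ?r = "legendre_deriv c"
  define F where "F = ?w * (?p 0 * (?q 1 * ?r 0 + ?q 0 * ?r 1) - ?p 1 * ?q 0 * ?r 0)"
  have "poly (pderiv F) x = poly (smult (real a * (real a + 1) - real b * (real b +
      1) - real c * (real c + 1))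
     (?p 0 * ?q 0 * ?r 0) + smult 2 (?w * (?p 0 * ?q 1 * ?r 1))) x" for x
    unfolding F_def using poly_legendre_ode[of x a 0] poly_legendre_ode[of x b 0] poly_legendre_ode[of
        x c 0]
    by (simp add: pderiv_mult pderiv_diff pderiv_add pderiv_pCons) algebra
  then have "pderiv F = smult (real a * (real a + 1) - real b * (real b + 1) - real c * (real c + 1))
     (?p 0 * ?q 0 * ?r 0) + smult 2 (?w * (?p 0 * ?q 1 * ?r 1))"
    by (simp add: poly_eq_poly_eq_iff[symmetric] fun_eq_iff)
  moreover have "poly_integral (pderiv F) = 0"
    by (simp add: poly_integral_pderiv F_def)
  ultimately show ?thesis by (simp add: poly_integral_add poly_integral_smult gaunt_integral_def)
qed

lemma gaunt_integral_rec_Suc: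
  defines "M \<equiv> \<lambda>m. real m + 1"
  shows "(real a * (real a + 1) - (real b - M m + 1) * (real b + M m) - (real c + M m +
      1) * (real c - M m))
       * gaunt_integral a b c (Suc m)
     + (real b - M m + 1) * (real b + M m) * (real c - M m + 1) *
         (real c + M m) * gaunt_integral a b c m
     + gaunt_integral a b c (Suc (Suc m)) = 0"
proof -
  let ?w = "[:1, 0, -1:] :: real poly" let ?m = "Suc m"
  let ?p = "legendre_deriv a" let ?q = "legendre_deriv b" let ?r = "legendre_deriv c"
  let ?A = "real a * (real a + 1) - (real b - M m + 1) * (real b + M m) - (real c + M m +
      1) * (real c - M m)"
  let ?B = "(real b - M m + 1) * (real b + M m) * (real c - M m + 1) * (real c + M m)"
  \<comment> \<open>Let \<open>u\<close> be \<open>?w ^ Suc m\<close> times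
    \<open>?q ?m * ?r ?m\<close>. Then \<open>?w ^ Suc m * Z\<close> is \<open>?w\<close> times the
    derivative of \<open>u\<close>, and \<open>F\<close> below is the weighted Wronskian of
    \<open>legendre_poly a\<close> and \<open>u\<close>.\<close>
  define Z where "Z = smult (- 2 * M m) ([:0, 1:] * ?q ?m * ?r ?m) + ?w * (?q (Suc ?m) * ?r ?m +
      ?q ?m * ?r (Suc ?m))"
  define F where "F = ?w ^ Suc m * (?p 0 * Z - ?w * (?p 1 * ?q ?m * ?r ?m))"
  have "poly (pderiv F) x = poly (smult ?A (?w ^ ?m * (?p 0 * ?q ?m * ?r ?m)) +
      smult ?B (?w ^ m * (?p 0 * ?q m * ?r m))
      + ?w ^ Suc ?m * (?p 0 * ?q (Suc ?m) * ?r (Suc ?m))) x" for x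
  proof -
    define P0 P1 P2 where P: "P0 = poly (?p 0) x" "P1 = poly (?p 1) x" "P2 = poly (?p (Suc 1)) x"
    define Q0 Q1 Q2 Q3 where Q: "Q0 = poly (?q m) x" "Q1 = poly (?q ?m) x" "Q2 = poly (?q (Suc ?m)) x"
        "Q3 = poly (?q (Suc (Suc ?m))) x"
    define R0 R1 R2 R3 where R: "R0 = poly (?r m) x" "R1 = poly (?r ?m) x" "R2 = poly (?r (Suc ?m)) x"
        "R3 = poly (?r (Suc (Suc ?m))) x"
    define w where "w = 1 - x\<^sup>2"
    define W where "W = w ^ m"
    define A B C M' where ABC: "A = real a" "B = real b" "C = real c" "M' = M m"
    have o1: "w * P2 = 2 * x * P1 - A * (A + 1) * P0"
      using poly_legendre_ode[of x a 0] by (simp add: P w_def ABC)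
    have o2: "w * Q2 = 2 * M' * x * Q1 - (B - M' + 1) * (B + M') * Q0"
      using poly_legendre_ode[of x b m] by (simp add: Q w_def ABC M_def algebra_simps)
    have o3: "w * Q3 = 2 * (M' + 1) * x * Q2 - (B - M') * (B + M' + 1) * Q1"
      using poly_legendre_ode[of x b "Suc m"] by (simp add: Q w_def ABC M_def algebra_simps)
    have o4: "w * R2 = 2 * M' * x * R1 - (C - M' + 1) * (C + M') * R0"
      using poly_legendre_ode[of x c m] by (simp add: R w_def ABC M_def algebra_simps)
    have o5: "w * R3 = 2 * (M' + 1) * x * R2 - (C - M') * (C + M' + 1) * R1"
      using poly_legendre_ode[of x c "Suc m"] by (simp add: R w_def ABC M_def algebra_simps)
    define z where "z = - 2 * M' * x * Q1 * R1 + w * (Q2 * R1 + Q1 * R2)"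
    have wx: "poly ?w x = w" by (simp add: w_def power2_eq_square)
    have wm: "poly (?w ^ Suc m) x = w * W" by (simp add: W_def poly_power w_def power2_eq_square)
    have pz: "poly Z x = z"
      by (simp add: Z_def z_def P Q R ABC w_def algebra_simps power2_eq_square)
    have pZ: "poly (pderiv Z) x = - (2 * M' + (B - M') * (B + M' + 1) + (C - M') * (C + M' +
        1)) * Q1 * R1 + 2 * w * Q2 * R2"
      unfolding Z_def
      using o3 o5 by (simp add: pderiv_add pderiv_diff pderiv_mult pderiv_smult pderiv_pCons P Q R ABC
          w_def) algebra
    have pW: "poly (pderiv (?w ^ Suc m)) x = - 2 * M' * x * W"
      unfolding pderiv_weight_power by (simp add: ABC M_def W_def poly_power w_def power2_eq_square
          algebra_simps)
    have "poly (pderiv F) x = w * W * (P0 * poly (pderiv Z) x + P1 * z - (w * P2 * Q1 * R1 +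
        w * P1 * Q2 * R1 + w * P1 * Q1 * R2 - 2 * x * P1 * Q1 * R1))
       + (P0 * z - w * P1 * Q1 * R1) * (- 2 * M' * x * W)"
    proof -
      define H where "H = ?p 0 * Z - ?w * (?p 1 * ?q ?m * ?r ?m)"
      have "poly H x = P0 * z - w * P1 * Q1 * R1"
        by (simp add: H_def pz P Q R w_def power2_eq_square)
      moreover have "poly (pderiv H) x = P0 * poly (pderiv Z) x + P1 * z - (w * P2 * Q1 * R1 +
          w * P1 * Q2 * R1 + w * P1 * Q1 * R2 - 2 * x * P1 * Q1 * R1)"
        by (simp add: H_def pderiv_mult pderiv_diff pderiv_pCons pz P Q R w_def algebra_simps
            power2_eq_square)
      moreover have "poly (pderiv F) x = poly (?w ^ Suc m) x * poly (pderiv H) x +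
          poly H x * poly (pderiv (?w ^ Suc m)) x"
        by (simp only: F_def H_def pderiv_mult[of "?w ^ Suc m"] poly_add poly_mult)
      ultimately show ?thesis by (simp only: wm pW)
    qed
    also have "\<dots> = (A * (A + 1) - (B - M' + 1) * (B + M') - (C + M' + 1) * (C - M')) * (w * W * (P0 *
        Q1 * R1))
        + (B - M' + 1) * (B + M') * (C - M' + 1) * (C + M') * (W * (P0 * Q0 * R0)) + w * (w * W) *
            (P0 * Q2 * R2)"
    proof -
      \<comment> \<open>The differential equation expresses \<open>2 * M' * x * Q1 - w * Q2\<close>
        through \<open>Q0\<close>, and likewise for \<open>R\<close>. Multiplying the two
        expressions trades the factor \<open>x\<close> for the orders one lower and one higher,
        which gives the recurrence its three terms.\<close>
      have a1: "2 * M' * x * z = (w * Q2) * (w * R2) - ((B - M' + 1) * (B + M') * Q0) * ((C - M' +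
          1) * (C + M') * R0)"
        unfolding z_def using o2 o4 by algebra
      have a2: "w * (P0 * poly (pderiv Z) x + P1 * z - (w * P2 * Q1 * R1 + w * P1 * Q2 * R1 +
          w * P1 * Q1 * R2 - 2 * x * P1 * Q1 * R1)) + 2 * M' * x * w * P1 * Q1 * R1
        = w * ((A * (A + 1) - (B - M' + 1) * (B + M') - (C + M' + 1) * (C - M')) *
            (P0 * Q1 * R1) + 2 * w * P0 * Q2 * R2)"
        unfolding pZ z_def o1 by (simp add: algebra_simps)
      have "w * W * (P0 * poly (pderiv Z) x + P1 * z - (w * P2 * Q1 * R1 + w * P1 * Q2 * R1 +
          w * P1 * Q1 * R2 - 2 * x * P1 * Q1 * R1))
       + (P0 * z - w * P1 * Q1 * R1) * (- 2 * M' * x * W)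
       = W * (w * (P0 * poly (pderiv Z) x + P1 * z - (w * P2 * Q1 * R1 + w * P1 * Q2 * R1 + w * P1 * Q1
           * R2 - 2 * x * P1 * Q1 * R1)) + 2 * M' * x * w * P1 * Q1 * R1)
         - W * P0 * (2 * M' * x * z)" by (simp add: algebra_simps)
      then show ?thesis unfolding a1 a2 by (simp add: algebra_simps)
    qed
    also have "\<dots> = poly (smult ?A (?w ^ ?m * (?p 0 * ?q ?m * ?r ?m)) +
        smult ?B (?w ^ m * (?p 0 * ?q m * ?r m))
      + ?w ^ Suc ?m * (?p 0 * ?q (Suc ?m) * ?r (Suc ?m))) x"
      by (simp only: poly_add poly_smult poly_mult poly_power power_Suc wx P Q R ABC W_def)
    finally show ?thesis .
  qed
  then have "pderiv F = smult ?A (?w ^ ?m * (?p 0 * ?q ?m * ?r ?m)) +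
      smult ?B (?w ^ m * (?p 0 * ?q m * ?r m))
      + ?w ^ Suc ?m * (?p 0 * ?q (Suc ?m) * ?r (Suc ?m))"
    by (simp add: poly_eq_poly_eq_iff[symmetric] fun_eq_iff)
  moreover have "poly_integral (pderiv F) = 0"
    by (simp add: poly_integral_pderiv F_def)
  ultimately show ?thesis by (simp add: poly_integral_add poly_integral_smult gaunt_integral_def)
qed

section \<open>Adams' formula for the integral of three Legendre polynomials\<close>

lemma legendre_poly_X:
  "smult (2 * real l + 1) ([:0, 1:] * legendre_poly l) =
     smult (real l + 1) (legendre_poly (Suc l)) + smult (real l) (legendre_poly (l - 1))"
proof (cases l)
  case 0
  then show ?thesis by (simp add: legendre_poly_0 legendre_poly_1)
next
  case (Suc k)
  show ?thesis using legendre_poly_three_term[of k] by (simp add: Suc algebra_simps)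
qed

definition legendre_triple :: "nat \<Rightarrow> nat \<Rightarrow> nat \<Rightarrow> real" where
  "legendre_triple a b c = poly_integral (legendre_poly a * legendre_poly b * legendre_poly c)"

text \<open>A factor \<open>t\<close> in the integral can be absorbed by
  \<open>legendre_poly a\<close> or by \<open>legendre_poly b\<close>; Bonnet's recurrence evaluates
  both. A truncated index \<open>a - 1\<close> or \<open>b - 1\<close> always carries a zero
  factor.\<close>

lemma legendre_triple_rec:
  "(2 * real b + 1) * ((real a + 1) * legendre_triple (Suc a) b c + real a * legendre_triple (a - 1) b
      c) =
   (2 * real a + 1) * ((real b + 1) * legendre_triple a (Suc b) c + real b * legendre_triple a
       (b - 1) c)"
proof -
  let ?P = legendre_poly
  have *: "(2 * real a + 1) * poly_integral ([:0, 1:] * ?P a * q) =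
     (real a + 1) * poly_integral (?P (Suc a) * q) + real a * poly_integral (?P (a - 1) * q)" for a q
  proof -
    have "(2 * real a + 1) * poly_integral ([:0, 1:] * ?P a * q) = poly_integral (smult (2 * real a +
        1) ([:0, 1:] * ?P a) * q)"
      by (simp add: poly_integral_smult)
    also have "\<dots> = (real a + 1) * poly_integral (?P (Suc a) * q) + real a * poly_integral (?P (a - 1) *
        q)"
      by (simp add: legendre_poly_X distrib_right poly_integral_add poly_integral_smult)
    finally show ?thesis .
  qed
  show ?thesis
    using *[of a "?P b * ?P c"] *[of b "?P a * ?P c"]
    by (simp add: legendre_triple_def mult_ac) algebra
qed

text \<open>The central binomial coefficient of \<open>2 n\<close> over \<open>n\<close>, divided by
  \<open>4 ^ n\<close>. Extension by zero to negative integers makes its recursion valid everywhere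
  and encodes the triangle rule.\<close>

definition adams_coeff :: "int \<Rightarrow> real" where
  "adams_coeff n = (if n < 0 then 0 else fact (2 * nat n) / (4 ^ nat n * (fact (nat n))\<^sup>2))"

lemma adams_coeff_Suc: "(2 * of_int n + 2) * adams_coeff (n + 1) = (2 * of_int n + 1) * adams_coeff n"
proof (cases "n \<ge> 0")
  case True
  then obtain k where k: "n = int k" by (metis nat_0_le)
  have "nat (n + 1) = Suc k" using k by simp
  moreover have "real k + 1 \<noteq> 0" by linarith
  ultimately show ?thesis
    using k by (simp add: adams_coeff_def divide_simps power2_eq_square) (simp add: algebra_simps)
next
  case False
  then show ?thesis by (cases "n = -1") (simp_all add: adams_coeff_def)
qed

lemma adams_coeff_neg [simp]: "n < 0 \<Longrightarrow> adams_coeff n = 0"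
  by (simp add: adams_coeff_def)

lemma adams_coeff_0 [simp]: "adams_coeff 0 = 1"
  by (simp add: adams_coeff_def)

lemma adams_coeff_pos: "n \<ge> 0 \<Longrightarrow> adams_coeff n > 0"
  by (simp add: adams_coeff_def)

text \<open>Adams' closed form, with \<open>g\<close> half the sum of the degrees. A violated
  triangle inequality makes one of \<open>g - a\<close>, \<open>g - b\<close>, \<open>g - c\<close>
  negative, and with it a factor zero.\<close>

definition adams :: "int \<Rightarrow> int \<Rightarrow> int \<Rightarrow> real" where
  "adams a b c = (if even (a + b + c) then
     (let g = (a + b + c) div 2 in
       2 * adams_coeff (g - a) * adams_coeff (g - b) * adams_coeff (g - c) /
           ((2 * of_int g + 1) * adams_coeff g)) else 0)"

lemma adams_even:
  "a + b + c = 2 * g \<Longrightarrow>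
   adams a b c = 2 * adams_coeff (g - a) * adams_coeff (g - b) * adams_coeff (g - c) /
       ((2 * of_int g + 1) * adams_coeff g)"
  by (simp add: adams_def)

lemma adams_odd: "odd (a + b + c) \<Longrightarrow> adams a b c = 0"
  by (simp add: adams_def)

text \<open>The recurrence for the closed form with denominators cleared. Here
  \<open>a + b + c = 2 * h + 1\<close>, and \<open>p\<close>, \<open>q\<close>, \<open>r\<close> are
  \<open>h - a\<close>, \<open>h - b\<close>, \<open>h - c\<close>.\<close>

lemma adams_core:
  fixes p q r :: int
  defines "a \<equiv> q + r + 1" and "b \<equiv> p + r + 1" and "c \<equiv> p + q + 1" and "h \<equiv> p + q + r + 1"
  assumes nn: "a \<ge> 0" "b \<ge> 0" "c \<ge> 0"
  shows "(2 * of_int b + 1) * ((of_int a + 1) * (2 * of_int h + 2) * adams_coeff p * adams_coeff (q +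
      1) * adams_coeff (r + 1)
           + of_int a * (2 * of_int h + 3) * adams_coeff (p + 1) * adams_coeff q * adams_coeff r) =
         (2 * of_int a + 1) * ((of_int b + 1) * (2 * of_int h + 2) * adams_coeff
             (p + 1) * adams_coeff q * adams_coeff (r + 1)
           + of_int b * (2 * of_int h + 3) * adams_coeff p * adams_coeff
               (q + 1) * adams_coeff r)" (is "?L = ?R")
proof -
  note S = adams_coeff_Suc[of p] adams_coeff_Suc[of q] adams_coeff_Suc[of r]
  \<comment> \<open>At -1 the coefficient jumps from 0 to 1 and its recursion says nothing. Further
    down both coefficients involved are zero, and from 0 on the recursion can be solved for the next
    one.\<close>
  consider "p \<le> -2" | "q \<le> -2" | "r \<le> -2" | "p = -1" | "q = -1" | "r = -1" | "p \<ge> 0" "q \<ge> 0" "r \<ge> 0"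
    by linarith
  then show ?thesis
  proof cases
    case 7
    define x y z where xyz: "x = real_of_int p" "y = real_of_int q" "z = real_of_int r"
    have nz: "(2 * x + 2) * (2 * y + 2) * (2 * z + 2) \<noteq> 0"
        using 7 by (simp add: xyz add_nonneg_eq_0_iff)
    have "(2 * x + 2) * (2 * y + 2) * (2 * z + 2) * ?L = (2 * x + 2) * (2 * y + 2) * (2 * z + 2) * ?R"
      using S unfolding a_def b_def c_def h_def of_int_add of_int_1 xyz[symmetric] by algebra
    then show ?thesis using nz by (simp only: mult_cancel_left) simp
  next
    case 4
    then have "adams_coeff p = 0" "adams_coeff (p + 1) = 1" "real_of_int p = -1" by simp_all
    then show ?thesis unfolding a_def b_def c_def h_def of_int_add of_int_1 using S by algebra
  next
    case 5
    then have "adams_coeff q = 0" "adams_coeff (q + 1) = 1" "real_of_int q = -1" by simp_all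
    then show ?thesis unfolding a_def b_def c_def h_def of_int_add of_int_1 using S by algebra
  next
    case 6
    then have "adams_coeff r = 0" "adams_coeff (r + 1) = 1" "real_of_int r = -1" by simp_all
    then show ?thesis unfolding a_def b_def c_def h_def of_int_add of_int_1 using S by algebra
  qed simp_all
qed

lemma adams_rec:
  fixes a b c :: int
  assumes nn: "a \<ge> 0" "b \<ge> 0" "c \<ge> 0"
  shows "(2 * of_int b + 1) * ((of_int a + 1) * adams (a + 1) b c + of_int a * adams (a - 1) b c) =
   (2 * of_int a + 1) * ((of_int b + 1) * adams a (b + 1) c + of_int b * adams a (b - 1) c)"
proof (cases "odd (a + b + c)")
  case False
  then have o: "odd (a + 1 + b + c)" "odd (a - 1 + b + c)" "odd (a + (b + 1) + c)"
      "odd (a + (b - 1) + c)"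
    by presburger+
  show ?thesis using o[THEN adams_odd] by simp
next
  case True
  then obtain h where h: "a + b + c = 2 * h + 1" by (metis oddE)
  have h0: "h \<ge> 0" using h nn by linarith
  define p q r where pqr: "p = h - a" "q = h - b" "r = h - c"
  have abc: "a = q + r + 1" "b = p + r + 1" "c = p + q + 1" "h = p + q + r + 1"
    using h by (simp_all add: pqr)
  have A1: "adams (a + 1) b c = 2 * adams_coeff p * adams_coeff (q + 1) * adams_coeff (r +
      1) / ((2 * of_int (h + 1) + 1) * adams_coeff (h + 1))"
    by (subst adams_even[of _ _ _ "h + 1"]) (use h in \<open>simp_all add: pqr algebra_simps\<close>)
  have A2: "adams (a - 1) b c = 2 * adams_coeff (p + 1) * adams_coeff q * adams_coeff r / ((2 * of_int
      h + 1) * adams_coeff h)"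
    by (subst adams_even[of _ _ _ h]) (use h in \<open>simp_all add: pqr algebra_simps\<close>)
  have A3: "adams a (b + 1) c = 2 * adams_coeff (p + 1) * adams_coeff q * adams_coeff (r +
      1) / ((2 * of_int (h + 1) + 1) * adams_coeff (h + 1))"
    by (subst adams_even[of _ _ _ "h + 1"]) (use h in \<open>simp_all add: pqr algebra_simps\<close>)
  have A4: "adams a (b - 1) c = 2 * adams_coeff p * adams_coeff (q + 1) * adams_coeff r / ((2 * of_int
      h + 1) * adams_coeff h)"
    by (subst adams_even[of _ _ _ h]) (use h in \<open>simp_all add: pqr algebra_simps\<close>)
  define H where "H = real_of_int h"
  have H: "H \<ge> 0" using h0 by (simp add: H_def)
  define K where "K = adams_coeff h"
  have K: "K > 0" using adams_coeff_pos[OF h0] by (simp add: K_def)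
  have K': "adams_coeff (h + 1) = (2 * H + 1) / (2 * H + 2) * K"
    using adams_coeff_Suc[of h] H by (simp add: H_def K_def field_simps)
  \<comment> \<open>\<open>inv\<close> and \<open>inv'\<close> bring the denominators at
    \<open>h + 1\<close> and at \<open>h\<close> to the common value
    \<open>(2 * H + 1) * (2 * H + 3) * K\<close>.\<close>
  have inv: "2 * X / ((2 * of_int (h + 1) + 1) * adams_coeff (h + 1)) = 2 * (2 * H + 2) * X / ((2 * H +
      1) * (2 * H + 3) * K)" for X
    using H K by (simp add: K' flip: H_def) (auto simp: divide_simps algebra_simps)
  have inv': "2 * X / ((2 * of_int h + 1) * adams_coeff h) = 2 * (2 * H + 3) * X / ((2 * H +
      1) * (2 * H + 3) * K)" for X
    using H K by (simp flip: H_def K_def) (simp add: divide_simps)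
  note core = adams_core[of q r p, folded abc, OF nn, folded H_def]
  show ?thesis
    unfolding A1 A2 A3 A4 mult.assoc[of 2] inv inv' add_divide_distrib[symmetric] times_divide_eq_right
    using core by (simp add: algebra_simps)
qed

text \<open>Both sides obey the same recurrence, and the case \<open>a = 0\<close> is orthogonality.
  The second degree is kept general in the induction because a step in \<open>a\<close> also moves
  \<open>b\<close>.\<close>

lemma legendre_triple_eq_adams: "legendre_triple a b c = adams (int a) (int b) (int c)"
proof (induction a arbitrary: b c rule: less_induct)
  case (less a)
  show ?case
  proof (cases a)
    case 0
    have "adams 0 (int b) (int c) = (if b = c then 2 / (2 * real b + 1) else 0)"
    proof (cases "even (b + c)")
      case True
      then obtain g where g: "b + c = 2 * g" by (metis evenE)
      have K: "adams_coeff (int g) > 0" by (rule adams_coeff_pos) simp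
      show ?thesis
      proof (cases b c rule: linorder_cases)
        case equal
        then have "g = c" using g by simp
        then show ?thesis using equal K by (subst adams_even[of _ _ _ "int g"]) auto
      next
        case less
        then have "adams_coeff (int g - int c) = 0" using g by simp
        then show ?thesis using less g by (subst adams_even[of _ _ _ "int g"]) auto
      next
        case greater
        then have "adams_coeff (int g - int b) = 0" using g by simp
        then show ?thesis using greater g by (subst adams_even[of _ _ _ "int g"]) auto
      qed
    next
      case False
      then show ?thesis by (auto simp: adams_def)
    qed
    then show ?thesis
      using 0 by (simp add: legendre_triple_def legendre_poly_0 poly_integral_legendre)
  next
    case (Suc k)
    have 1: "legendre_triple k b' c = adams (int k) (int b') (int c)" for b' using less Suc by blast
    have 2: "real k * legendre_triple (k - 1) b c = real k * adams (int k - 1) (int b) (int c)"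
      using less[of "k - 1"] Suc by (cases k) auto
    have 3: "real b * legendre_triple k (b - 1) c = real b * adams (int k) (int b - 1) (int c)"
      using 1 by (cases b) auto
    have "(2 * real b + 1) * ((real k + 1) * legendre_triple (Suc k) b c) =
          (2 * real b + 1) * ((real k + 1) * adams (int k + 1) (int b) (int c))"
    proof -
      have "int (Suc b) = int b + 1" by simp
      then have 4: "legendre_triple k (Suc b) c = adams (int k) (int b + 1) (int c)" using 1 by metis
      have 5: "(2 * real b + 1) * ((real k + 1) * adams (int k + 1) (int b) (int c) +
          real k * adams (int k - 1) (int b) (int c)) =
         (2 * real k + 1) * ((real b + 1) * adams (int k) (int b + 1) (int c) + real b * adams (int k)
             (int b - 1) (int c))"
        using adams_rec[of "int k" "int b" "int c"] by (simp only: of_int_of_nat_eq)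
      show ?thesis using legendre_triple_rec[of b k c] 2 3 4 5 by algebra
    qed
    moreover have "2 * real b + 1 \<noteq> 0" "real k + 1 \<noteq> 0" by linarith+
    ultimately show ?thesis using Suc by (simp add: add.commute)
  qed
qed

section \<open>Racah's sum\<close>

text \<open>The reciprocal Gamma function at \<open>k + 1\<close>. Its zeros at the negative
  integers make \<open>inv_fact_pred\<close> hold for all integers, so recurrences need no boundary
  cases.\<close>

definition inv_fact :: "int \<Rightarrow> real" where
  "inv_fact k = (if k < 0 then 0 else 1 / fact (nat k))"

lemma inv_fact_pred: "inv_fact (k - 1) = of_int k * inv_fact k"
proof (cases "k \<ge> 1")
  case True
  then obtain n where n: "k = int (Suc n)"
      by (metis Suc_nat_eq_nat_zadd1 add.commute diff_add_cancel int_nat_eq le_add_diff_inverse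
      zle_diff1_eq zle_iff_zadd of_nat_Suc)
  then show ?thesis by (simp add: inv_fact_def nat_add_distrib divide_simps)
next
  case False
  then show ?thesis by (cases "k = 0") (simp_all add: inv_fact_def)
qed

lemma inv_fact_neg [simp]: "k < 0 \<Longrightarrow> inv_fact k = 0"
  by (simp add: inv_fact_def)

lemma sum_int_telescope:
  fixes f :: "int \<Rightarrow> real"
  assumes "lo \<le> hi + 1"
  shows "(\<Sum>k\<in>{lo..hi}. f (k + 1) - f k) = f (hi + 1) - f lo"
proof -
  have "(\<Sum>k\<in>{lo..<j}. f (k + 1) - f k) = f j - f lo" if "lo \<le> j" for j
    using that
  proof (induction j rule: int_ge_induct)
    case (step i)
    have "{lo..<i + 1} = insert i {lo..<i}" using step by auto
    then show ?case using step by simp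
  qed simp
  from this[OF assms] show ?thesis
    by (simp add: atLeastLessThanPlusOne_atLeastAtMost_int)
qed

text \<open>Racah's summand with first projection 0, continued by zero; the sum may then be taken
  over any finite set containing the support.\<close>

definition racah_term :: "int \<Rightarrow> int \<Rightarrow> int \<Rightarrow> int \<Rightarrow> int \<Rightarrow> real" where
  "racah_term a b c m t = (-1) powi t *
     (inv_fact t * inv_fact (c - b + t) * inv_fact (c - a + t - m) * inv_fact (a + b - c - t) *
      inv_fact (a - t) * inv_fact (b - t + m))"

lemma wigner_3j_sum_eq:
  assumes "{t. racah_term a b c m t \<noteq> 0} \<subseteq> A" "finite A"
  shows "wigner_3j_sum a b c 0 m = sum (racah_term a b c m) A"
proof -
  let ?S = "{t. 0 \<le> t \<and> 0 \<le> c - b + t + 0 \<and> 0 \<le> c - a + t - m \<and> t \<le> a + b - c \<and> t \<le> a - 0 \<and> t \<le> b + m}"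
  have fin: "finite ?S" by (rule finite_subset[of _ "{0..a}"]) auto
  have z: "racah_term a b c m t = 0" if "t \<notin> ?S" for t
    using that by (auto simp: racah_term_def not_le)
  have "wigner_3j_sum a b c 0 m = sum (racah_term a b c m) ?S"
    unfolding wigner_3j_sum_def by (rule sum.cong) (auto simp: racah_term_def inv_fact_def divide_simps)
  also have "\<dots> = sum (racah_term a b c m) (?S \<union> A)"
    using z fin assms by (intro sum.mono_neutral_left) auto
  also have "\<dots> = sum (racah_term a b c m) A"
    using fin assms by (intro sum.mono_neutral_right) auto
  finally show ?thesis .
qed

lemma racah_term_support: "racah_term a b c m t \<noteq> 0 \<Longrightarrow> 0 \<le> t \<and> t \<le> a \<and> t \<le> a + b - c"
  by (rule ccontr) (auto simp: racah_term_def not_le)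

lemma wigner_3j_sum_eq_racah: "wigner_3j_sum a b c 0 m = sum (racah_term a b c m) {0..a}"
  using racah_term_support by (intro wigner_3j_sum_eq) auto

text \<open>Creative telescoping with certificate \<open>G\<close>, which vanishes at both ends of
  the range because a reciprocal factorial is taken at -1 there. The coefficients agree with
  \<open>gaunt_integral_rec_Suc\<close> once the integrals are divided by
  \<open>fact (b + m) * fact (c + m)\<close>.\<close>

lemma racah_rec:
  assumes "a \<ge> 0"
  shows "(of_int a * (of_int a + 1) - (of_int b - of_int m + 1) * (of_int b + of_int m) - (of_int c +
      of_int m + 1) * (of_int c - of_int m))
            * wigner_3j_sum a b c 0 m
     + (of_int b - of_int m + 1) * (of_int c - of_int m + 1) * wigner_3j_sum a b c 0 (m - 1)
     + (of_int c + of_int m + 1) * (of_int b + of_int m + 1) * wigner_3j_sum a b c 0 (m + 1) = 0"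
    (is "?K * _ + ?B * _ + ?C * _ = 0")
proof -
  define G where "G t = - (of_int b + of_int c + 1 - of_int a) * ((-1) powi t *
     (inv_fact (t - 1) * inv_fact (c - b + t - 1) * inv_fact (c - a + t - m) * inv_fact
         (a + b - c - t) *
      inv_fact (a - t) * inv_fact (b - t + m + 1)))" for t :: int
  have "?K * racah_term a b c m t + ?B * racah_term a b c (m - 1) t + ?C * racah_term a b c (m + 1) t
      = G (t + 1) - G t" for t
  proof -
    define p q where pq: "p = c - a + t - m" "q = b - t + m"
    have e: "c - a + t - (m - 1) = p + 1" "c - a + t - (m + 1) = p - 1" "b - t + (m - 1) = q - 1"
        "b - t + (m + 1) = q + 1"
      "c - a + (t + 1) - m = p + 1" "b - (t + 1) + m + 1 = q" "b - t + m + 1 = q + 1"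
      "a + b - c - (t + 1) = a + b - c - t - 1" "a - (t + 1) = a - t - 1"
          "c - b + (t + 1) - 1 = c - b + t" "t + 1 - 1 = t"
      by (simp_all add: pq)
    \<comment> \<open>All terms are expressed through one common product of reciprocal factorials,
      with \<open>p + 1\<close> and \<open>q + 1\<close> among its arguments; a polynomial identity
      remains.\<close>
    have f: "inv_fact p = (of_int p + 1) * inv_fact (p + 1)"
        "inv_fact (p - 1) = of_int p * ((of_int p + 1) * inv_fact (p + 1))"
      "inv_fact q = (of_int q + 1) * inv_fact (q + 1)"
          "inv_fact (q - 1) = of_int q * ((of_int q + 1) * inv_fact (q + 1))"
      using inv_fact_pred[of "p + 1"] inv_fact_pred[of p] inv_fact_pred[of "q + 1"] inv_fact_pred[of q]
          by simp_all
    have s: "(-1) powi (t + 1) = - ((-1) powi t :: real)" by (simp add: power_int_add)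
    have pr: "real_of_int p = of_int c - of_int a + of_int t - of_int m"
        "real_of_int q = of_int b - of_int t + of_int m"
      by (simp_all add: pq)
    show ?thesis
      unfolding racah_term_def G_def e pq[symmetric] f s inv_fact_pred pr of_int_add of_int_diff
      by algebra
  qed
  then have "(\<Sum>t\<in>{0..a}. ?K * racah_term a b c m t + ?B * racah_term a b c (m - 1) t +
      ?C * racah_term a b c (m + 1) t)
     = G (a + 1) - G 0"
    using assms by (simp only: sum_int_telescope)
  also have "\<dots> = 0" by (simp add: G_def)
  finally show ?thesis
    by (simp only: wigner_3j_sum_eq_racah sum.distrib sum_distrib_left)
qed

text \<open>The substitution exchanges the six factorials in three pairs, so that only the sign is
  affected.\<close>

lemma racah_term_reflect: "racah_term a b c (- m) (a + b - c - t) = (-1) powi (a + b - c) * racah_term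
    a b c m t"
proof -
  have "(-1) powi (a + b - c - t) = (-1) powi (a + b - c) * ((-1) powi t :: real)"
    by (auto simp: power_int_minus_left)
  moreover have "c - b + (a + b - c - t) = a - t" "c - a + (a + b - c - t) - - m = b - t + m"
     "a + b - c - (a + b - c - t) = t" "a - (a + b - c - t) = c - b + t"
         "b - (a + b - c - t) + - m = c - a + t - m"
    by simp_all
  ultimately show ?thesis by (simp only: racah_term_def mult_ac)
qed

lemma wigner_3j_sum_reflect: "wigner_3j_sum a b c 0 (- m) = (-1) powi (a + b - c) * wigner_3j_sum a b c
    0 m"
proof -
  have *: "wigner_3j_sum a b c 0 m = sum (racah_term a b c m) {0..a+b-c}" for m
    using racah_term_support by (intro wigner_3j_sum_eq) auto
  have "sum (racah_term a b c (- m)) {0..a+b-c} = sum (\<lambda>t. racah_term a b c (- m) (a +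
      b - c - t)) {0..a+b-c}"
    by (rule sum.reindex_bij_witness[of _ "\<lambda>t. a + b - c - t" "\<lambda>t. a + b - c - t"]) auto
  then show ?thesis by (simp only: * racah_term_reflect sum_distrib_left)
qed

section \<open>Dixon's identity\<close>

text \<open>Up to a factor independent of \<open>k\<close>, the alternating product of the binomial
  coefficients of \<open>2 x\<close> over \<open>x + k\<close>, \<open>2 y\<close> over
  \<open>y + k\<close> and \<open>2 z\<close> over \<open>z + k\<close>.\<close>

definition dixon_term :: "int \<Rightarrow> int \<Rightarrow> int \<Rightarrow> int \<Rightarrow> real" where
  "dixon_term x y z k = (-1) powi k *
     (inv_fact (x + k) * inv_fact (x - k) * inv_fact (y + k) * inv_fact (y - k) * inv_fact
         (z + k) * inv_fact (z - k))"

lemma dixon_term_support: "dixon_term x y z k \<noteq> 0 \<Longrightarrow> \<bar>k\<bar> \<le> z"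
proof (rule ccontr)
  assume *: "dixon_term x y z k \<noteq> 0" "\<not> \<bar>k\<bar> \<le> z"
  then have "z - k < 0 \<or> z + k < 0" by linarith
  then show False using *(1) by (auto simp: dixon_term_def)
qed

text \<open>Induction on \<open>z\<close> with a Wilf-Zeilberger certificate \<open>G\<close>. The
  range depends on \<open>N\<close> alone, so the sums for \<open>z\<close> and \<open>z + 1\<close>
  can be compared term by term; \<open>Suc z \<le> N\<close> makes \<open>G\<close> vanish at both
  ends.\<close>

lemma dixon:
  "z \<le> N \<Longrightarrow> (\<Sum>k\<in>{-int N..int N}. dixon_term (int x) (int y) (int z) k) =
     fact (x + y + z) / (fact x * fact y * fact z * fact (x + y) * fact (y + z) * fact (z + x))"
proof (induction z)
  case 0
  have "(\<Sum>k\<in>{-int N..int N}. dixon_term (int x) (int y) 0 k) = (\<Sum>k\<in>{0}. dixon_term (int x) (int y) 0 k)"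
    using dixon_term_support by (intro sum.mono_neutral_right) fastforce+
  then show ?case by (simp add: dixon_term_def inv_fact_def)
next
  case (Suc z)
  define X Y Z where XYZ: "X = real x" "Y = real y" "Z = real z"
  define G where "G k = - 1 / 2 * ((-1) powi k *
     (inv_fact (int x + k - 1) * inv_fact (int x - k) * inv_fact (int y + k - 1) * inv_fact (int y - k)
       * inv_fact (int z + k) * inv_fact (int z + 1 - k)))" for k
  have "(Z + 1) * (Y + Z + 1) * (X + Z + 1) * dixon_term (int x) (int y) (int z + 1) k
     - (X + Y + Z + 1) * dixon_term (int x) (int y) (int z) k = G (k + 1) - G k" for k
  proof -
    have e: "int x - (k + 1) = int x - k - 1" "int y - (k + 1) = int y - k - 1"
        "int z + (k + 1) = int z + 1 + k"
      "int z + 1 - (k + 1) = (int z + 1 - k) - 1" "int x + (k + 1) - 1 = int x + k"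
          "int y + (k + 1) - 1 = int y + k"
      by simp_all
    have f: "inv_fact (int z + k) = (Z + 1 + of_int k) * inv_fact (int z + 1 + k)"
      "inv_fact (int z - k) = (Z + 1 - of_int k) * inv_fact (int z + 1 - k)"
      using inv_fact_pred[of "int z + 1 + k"] inv_fact_pred[of "int z + 1 - k"] by
          (simp_all add: XYZ algebra_simps)
    have s: "(-1) powi (k + 1) = - ((-1) powi k :: real)" by (simp add: power_int_add)
    show ?thesis
      unfolding dixon_term_def G_def e f s inv_fact_pred of_int_add of_int_diff of_int_of_nat_eq
          XYZ[symmetric] of_int_1
      by algebra
  qed
  then have "(\<Sum>k\<in>{-int N..int N}. (Z + 1) * (Y + Z + 1) * (X + Z + 1) * dixon_term (int x) (int y)
      (int z + 1) k
     - (X + Y + Z + 1) * dixon_term (int x) (int y) (int z) k) = G (int N + 1) - G (- int N)"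
    by (simp only: sum_int_telescope)
  also have "\<dots> = 0" using Suc.prems by (simp add: G_def)
  finally have "(Z + 1) * (Y + Z + 1) * (X + Z + 1) * (\<Sum>k\<in>{-int N..int N}. dixon_term (int x) (int y)
      (int (Suc z)) k) =
     (X + Y + Z + 1) * (\<Sum>k\<in>{-int N..int N}. dixon_term (int x) (int y) (int z) k)"
    by (simp add: sum_subtractf sum_distrib_left add.commute)
  also have "(\<Sum>k\<in>{-int N..int N}. dixon_term (int x) (int y) (int z) k) = fact (x + y +
      z) / (fact x * fact y * fact z * fact (x + y) * fact (y + z) * fact (z + x))"
    using Suc by simp
  finally have *: "(Z + 1) * (Y + Z + 1) * (X + Z + 1) * (\<Sum>k\<in>{-int N..int N}. dixon_term (int x)
      (int y) (int (Suc z)) k) =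
     (X + Y + Z + 1) * (fact (x + y + z) / (fact x * fact y * fact z * fact (x + y) * fact
         (y + z) * fact (z + x)))" .
  have nz: "Z + 1 \<noteq> 0" "Y + Z + 1 \<noteq> 0" "X + Z + 1 \<noteq> 0" unfolding XYZ by linarith+
  have f: "fact (x + y + Suc z) = (X + Y + Z + 1) * (fact (x + y + z) :: real)"
      "fact (Suc z) = (Z + 1) * (fact z :: real)"
    "fact (y + Suc z) = (Y + Z + 1) * (fact (y + z) :: real)"
        "fact (Suc z + x) = (X + Z + 1) * (fact (z + x) :: real)"
    by (simp_all add: XYZ algebra_simps)
  show ?case
  proof -
    define S where "S = (\<Sum>k\<in>{-int N..int N}. dixon_term (int x) (int y) (int (Suc z)) k)"
    define D :: real where "D = fact x * fact y * fact z * fact (x + y) * fact (y + z) * fact (z + x)"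
    have "S = (X + Y + Z + 1) * (fact (x + y + z) / D) / ((Z + 1) * (Y + Z + 1) * (X + Z + 1))"
    proof -
      have "S = B / A" if "A * S = B" "A \<noteq> 0" for A B using that by auto
      from this[OF *[folded S_def D_def]] show ?thesis using nz by simp
    qed
    also have "\<dots> = (X + Y + Z + 1) * fact (x + y + z) / (D * ((Z + 1) * (Y + Z + 1) * (X + Z + 1)))"
      by simp
    also have "D * ((Z + 1) * (Y + Z + 1) * (X + Z + 1)) =
        fact x * fact y * ((Z + 1) * fact z) * fact (x + y) * ((Y + Z + 1) * fact (y + z)) *
            ((X + Z + 1) * fact (z + x))"
      by (simp add: D_def mult_ac)
    finally show ?thesis unfolding f S_def .
  qed
qed

text \<open>Here \<open>x\<close>, \<open>y\<close>, \<open>z\<close> are the half sum of the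
  degrees minus each degree. Shifting the summation index by \<open>z\<close> centres the six
  factorials and produces Dixon's sum.\<close>

lemma wigner_3j_sum_zero:
  "wigner_3j_sum (int (y + z)) (int (x + z)) (int (x + y)) 0 0 =
     (-1) ^ z * fact (x + y + z) / (fact x * fact y * fact z * fact (x + y) * fact (y + z) * fact
         (z + x))"
proof -
  let ?R = "racah_term (int (y + z)) (int (x + z)) (int (x + y)) 0"
  have sh: "?R (k + int z) = (-1) ^ z * dixon_term (int x) (int y) (int z) k" for k
    by (simp add: racah_term_def dixon_term_def power_int_add mult_ac add_ac)
  have "wigner_3j_sum (int (y + z)) (int (x + z)) (int (x + y)) 0 0 = sum ?R {0..2 * int z}"
    using racah_term_support by (intro wigner_3j_sum_eq) fastforce+
  also have "\<dots> = (\<Sum>k\<in>{- int z..int z}. ?R (k + int z))"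
    by (rule sum.reindex_bij_witness[of _ "\<lambda>k. k + int z" "\<lambda>t. t - int z"]) auto
  also have "\<dots> = (-1) ^ z * (\<Sum>k\<in>{- int z..int z}. dixon_term (int x) (int y) (int z) k)"
    by (simp only: sh sum_distrib_left)
  finally show ?thesis by (simp add: dixon)
qed

section \<open>Gaunt's integral in terms of 3j-symbols\<close>

text \<open>Two solutions of one recurrence in \<open>m\<close> are proportional. The relation is
  cross-multiplied so that no value at order 0 has to be nonzero; the factorials adapt the integral
  to the recurrence of Racah's sum.\<close>

lemma gaunt_integral_racah:
  assumes "even (a + b + c)"
  shows "gaunt_integral a b c m * wigner_3j_sum (int a) (int b) (int c) 0 0 * (fact b * fact c) =
     wigner_3j_sum (int a) (int b) (int c) 0 (int m) * gaunt_integral a b c 0 * (fact (b + m) * fact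
         (c + m))"
proof -
  define S where "S m = wigner_3j_sum (int a) (int b) (int c) 0 m" for m
  define r where "r m = gaunt_integral a b c m / (fact (b + m) * fact (c + m))" for m
  have g: "gaunt_integral a b c m = r m * (fact (b + m) * fact (c + m))" for m
    by (simp add: r_def)
  have rec0: "(real a * (real a + 1) - real b * (real b + 1) - real c * (real c + 1)) * r 0 +
      2 * (real b + 1) * (real c + 1) * r 1 = 0"
  proof -
    have "((real a * (real a + 1) - real b * (real b + 1) - real c * (real c + 1)) * r 0 +
        2 * (real b + 1) * (real c + 1) * r 1) * (fact b * fact c) = 0"
      using gaunt_integral_rec_0[of a b c] unfolding g by (simp add: algebra_simps)
    then show ?thesis by simp
  qed
  have recS: "(real a * (real a + 1) - (real b - M + 1) * (real b + M) - (real c + M +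
      1) * (real c - M)) * r (Suc n)
     + (real b - M + 1) * (real c - M + 1) * r n + (real c + M + 1) * (real b + M + 1) * r
         (Suc (Suc n)) = 0"
    if M: "M = real n + 1" for n M
  proof -
    have f: "fact (b + Suc n) = (real b + M) * (fact (b + n) :: real)"
        "fact (c + Suc n) = (real c + M) * (fact (c + n) :: real)"
      "fact (b + Suc (Suc n)) = (real b + M + 1) * ((real b + M) * (fact (b + n) :: real))"
      "fact (c + Suc (Suc n)) = (real c + M + 1) * ((real c + M) * (fact (c + n) :: real))"
      by (simp_all add: M algebra_simps)
    have "((real a * (real a + 1) - (real b - M + 1) * (real b + M) - (real c + M + 1) * (real c - M))
        * r (Suc n)
     + (real b - M + 1) * (real c - M + 1) * r n + (real c + M + 1) * (real b + M + 1) * r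
         (Suc (Suc n))) * ((real b + M) * (real c + M) * fact (b + n) * fact (c + n)) = 0"
      using gaunt_integral_rec_Suc[of a b n c] unfolding g f M[symmetric] by algebra
    moreover have "real b + M \<noteq> 0" "real c + M \<noteq> 0" unfolding M by linarith+
    ultimately show ?thesis by simp
  qed
  \<comment> \<open>Even parity makes Racah's sum symmetric in \<open>m\<close>. Its three-term
    relation at order 0 thus links only the values at 0 and 1, with the same factor 2 as for the
    integral.\<close>
  have "even (int a + int b - int c)" using assms by simp
  then have S1: "S (-1) = S 1"
    using wigner_3j_sum_reflect[of "int a" "int b" "int c" 1] by (simp add: S_def power_int_minus_left)
  have nz: "real c + real n + 1 \<noteq> 0" "real b + real n + 1 \<noteq> 0" for n by linarith+
  have main: "r m * S 0 = S (int m) * r 0" for m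
  proof (induction m rule: less_induct)
    case (less m)
    consider "m = 0" | "m = 1" | n where "m = Suc (Suc n)" by (metis One_nat_def not0_implies_Suc)
    then show ?case
    proof cases
      case 2
      have "(real a * (real a + 1) - (real b + 1) * real b - (real c + 1) * real c) * S 0 +
          2 * (real b + 1) * (real c + 1) * S 1 = 0"
        using racah_rec[of "int a" "int b" 0 "int c"] S1 by (simp add: S_def algebra_simps)
      then have "(real b + 1) * ((real c + 1) * (r 1 * S 0)) = (real b + 1) * ((real c +
          1) * (S 1 * r 0))"
        using rec0 by algebra
      then show ?thesis using nz[of 0] 2 by simp
    next
      case (3 n)
      define M where "M = real n + 1"
      have "(real a * (real a + 1) - (real b - M + 1) * (real b + M) - (real c + M + 1) * (real c - M))
          * S (int (Suc n))
         + (real b - M + 1) * (real c - M + 1) * S (int n) + (real c + M + 1) * (real b + M + 1) * S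
             (int (Suc (Suc n))) = 0"
        using racah_rec[of "int a" "int b" "int (Suc n)" "int c"] by (simp add: S_def M_def add_ac)
      moreover have "r n * S 0 = S (int n) * r 0" "r (Suc n) * S 0 = S (int (Suc n)) * r 0"
        using less 3 by auto
      ultimately have "(real c + M + 1) * ((real b + M + 1) * (r (Suc (Suc n)) * S 0)) = (real c + M +
          1) * ((real b + M + 1) * (S (int (Suc (Suc n))) * r 0))"
        using recS[OF M_def] by algebra
      moreover have "real c + M + 1 \<noteq> 0" "real b + M + 1 \<noteq> 0" unfolding M_def by linarith+
      ultimately show ?thesis using 3 by simp
    qed simp
  qed
  show ?thesis
    unfolding g using main[of m] by (simp add: S_def)
qed

text \<open>The recurrences determine every order from order 0. This settles the degrees of odd sum
  and those violating the triangle rule.\<close>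

lemma gaunt_integral_eq_0: "gaunt_integral a b c 0 = 0 \<Longrightarrow> gaunt_integral a b c m = 0"
proof (induction m rule: less_induct)
  case (less m)
  consider "m = 0" | "m = 1" | n where "m = Suc (Suc n)" by (metis One_nat_def not0_implies_Suc)
  then show ?case
  proof cases
    case 2
    then show ?thesis using gaunt_integral_rec_0[of a b c] less.prems by simp
  next
    case (3 n)
    then show ?thesis using gaunt_integral_rec_Suc[of a b n c] less.IH[of n] less.IH[of
        "Suc n"] less.prems by simp
  qed (use less in simp)
qed

lemma gaunt_integral_0: "gaunt_integral a b c 0 = adams (int a) (int b) (int c)"
  by (simp add: gaunt_integral_def legendre_deriv_def legendre_triple_def flip:
      legendre_triple_eq_adams)

text \<open>Reflection at order 0 equates Racah's sum with its own negative.\<close>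

lemma wigner_3j_zero_odd:
  assumes "odd (a + b + c)"
  shows "wigner_3j a b c 0 0 0 = 0"
proof -
  have "odd (int a + int b - int c)" using assms by simp
  then have "wigner_3j_sum (int a) (int b) (int c) 0 0 = 0"
    using wigner_3j_sum_reflect[of "int a" "int b" "int c" 0] by (simp add: power_int_minus_left)
  then show ?thesis by (simp add: wigner_3j_def Let_def)
qed

text \<open>Reflection can change the sign of the second symbol only for an odd sum of degrees, and
  then the first symbol is zero.\<close>

lemma wigner_3j_zero_reflect:
  "wigner_3j a b c 0 0 0 * wigner_3j a b c 0 (- m) m = wigner_3j a b c 0 0 0 * wigner_3j a b c 0 m
      (- m)"
proof (cases "even (a + b + c)")
  case True
  then have e: "even (int a + int b - int c)" by simp
  then have "wigner_3j_sum (int a) (int b) (int c) 0 (- m) = wigner_3j_sum (int a) (int b) (int c) 0 m"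
    using wigner_3j_sum_reflect[of "int a" "int b" "int c" m] by (simp add: power_int_minus_left)
  moreover have "(-1) powi (int a - int b - m) = ((-1) powi (int a - int b + m) :: real)"
    by (simp add: power_int_minus_left)
  ultimately show ?thesis by (simp add: wigner_3j_def Let_def mult_ac)
next
  case False
  then show ?thesis by (simp add: wigner_3j_zero_odd)
qed

text \<open>Separates the triangle factor of Racah's formula from a square, which is the shape that
  a product of two 3j-symbols produces.\<close>

lemma adams_eq_fact:
  "adams (int (y + z)) (int (x + z)) (int (x + y)) =
     2 * fact (2 * x) * fact (2 * y) * fact (2 * z) / fact (2 * (x + y + z) + 1) * (fact (x + y + z) /
         (fact x * fact y * fact z))\<^sup>2"
proof -
  have "adams (int (y + z)) (int (x + z)) (int (x + y)) =
     2 * adams_coeff (int x) * adams_coeff (int y) * adams_coeff (int z) /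
         ((2 * real (x + y + z) + 1) * adams_coeff (int (x + y + z)))"
    by (subst adams_even[of _ _ _ "int (x + y + z)"]) auto
  also have "\<dots> = 2 * fact (2 * x) * fact (2 * y) * fact (2 * z) / fact (2 * (x + y + z) +
      1) * (fact (x + y + z) / (fact x * fact y * fact z))\<^sup>2"
    by (simp add: adams_coeff_def power_add divide_simps power2_eq_square add_nonneg_eq_0_iff
        nat_add_distrib)
  finally show ?thesis .
qed

text \<open>Dixon's identity turns Adams' value at order 0 into
  \<open>2 * \<Delta> * (F * ?S 0)^2\<close>. Proportionality, divided by the nonzero
  \<open>?S 0\<close>, carries this to order \<open>m\<close>, and the square root on the left
  supplies the factorials of the second symbol.\<close>

lemma gaunt_integral_wigner:
  assumes m: "m \<le> b" "m \<le> c"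
  shows "gaunt_integral a b c m / 2 * sqrt (fact (b - m) * fact (c - m) / (fact (b + m) * fact (c +
      m))) =
     (-1) ^ m * (wigner_3j a b c 0 0 0 * wigner_3j a b c 0 (int m) (- int m))"
proof (cases "even (a + b + c) \<and> a \<le> b + c \<and> b \<le> a + c \<and> c \<le> a + b")
  case False
  then have "gaunt_integral a b c 0 = 0"
  proof (cases "even (a + b + c)")
    case True
    then obtain g where g: "a + b + c = 2 * g" by (metis evenE)
    have "adams (int a) (int b) (int c) = 2 * adams_coeff (int g - int a) * adams_coeff (int g - int b)
        * adams_coeff (int g - int c) / ((2 * of_int (int g) + 1) * adams_coeff (int g))"
      by (rule adams_even) (use g in linarith)
    moreover have "int g - int a < 0 \<or> int g - int b < 0 \<or> int g - int c < 0"
      using False True g by auto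
    ultimately show ?thesis unfolding gaunt_integral_0 by auto
  next
    case False
    then show ?thesis unfolding gaunt_integral_0 by (simp add: adams_def)
  qed
  moreover have "wigner_3j a b c 0 0 0 = 0"
  proof (cases "even (a + b + c)")
    case True
    then have "\<not> (\<bar>int a - int b\<bar> \<le> int c \<and> int c \<le> int a + int b)" using False by linarith
    then show ?thesis unfolding wigner_3j_def Let_def by (subst if_not_P) blast+
  qed (rule wigner_3j_zero_odd)
  ultimately show ?thesis by (simp add: gaunt_integral_eq_0)
next
  case True
  then obtain g where g: "a + b + c = 2 * g" by (metis evenE)
  define x y z where xyz: "x = g - a" "y = g - b" "z = g - c"
  have abc: "a = y + z" "b = x + z" "c = x + y" using g True by (auto simp: xyz)
  let ?S = "wigner_3j_sum (int a) (int b) (int c) 0"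
  define \<Delta> where "\<Delta> = (fact (2 * x) * fact (2 * y) * fact (2 * z) / fact (2 * (x + y + z) + 1) :: real)"
  have \<Delta>: "\<Delta> > 0" by (simp add: \<Delta>_def)
  define F where "F = (fact a * fact b * fact c :: real)"
  have F: "F > 0" by (simp add: F_def)
  have S0: "?S 0 = (-1) ^ z * (fact (x + y + z) / (fact x * fact y * fact z)) / F"
    unfolding abc wigner_3j_sum_zero F_def by (simp add: add_ac)
  have G0: "gaunt_integral a b c 0 = 2 * \<Delta> * (F * ?S 0)\<^sup>2"
    unfolding gaunt_integral_0 S0 using F
    by (simp add: abc adams_eq_fact \<Delta>_def power_mult_distrib power_divide del: of_nat_add flip:
        power_mult)
  have S0nz: "?S 0 \<noteq> 0" unfolding S0 using F by simp
  have "?S 0 * (gaunt_integral a b c m * (fact b * fact c)) = ?S 0 * (2 * \<Delta> * F\<^sup>2 * ?S 0 * ?S (int m) *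
      (fact (b + m) * fact (c + m)))"
    using gaunt_integral_racah[of a b c m] True unfolding G0 by (simp add: power2_eq_square mult_ac)
  then have G: "gaunt_integral a b c m * (fact b * fact c) = 2 * \<Delta> * F\<^sup>2 * ?S 0 * ?S (int m) * (fact
      (b + m) * fact (c + m))"
    using S0nz by simp
  have bc: "(fact b * fact c :: real) \<noteq> 0" by simp
  have G': "gaunt_integral a b c m = 2 * \<Delta> * fact a * F * ?S 0 * ?S (int m) * (fact (b + m) * fact (c +
      m))"
  proof -
    have "(fact b * fact c) * gaunt_integral a b c m = (fact b * fact c) * (2 * \<Delta> * fact a * F * ?S 0 *
        ?S (int m) * (fact (b + m) * fact (c + m)))"
      using G by (simp add: F_def power2_eq_square mult_ac)
    then show ?thesis using bc mult_left_cancel by blast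
  qed
  have D: "int_fact (int a + int b - int c) * int_fact (int a - int b + int c) * int_fact (- int a +
      int b + int c) / int_fact (int a + int b + int c + 1) = \<Delta>"
  proof -
    have "nat (int a + int b - int c) = 2 * z" "nat (int a - int b + int c) = 2 * y"
        "nat (- int a + int b + int c) = 2 * x"
      "nat (int a + int b + int c + 1) = 2 * (x + y + z) + 1"
      by (simp_all add: abc nat_eq_iff)
    then show ?thesis by (simp add: \<Delta>_def mult_ac)
  qed
  have tri: "\<bar>int a - int b\<bar> \<le> int c" "int c \<le> int a + int b" using True by linarith+
  define E where "E = sqrt (fact (b + m) * fact (b - m) * fact (c + m) * fact (c - m) :: real)"
  have W0: "wigner_3j a b c 0 0 0 = (-1) powi (int a - int b) * sqrt \<Delta> * F * ?S 0"
  proof -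
    have "sqrt (int_fact (int a + 0) * int_fact (int a - 0) * int_fact (int b +
        0) * int_fact (int b - 0) * int_fact (int c + 0) * int_fact (int c - 0)) = F"
    proof -
      have "int_fact (int a + 0) * int_fact (int a - 0) * int_fact (int b + 0) * int_fact (int b - 0) *
          int_fact (int c + 0) * int_fact (int c - 0) = F\<^sup>2"
        by (simp add: F_def power2_eq_square)
      then show ?thesis using F by simp
    qed
    then show ?thesis using tri D by (simp add: wigner_3j_def Let_def mult_ac)
  qed
  have Wm: "wigner_3j a b c 0 (int m) (- int m) = (-1) powi (int a - int b + int m) * sqrt \<Delta> * (fact a
      * E) * ?S (int m)"
  proof -
    have "nat (int b + int m) = b + m" "nat (int b - int m) = b - m" "nat (int c + int m) = c + m"
        "nat (int c - int m) = c - m"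
      using m by (simp_all add: nat_eq_iff of_nat_diff)
    then have "sqrt (int_fact (int a + 0) * int_fact (int a - 0) * int_fact (int b +
        int m) * int_fact (int b - int m) * int_fact (int c + - int m) * int_fact
        (int c - - int m)) = fact a * E"
      by (simp add: E_def real_sqrt_mult mult_ac)
    then show ?thesis using tri D m by (simp add: wigner_3j_def Let_def mult_ac)
  qed
  \<comment> \<open>The sign \<open>(-1) ^ m\<close> is what survives of the phases
    \<open>a - b\<close> and \<open>a - b + m\<close> of the two symbols.\<close>
  have sg: "(-1) powi (int a - int b) * (-1) powi (int a - int b + int m) = ((-1) ^ m :: real)"
    by (simp add: power_int_minus_left uminus_power_if)
  have q: "(fact (b + m) * fact (c + m)) * sqrt (fact (b - m) * fact (c - m) / (fact (b +
      m) * fact (c + m))) = E"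
    by (simp add: E_def real_sqrt_mult real_sqrt_divide field_simps)
  have "gaunt_integral a b c m / 2 * sqrt (fact (b - m) * fact (c - m) / (fact (b + m) * fact (c +
      m))) =
     \<Delta> * fact a * F * ?S 0 * ?S (int m) * E"
    unfolding G' q[symmetric] by (simp add: mult_ac)
  moreover have "wigner_3j a b c 0 0 0 * wigner_3j a b c 0 (int m) (- int m) =
     ((-1) powi (int a - int b) * (-1) powi (int a - int b + int m)) * (sqrt \<Delta> * sqrt \<Delta>) *
         (fact a * F * ?S 0 * ?S (int m) * E)"
    unfolding W0 Wm by (simp only: mult_ac)
  ultimately show ?thesis unfolding sg using \<Delta> by (simp flip: power_add)
qed

section \<open>Integration over the sphere\<close>

lemma (in pair_sigma_finite)
  fixes f :: "'a \<Rightarrow> complex" and g :: "'b \<Rightarrow> complex"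
  assumes f: "integrable M1 f" and g: "integrable M2 g"
  shows integrable_mult_pair: "integrable (M1 \<Otimes>\<^sub>M M2) (\<lambda>z. f (fst z) * g (snd z))"
    and integral_mult_pair: "(\<integral>z. f (fst z) * g (snd z) \<partial>(M1 \<Otimes>\<^sub>M M2)) = (\<integral>x. f x \<partial>M1) * (\<integral>y. g y \<partial>M2)"
proof -
  have [measurable]: "f \<in> borel_measurable M1" "g \<in> borel_measurable M2" using f g by auto
  show *: "integrable (M1 \<Otimes>\<^sub>M M2) (\<lambda>z. f (fst z) * g (snd z))"
  proof (rule Fubini_integrable)
    show "integrable M1 (\<lambda>x. \<integral>y. norm (f (fst (x, y)) * g (snd (x, y))) \<partial>M2)"
      using f g by (simp add: norm_mult)
    show "AE x in M1. integrable M2 (\<lambda>y. f (fst (x, y)) * g (snd (x, y)))"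
      using g by simp
  qed measurable
  show "(\<integral>z. f (fst z) * g (snd z) \<partial>(M1 \<Otimes>\<^sub>M M2)) = (\<integral>x. f x \<partial>M1) * (\<integral>y. g y \<partial>M2)"
    using integral_fst'[OF *] by simp
qed

lemma continuous_on_sphere_point: "continuous_on A (\<lambda>(\<theta>, \<phi>). sphere_point \<theta> \<phi>)"
proof -
  have "(\<lambda>(\<theta>, \<phi>). sphere_point \<theta> \<phi>) = (\<lambda>z. \<chi> i. if i = 1 then sin (fst z) * cos (snd z) else
      if i = 2 then sin (fst z) * sin (snd z) else cos (fst z))"
    by (auto simp: fun_eq_iff vec_eq_iff sphere_point_def forall_3)
  moreover have "continuous_on A (\<lambda>z. if i = 1 then sin (fst z) * cos (snd z) else
      if i = 2 then sin (fst z) * sin (snd z) else cos (fst z))" for i :: 3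
    by (cases "i = 1"; cases "i = 2") (auto intro!: continuous_intros)
  ultimately show ?thesis by (simp only: continuous_on_vec_lambda)
qed

lemma norm_vec3: "norm (x :: real^3) ^ 2 = (x $ 1)\<^sup>2 + (x $ 2)\<^sup>2 + (x $ 3)\<^sup>2"
  by (simp add: norm_vec_def L2_set_def sum_3)

lemma sphere_point_nth [simp]:
  "sphere_point \<theta> \<phi> $ 1 = sin \<theta> * cos \<phi>" "sphere_point \<theta> \<phi> $ 2 = sin \<theta> * sin \<phi>"
      "sphere_point \<theta> \<phi> $ 3 = cos \<theta>"
  by (simp_all add: sphere_point_def)

lemma sphere_point_in_S2: "sphere_point \<theta> \<phi> \<in> S2"
proof -
  have "norm (sphere_point \<theta> \<phi>) ^ 2 = (sin \<theta>)\<^sup>2 * ((cos \<phi>)\<^sup>2 + (sin \<phi>)\<^sup>2) + (cos \<theta>)\<^sup>2"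
    unfolding norm_vec3 sphere_point_nth by algebra
  then have "norm (sphere_point \<theta> \<phi>) ^ 2 = 1" by simp
  then show ?thesis by (simp add: power2_eq_1_iff) (metis norm_not_less_zero neg_less_0_iff_less
      zero_less_one)
qed

abbreviation sphere_borel :: "(real^3) measure" where
  "sphere_borel \<equiv> restrict_space borel S2"

definition angle_measure :: "(real \<times> real) measure" where
  "angle_measure = density (restrict_space lborel ({0..pi} \<times> {0..<2*pi})) (\<lambda>(\<theta>, \<phi>). ennreal (sin \<theta>))"

lemma sets_angles [measurable]: "{0..pi} \<times> {0..<2*pi} \<in> sets (borel :: (real \<times> real) measure)"
  by (simp flip: borel_prod)

lemma sphere_point_measurable [measurable]:
  "(\<lambda>(\<theta>, \<phi>). sphere_point \<theta> \<phi>) \<in> measurable angle_measure sphere_borel"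
proof (rule measurable_restrict_space2)
  show "(\<lambda>(\<theta>, \<phi>). sphere_point \<theta> \<phi>) \<in> space angle_measure \<rightarrow> S2"
    using sphere_point_in_S2 by auto
  have "(\<lambda>(\<theta>, \<phi>). sphere_point \<theta> \<phi>) \<in> borel_measurable borel"
    using continuous_on_sphere_point by (rule borel_measurable_continuous_onI)
  then show "(\<lambda>(\<theta>, \<phi>). sphere_point \<theta> \<phi>) \<in> borel_measurable angle_measure"
    unfolding angle_measure_def
    by (simp add: measurable_restrict_space1 cong: measurable_cong_sets)
qed

lemma surface_measure_eq: "surface_measure = distr angle_measure sphere_borel (\<lambda>(\<theta>, \<phi>). sphere_point \<theta>
    \<phi>)"
  by (simp add: surface_measure_def angle_measure_def)

lemma sets_surface_measure [simp, measurable_cong]: "sets surface_measure = sets sphere_borel"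
  by (simp add: surface_measure_eq)

lemma space_surface_measure [simp]: "space surface_measure = S2"
  by (simp add: surface_measure_eq space_restrict_space)

lemma sin_density_measurable [measurable]:
  "(\<lambda>(\<theta>::real, \<phi>::real). ennreal (sin \<theta>)) \<in> borel_measurable (restrict_space lborel A)"
proof -
  have "(\<lambda>z. ennreal (sin (fst z))) \<in> borel_measurable (borel :: (real \<times> real) measure)"
    by (intro measurable_compose[OF _ measurable_ennreal] borel_measurable_continuous_onI
        continuous_intros)
  then have "(\<lambda>z. ennreal (sin (fst z))) \<in> borel_measurable (restrict_space lborel A)"
    by (intro measurable_restrict_space1) simp
  then show ?thesis by (simp add: case_prod_unfold)
qed

lemma finite_measure_angle: "finite_measure angle_measure"
proof (rule finite_measureI)
  let ?B = "restrict_space lborel ({0..pi} \<times> {0..<2*pi})"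
  have "emeasure angle_measure (space angle_measure) = (\<integral>\<^sup>+z. (\<lambda>(\<theta>, \<phi>). ennreal (sin \<theta>)) z * indicator
      (space ?B) z \<partial>?B)"
    unfolding angle_measure_def space_density by
        (rule emeasure_density[OF sin_density_measurable sets.top])
  also have "\<dots> \<le> (\<integral>\<^sup>+z. 1 \<partial>?B)"
    by (intro nn_integral_mono) (auto split: split_indicator simp: ennreal_le_1)
  also have "\<dots> = emeasure lborel ({0..pi} \<times> {0..<2*pi})"
    by (simp add: space_restrict_space emeasure_restrict_space)
  also have "\<dots> \<le> emeasure lborel (cbox (0, 0) (pi, 2*pi))"
  proof (rule emeasure_mono)
    show "{0..pi} \<times> {0..<2*pi} \<subseteq> cbox (0, 0) (pi, 2*pi)" by (auto simp: cbox_Pair_eq)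
  qed simp
  also have "\<dots> < \<infinity>" by (simp add: emeasure_lborel_cbox_eq)
  finally show "emeasure angle_measure (space angle_measure) \<noteq> \<infinity>" by simp
qed

lemma finite_measure_surface: "finite_measure surface_measure"
  unfolding surface_measure_eq
  by (rule finite_measure.finite_measure_distr[OF finite_measure_angle]) measurable

interpretation surface: finite_measure surface_measure
  by (rule finite_measure_surface)

lemma sphere_borel_measurable_continuous:
  "continuous_on S2 f \<Longrightarrow> f \<in> borel_measurable sphere_borel"
  for f :: "real^3 \<Rightarrow> 'b::topological_space"
  by (rule borel_measurable_continuous_on_restrict)

lemma surface_integrable_bounded:
  fixes f :: "real^3 \<Rightarrow> 'b::{banach, second_countable_topology}"
  assumes "f \<in> borel_measurable surface_measure" "\<And>x. x \<in> S2 \<Longrightarrow> norm (f x) \<le> B"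
  shows "integrable surface_measure f"
  by (rule surface.integrable_const_bound[of _ B]) (use assms in auto)

lemma surface_integrable_continuous:
  fixes f :: "real^3 \<Rightarrow> 'b::{banach, second_countable_topology}"
  assumes "continuous_on S2 f"
  shows "integrable surface_measure f"
proof -
  have "compact (f ` S2)" using assms by (intro compact_continuous_image) auto
  then obtain B where "\<And>x. x \<in> S2 \<Longrightarrow> norm (f x) \<le> B"
    using compact_imp_bounded bounded_iff by (metis image_eqI)
  then show ?thesis
    using sphere_borel_measurable_continuous[OF assms] by (intro surface_integrable_bounded) auto
qed

text \<open>Spherical coordinates and Fubini for a separated integrand. The measure uses a half-open
  longitude interval; its missing endpoint is a null set, and the closed interval suits the
  fundamental theorem of calculus.\<close>

lemma surface_integral_product:
  fixes f :: "real^3 \<Rightarrow> complex"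
  assumes f: "f \<in> borel_measurable surface_measure"
    and eq: "\<And>\<theta> \<phi>. 0 \<le> \<theta> \<Longrightarrow> \<theta> \<le> pi \<Longrightarrow> 0 \<le> \<phi> \<Longrightarrow> \<phi> < 2*pi \<Longrightarrow> f (sphere_point \<theta> \<phi>) = g \<theta> * h \<phi>"
    and g: "continuous_on {0..pi} g" and h: "continuous_on {0..2*pi} h"
  shows "(\<integral>x. f x \<partial>surface_measure) =
     (\<integral>\<theta>. indicator {0..pi} \<theta> *\<^sub>R (of_real (sin \<theta>) * g \<theta>) \<partial>lborel) *
         (\<integral>\<phi>. indicator {0..2*pi} \<phi> *\<^sub>R h \<phi> \<partial>lborel)"
proof -
  let ?B = "restrict_space lborel ({0..pi} \<times> {0..<2*pi})"
  have fm: "(\<lambda>z. f (case z of (\<theta>, \<phi>) \<Rightarrow> sphere_point \<theta> \<phi>)) \<in> borel_measurable angle_measure"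
    by (rule measurable_compose[OF sphere_point_measurable])
        (use f in \<open>simp cong: measurable_cong_sets\<close>)
  have "(\<integral>x. f x \<partial>surface_measure) = (\<integral>z. f (case z of (\<theta>, \<phi>) \<Rightarrow> sphere_point \<theta> \<phi>) \<partial>angle_measure)"
    unfolding surface_measure_eq
    by (rule integral_distr[OF sphere_point_measurable]) (use f in \<open>simp cong: measurable_cong_sets\<close>)
  also have "\<dots> = (\<integral>z. sin (fst z) *\<^sub>R f (case z of (\<theta>, \<phi>) \<Rightarrow> sphere_point \<theta> \<phi>) \<partial>?B)"
  proof -
    have sm: "(\<lambda>z. sin (fst z)) \<in> borel_measurable ?B"
      by (intro measurable_restrict_space1) (auto intro!: borel_measurable_continuous_onI
          continuous_intros)
    have d: "angle_measure = density ?B (\<lambda>z. ennreal (sin (fst z)))"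
      by (simp add: angle_measure_def case_prod_unfold)
    have "(\<lambda>z. f (case z of (\<theta>, \<phi>) \<Rightarrow> sphere_point \<theta> \<phi>)) \<in> borel_measurable ?B"
      using fm by (simp add: angle_measure_def cong: measurable_cong_sets)
    moreover have "AE z in ?B. 0 \<le> sin (fst z)"
      by (rule AE_I2) (auto simp: space_restrict_space sin_ge_zero)
    ultimately show ?thesis unfolding d by (rule integral_density[OF _ sm])
  qed
  also have "\<dots> = (\<integral>z. indicator ({0..pi} \<times> {0..<2*pi}) z *\<^sub>R (sin (fst z) *\<^sub>R f (case z of (\<theta>, \<phi>) \<Rightarrow>
      sphere_point \<theta> \<phi>)) \<partial>lborel)"
    by (rule integral_restrict_space) simp
  also have "\<dots> = (\<integral>z. (indicator {0..pi} (fst z) *\<^sub>R (of_real (sin (fst z)) * g (fst z))) * (indicator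
      {0..<2*pi} (snd z) *\<^sub>R h (snd z)) \<partial>(lborel \<Otimes>\<^sub>M lborel))"
    unfolding lborel_prod
    by (intro Bochner_Integration.integral_cong)
        (auto simp: eq scaleR_conv_of_real split: split_indicator)
  also have "\<dots> = (\<integral>\<theta>. indicator {0..pi} \<theta> *\<^sub>R (of_real (sin \<theta>) * g \<theta>) \<partial>lborel) * (\<integral>\<phi>. indicator
      {0..<2*pi} \<phi> *\<^sub>R h \<phi> \<partial>lborel)"
  proof (rule lborel_pair.integral_mult_pair)
    show "integrable lborel (\<lambda>\<theta>. indicator {0..pi} \<theta> *\<^sub>R (of_real (sin \<theta>) * g \<theta>))"
      by (rule borel_integrable_atLeastAtMost'[unfolded set_integrable_def]) (intro continuous_intros g)
    have "set_integrable lborel {0..2*pi} h"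
      using h by (rule borel_integrable_atLeastAtMost')
    then have "set_integrable lborel {0..<2*pi} h"
      by (rule set_integrable_subset) auto
    then show "integrable lborel (\<lambda>\<phi>. indicator {0..<2*pi} \<phi> *\<^sub>R h \<phi>)"
      unfolding set_integrable_def .
  qed
  also have "(\<integral>\<phi>. indicator {0..<2*pi} \<phi> *\<^sub>R h \<phi> \<partial>lborel) = (\<integral>\<phi>. indicator {0..2*pi} \<phi> *\<^sub>R h \<phi> \<partial>lborel)"
  proof (rule integral_cong_AE)
    have i: "set_integrable lborel {0..2*pi} h"
      using h by (rule borel_integrable_atLeastAtMost')
    then have "set_integrable lborel {0..<2*pi} h"
      by (rule set_integrable_subset) auto
    with i show "(\<lambda>\<phi>. indicator {0..<2*pi} \<phi> *\<^sub>R h \<phi>) \<in> borel_measurable lborel"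
      "(\<lambda>\<phi>. indicator {0..2*pi} \<phi> *\<^sub>R h \<phi>) \<in> borel_measurable lborel"
      unfolding set_integrable_def by auto
    show "AE \<phi> in lborel. indicator {0..<2*pi} \<phi> *\<^sub>R h \<phi> = indicator {0..2*pi} \<phi> *\<^sub>R h \<phi>"
      using AE_lborel_singleton[of "2*pi"] by eventually_elim (auto split: split_indicator)
  qed
  finally show ?thesis .
qed

lemma pderiv_surj: "\<exists>q. pderiv q = (p :: real poly)"
proof -
  have "pderiv (\<Sum>i\<le>degree p. monom (coeff p i / real (Suc i)) (Suc i)) =
      (\<Sum>i\<le>degree p. monom (coeff p i) i)"
    using higher_pderiv_sum[of 1 "\<lambda>i. monom (coeff p i / real (Suc i)) (Suc i)" "{..degree p}"]
    by (simp add: pderiv_monom del: of_nat_Suc)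
  then show ?thesis by (metis poly_as_sum_of_monoms)
qed

text \<open>The substitution \<open>t = cos \<theta>\<close>, carried out through a polynomial
  antiderivative \<open>q\<close> of \<open>p\<close>.\<close>

lemma integral_sin_poly:
  "(\<integral>\<theta>. indicator {0..pi} \<theta> *\<^sub>R (of_real (sin \<theta>) * of_real (poly p (cos \<theta>))) \<partial>lborel) =
      (of_real (poly_integral p) :: complex)"
proof -
  obtain q where q: "pderiv q = p" using pderiv_surj by blast
  have "(\<integral>\<theta>. indicator {0..pi} \<theta> *\<^sub>R (sin \<theta> * poly p (cos \<theta>)) \<partial>lborel) = - poly q (cos pi) - - poly q
      (cos 0)"
  proof (rule integral_FTC_Icc)
    fix x :: real
    have "((\<lambda>x. - poly q (cos x)) has_real_derivative sin x * poly p (cos x)) (at x within {0..pi})"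
      by (auto intro!: derivative_eq_intros DERIV_chain2[OF poly_DERIV] simp: q)
    then show "((\<lambda>x. - poly q (cos x)) has_vector_derivative sin x * poly p (cos x)) (at x within
        {0..pi})"
      by (simp add: has_real_derivative_iff_has_vector_derivative)
  qed (auto intro!: continuous_intros)
  also have "\<dots> = poly_integral p" by (simp add: poly_integral_pderiv flip: q)
  finally have "(\<integral>\<theta>. indicator {0..pi} \<theta> *\<^sub>R (sin \<theta> * poly p (cos \<theta>)) \<partial>lborel) = poly_integral p" .
  then have "of_real (\<integral>\<theta>. indicator {0..pi} \<theta> *\<^sub>R (sin \<theta> * poly p (cos \<theta>)) \<partial>lborel) =
      (of_real (poly_integral p) :: complex)"
    by simp
  then show ?thesis
    by (simp add: scaleR_conv_of_real flip: integral_complex_of_real)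
qed

lemma integral_cis:
  "(\<integral>\<phi>. indicator {0..2*pi} \<phi> *\<^sub>R cis (of_int k * \<phi>) \<partial>lborel) = (if k = 0 then 2 * pi else 0)"
proof (cases "k = 0")
  case True
  then show ?thesis by (simp add: scaleR_conv_of_real)
next
  case False
  have "(\<integral>\<phi>. indicator {0..2*pi} \<phi> *\<^sub>R cis (of_int k * \<phi>) \<partial>lborel) =
     cis (of_int k * (2*pi)) / (\<i> * of_int k) - cis (of_int k * 0) / (\<i> * of_int k)"
  proof (rule integral_FTC_Icc)
    fix x :: real
    have "((\<lambda>z. exp (\<i> * of_int k * z) / (\<i> * of_int k)) has_field_derivative exp (\<i> * of_int k *
        of_real x)) (at (of_real x))"
      using False by (auto intro!: derivative_eq_intros)
    from has_vector_derivative_real_field[OF this, of "{0..2*pi}"]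
    show "((\<lambda>x. cis (of_int k * x) / (\<i> * of_int k)) has_vector_derivative cis (of_int k * x)) (at x
        within {0..2*pi})"
      by (simp add: cis_conv_exp mult.assoc)
  qed (auto intro!: continuous_intros)
  also have "cis (of_int k * (2*pi)) = 1"
  proof -
    have "cis (2*pi) = 1" by (simp add: complex_eq_iff)
    then show ?thesis using cis_power_int[of "2*pi" k] by simp
  qed
  finally show ?thesis using False by simp
qed

section \<open>Spherical harmonics as polynomials\<close>

definition zonal_var :: "real^3 \<Rightarrow> complex" where
  "zonal_var x = Complex (x $ 1) (x $ 2)"

text \<open>The polynomial form of the longitude factor together with the power
  \<open>\<bar>m\<bar>\<close> of the sine; unlike the longitude itself it is continuous at the
  poles.\<close>

definition azimuthal :: "int \<Rightarrow> real^3 \<Rightarrow> complex" where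
  "azimuthal m x = (if m \<ge> 0 then zonal_var x ^ nat m else cnj (zonal_var x) ^ nat (- m))"

lemma continuous_on_zonal_var [continuous_intros]: "continuous_on A zonal_var"
  unfolding zonal_var_def[abs_def] Complex_eq by (intro continuous_intros)

lemma continuous_on_azimuthal [continuous_intros]: "continuous_on A (azimuthal m)"
  unfolding azimuthal_def[abs_def] by (cases "m \<ge> 0") (auto intro!: continuous_intros)

lemma zonal_var_sphere_point: "zonal_var (sphere_point \<theta> \<phi>) = of_real (sin \<theta>) * cis \<phi>"
  by (simp add: zonal_var_def complex_eq_iff)

lemma azimuthal_sphere_point: "azimuthal m (sphere_point \<theta> \<phi>) = of_real (sin \<theta> ^ nat \<bar>m\<bar>) * cis (of_int
    m * \<phi>)"
proof (cases "m \<ge> 0")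
  case True
  then show ?thesis
    by (simp add: azimuthal_def zonal_var_sphere_point power_mult_distrib Complex.DeMoivre)
next
  case False
  then show ?thesis
    by (simp add: azimuthal_def zonal_var_sphere_point power_mult_distrib Complex.DeMoivre cis_cnj)
qed

lemma azimuthal_minus: "azimuthal (- m) x = cnj (azimuthal m x)"
  by (auto simp: azimuthal_def)

lemma integral_azimuthal:
  "(\<integral>x. azimuthal m x * cnj (azimuthal m' x) * of_real (poly q (x $ 3)) \<partial>surface_measure) =
     (if m = m' then of_real (2 * pi * poly_integral ([:1, 0, -1:] ^ nat \<bar>m\<bar> * q)) else 0)"
proof -
  let ?f = "\<lambda>x. azimuthal m x * cnj (azimuthal m' x) * of_real (poly q (x $ 3))"
  let ?g = "\<lambda>\<theta>. of_real (sin \<theta> ^ (nat \<bar>m\<bar> + nat \<bar>m'\<bar>) * poly q (cos \<theta>)) :: complex"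
  have "integral\<^sup>L surface_measure ?f =
     (\<integral>\<theta>. indicator {0..pi} \<theta> *\<^sub>R (of_real (sin \<theta>) * ?g \<theta>) \<partial>lborel) * (\<integral>\<phi>. indicator {0..2*pi} \<phi> *\<^sub>R cis
         (of_int (m - m') * \<phi>) \<partial>lborel)"
  proof (rule surface_integral_product)
    have "continuous_on S2 ?f" by (intro continuous_intros)
    then show "?f \<in> borel_measurable surface_measure"
      using sphere_borel_measurable_continuous by (simp cong: measurable_cong_sets)
    fix \<theta> \<phi> :: real
    have "cis (of_int m * \<phi>) * cnj (cis (of_int m' * \<phi>)) = cis (of_int (m - m') * \<phi>)"
      by (simp add: cis_cnj cis_mult left_diff_distrib)
    then show "?f (sphere_point \<theta> \<phi>) = ?g \<theta> * cis (of_int (m - m') * \<phi>)"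
      by (simp add: azimuthal_sphere_point power_add mult_ac)
  qed (auto intro!: continuous_intros)
  also have "\<dots> = (if m = m' then of_real (2 * pi * poly_integral ([:1, 0, -1:] ^ nat \<bar>m\<bar> * q)) else 0)"
  proof (cases "m = m'")
    case True
    have "?g \<theta> = of_real (poly ([:1, 0, -1:] ^ nat \<bar>m\<bar> * q) (cos \<theta>))" for \<theta>
    proof -
      have "sin \<theta> ^ (nat \<bar>m\<bar> + nat \<bar>m\<bar>) = (1 - cos \<theta> * cos \<theta>) ^ nat \<bar>m\<bar>"
        by (metis mult_2 power_mult power2_eq_square sin_squared_eq)
      then show ?thesis using True by (simp add: poly_power)
    qed
    then show ?thesis using True integral_cis[of 0] by (simp only: integral_sin_poly) simp
  next
    case False
    then show ?thesis using integral_cis[of "m - m'"] by simp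
  qed
  finally show ?thesis .
qed

definition sph_norm :: "nat \<Rightarrow> nat \<Rightarrow> real" where
  "sph_norm l m = sqrt ((2 * real l + 1) * fact (l - m) / (4 * pi * fact (l + m)))"

text \<open>The power of the sine sits in \<open>azimuthal\<close>, so a polynomial in the third
  coordinate remains. For negative \<open>m\<close> the Condon-Shortley sign cancels against the
  sign in \<open>sph_harm\<close>.\<close>

definition sph_poly :: "nat \<Rightarrow> int \<Rightarrow> real poly" where
  "sph_poly l m = smult ((if m \<ge> 0 then (-1) ^ nat m else 1) * sph_norm l (nat \<bar>m\<bar>)) (legendre_deriv l
      (nat \<bar>m\<bar>))"

lemma S2_eq: "x \<in> S2 \<Longrightarrow> (x $ 1)\<^sup>2 + (x $ 2)\<^sup>2 + (x $ 3)\<^sup>2 = 1"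
  using norm_vec3[of x] by simp

lemma cmod_zonal_var: "x \<in> S2 \<Longrightarrow> cmod (zonal_var x) = sqrt (1 - (x $ 3)\<^sup>2)"
proof -
  assume "x \<in> S2"
  then have "(x $ 1)\<^sup>2 + (x $ 2)\<^sup>2 = 1 - (x $ 3)\<^sup>2" using S2_eq[of x] by linarith
  then show ?thesis by (simp add: zonal_var_def cmod_def)
qed

lemma sph_harm_nonneg_eq:
  assumes "x \<in> S2"
  shows "sph_harm_nonneg l m x = zonal_var x ^ m * of_real ((-1) ^ m * sph_norm l m * poly
      (legendre_deriv l m) (x $ 3))"
proof -
  have "(x $ 3)\<^sup>2 \<le> 1" using S2_eq[OF assms] by (metis add_increasing order_refl zero_le_power2
      add_nonneg_nonneg)
  then have "\<bar>x $ 3\<bar> \<le> 1" by (simp add: abs_square_le_1)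
  then have c: "cos (colatitude x) = x $ 3" by (auto simp: colatitude_def cos_arccos abs_le_iff)
  have "zonal_var x = of_real (sqrt (1 - (x $ 3)\<^sup>2)) * cis (longitude x)"
    using Arg2pi_eq[of "zonal_var x"] cmod_zonal_var[OF assms]
    by (simp add: longitude_def cis_conv_exp zonal_var_def)
  then have "zonal_var x ^ m = of_real (sqrt (1 - (x $ 3)\<^sup>2) ^ m) * cis (real m * longitude x)"
    by (simp add: power_mult_distrib Complex.DeMoivre)
  then show ?thesis
    by (simp add: sph_harm_nonneg_def c assoc_legendre_def legendre_deriv_def sph_norm_def mult_ac)
qed

lemma sph_harm_eq:
  assumes "x \<in> S2"
  shows "sph_harm l m x = azimuthal m x * of_real (poly (sph_poly l m) (x $ 3))"
proof (cases "m \<ge> 0")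
  case True
  then show ?thesis
    using assms by (simp add: sph_harm_def sph_harm_nonneg_eq azimuthal_def sph_poly_def)
next
  case False
  have "(-1) ^ k * (cnj z ^ k * of_real ((-1) ^ k * c)) = cnj z ^ k * of_real c" for k c z
    by (simp add: mult_ac flip: power_mult_distrib) 
  then show ?thesis
    using False assms by (simp add: sph_harm_def sph_harm_nonneg_eq azimuthal_def sph_poly_def
        mult.assoc)
qed

lemma continuous_on_sph_harm: "continuous_on S2 (sph_harm l m)"
proof -
  have "continuous_on S2 (\<lambda>x. azimuthal m x * of_real (poly (sph_poly l m) (x $ 3)))"
    by (intro continuous_intros)
  then show ?thesis by (subst continuous_on_cong[OF refl sph_harm_eq]) auto
qed

text \<open>Makes those terms of the shift relations harmless in which the order has left the range
  of the degree.\<close>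

lemma sph_harm_eq_0: "\<bar>m\<bar> > int l \<Longrightarrow> x \<in> S2 \<Longrightarrow> sph_harm l m x = 0"
  by (simp add: sph_harm_eq sph_poly_def legendre_deriv_eq_0 nat_less_iff zless_nat_eq_int_zless)

lemma cnj_sph_harm: "x \<in> S2 \<Longrightarrow> cnj (sph_harm l m x) = (-1) ^ nat \<bar>m\<bar> * sph_harm l (- m) x"
proof -
  assume x: "x \<in> S2"
  have "sph_poly l m = smult ((-1) ^ nat \<bar>m\<bar>) (sph_poly l (- m))"
    by (cases "m = 0"; cases "m > 0") (auto simp: sph_poly_def mult_ac simp flip: power_mult_distrib)
  then show ?thesis using x by (simp add: sph_harm_eq azimuthal_minus mult_ac)
qed

section \<open>Orthonormality and the integral of three harmonics\<close>

lemma sph_norm_squared: "sph_norm l m * sph_norm l m = (2 * real l + 1) * fact (l - m) / (4 * pi * fact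
    (l + m))"
  by (simp add: sph_norm_def)

lemma sph_harm_orthonormal:
  assumes "\<bar>m\<bar> \<le> int l" "\<bar>m'\<bar> \<le> int l'"
  shows "(\<integral>x. sph_harm l m x * cnj (sph_harm l' m' x) \<partial>surface_measure) = (if l = l' \<and> m =
      m' then 1 else 0)"
proof -
  have "(\<integral>x. sph_harm l m x * cnj (sph_harm l' m' x) \<partial>surface_measure) =
     (\<integral>x. azimuthal m x * cnj (azimuthal m' x) * of_real (poly (sph_poly l m * sph_poly l' m')
         (x $ 3)) \<partial>surface_measure)"
    by (intro Bochner_Integration.integral_cong) (simp_all add: sph_harm_eq mult_ac)
  also have "\<dots> = (if m = m' then of_real (2 * pi * poly_integral ([:1, 0, -1:] ^ nat \<bar>m\<bar> * (sph_poly l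
      m * sph_poly l' m'))) else 0)"
    by (rule integral_azimuthal)
  also have "\<dots> = (if l = l' \<and> m = m' then 1 else 0)"
  proof (cases "m = m'")
    case True
    define k where "k = nat \<bar>m\<bar>"
    have k: "k \<le> l" using assms by (simp add: k_def nat_le_iff)
    have "[:1, 0, -1:] ^ k * (sph_poly l m * sph_poly l' m) = smult (sph_norm l k * sph_norm l' k)
        ([:1, 0, -1:] ^ k * (legendre_deriv l k * legendre_deriv l' k))"
      by (auto simp: sph_poly_def k_def mult_ac simp flip: power_mult_distrib)
    then have "poly_integral ([:1, 0, -1:] ^ k * (sph_poly l m * sph_poly l' m)) =
      (if l = l' then sph_norm l k * sph_norm l k * (2 / (2 * real l + 1) * (fact (l + k) / fact
          (l - k))) else 0)"
      using k by (simp add: poly_integral_smult poly_integral_assoc_legendre)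
    also have "\<dots> = (if l = l' then 1 / (2 * pi) else 0)"
      unfolding sph_norm_squared by (simp add: divide_simps)
    finally show ?thesis using True by (simp add: k_def)
  qed simp
  finally show ?thesis .
qed

text \<open>The orders cancel, so the longitude contributes \<open>2 * pi\<close>. The rest is
  \<open>gaunt_integral\<close> at order \<open>\<bar>m\<bar>\<close> times the normalising
  constants, whose order-dependent parts form the square root in
  \<open>gaunt_integral_wigner\<close>; reflection restores the sign of \<open>m\<close>.\<close>

lemma sph_harm_gaunt:
  assumes "\<bar>m\<bar> \<le> int b" "\<bar>m\<bar> \<le> int c"
  shows "(\<integral>x. sph_harm a 0 x * sph_harm b m x * cnj (sph_harm c m x) \<partial>surface_measure) =
     (-1) powi m * of_real (sqrt ((2 * real a + 1) * (2 * real b + 1) * (2 * real c + 1) / (4 * pi)) *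
        wigner_3j a b c 0 0 0 * wigner_3j a b c 0 m (- m))"
proof -
  define k where "k = nat \<bar>m\<bar>"
  have k: "k \<le> b" "k \<le> c" using assms by (simp_all add: k_def nat_le_iff)
  have "(\<integral>x. sph_harm a 0 x * sph_harm b m x * cnj (sph_harm c m x) \<partial>surface_measure) =
     (\<integral>x. azimuthal m x * cnj (azimuthal m x) * of_real (poly
         (sph_poly a 0 * sph_poly b m * sph_poly c m) (x $ 3)) \<partial>surface_measure)"
    by (intro Bochner_Integration.integral_cong) (simp_all add: sph_harm_eq azimuthal_def[of 0] mult_ac)
  also have "\<dots> = of_real (2 * pi * poly_integral ([:1, 0, -1:] ^ k * (sph_poly a 0 * sph_poly b m *
      sph_poly c m)))"
    by (subst integral_azimuthal) (simp add: k_def)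
  also have "[:1, 0, -1:] ^ k * (sph_poly a 0 * sph_poly b m * sph_poly c m) =
      smult (sph_norm a 0 * sph_norm b k * sph_norm c k) ([:1, 0, -1:] ^ k *
          (legendre_deriv a 0 * legendre_deriv b k * legendre_deriv c k))"
    by (auto simp: sph_poly_def k_def mult_ac simp flip: power_mult_distrib)
  also have "2 * pi * poly_integral \<dots> = 2 * pi * (sph_norm a 0 * sph_norm b k * sph_norm c k) *
      gaunt_integral a b c k"
    by (simp add: poly_integral_smult gaunt_integral_def)
  \<comment> \<open>The factor \<open>2 * pi\<close> against three factors
    \<open>1 / sqrt (4 * pi)\<close> leaves \<open>1 / (2 * sqrt (4 * pi))\<close>.\<close>
  also have "2 * pi * (sph_norm a 0 * sph_norm b k * sph_norm c k) =
     sqrt ((2 * real a + 1) * (2 * real b + 1) * (2 * real c + 1) / (4 * pi)) / 2 * sqrt (fact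
         (b - k) * fact (c - k) / (fact (b + k) * fact (c + k)))"
  proof -
    have "sqrt (4 * pi) * sqrt (4 * pi) = 4 * pi" by simp
    moreover have "sqrt (4 * pi) \<noteq> 0" by simp
    ultimately show ?thesis
      unfolding sph_norm_def by (simp add: real_sqrt_mult real_sqrt_divide divide_simps del:
          real_sqrt_four)
  qed
  also have "\<dots> * gaunt_integral a b c k = sqrt ((2 * real a + 1) * (2 * real b + 1) * (2 * real c +
      1) / (4 * pi)) *
      (gaunt_integral a b c k / 2 * sqrt (fact (b - k) * fact (c - k) / (fact (b + k) * fact (c + k))))"
    by simp
  also have "\<dots> = sqrt ((2 * real a + 1) * (2 * real b + 1) * (2 * real c + 1) / (4 * pi)) *
      ((-1) ^ k * (wigner_3j a b c 0 0 0 * wigner_3j a b c 0 m (- m)))"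
  proof (cases "m \<ge> 0")
    case True
    then have "int k = m" by (simp add: k_def)
    then show ?thesis using gaunt_integral_wigner[OF k, of a] by simp
  next
    case False
    then have "int k = - m" by (simp add: k_def)
    then show ?thesis using gaunt_integral_wigner[OF k, of a] wigner_3j_zero_reflect[of a b c m] by simp
  qed
  finally show ?thesis
    by (simp add: k_def mult_ac power_int_minus_left uminus_power_if even_nat_iff)
qed

section \<open>Multiplication of spherical harmonics by coordinates\<close>

text \<open>The matrix element of \<open>x $ 3\<close> between degrees \<open>l\<close> and
  \<open>l - 1\<close>. It is indexed by the larger degree, so one function serves both
  directions.\<close>

definition vert_coeff :: "nat \<Rightarrow> int \<Rightarrow> real" where
  "vert_coeff l m = sqrt ((real l + of_int m) * (real l - of_int m) / ((2 * real l - 1) * (2 * real l +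
      1)))"

text \<open>Up to sign, the matrix element of \<open>zonal_var\<close> or its conjugate, indexed by
  the larger degree. The second argument is the order of the harmonic of larger degree, negated when
  that order is the smaller of the two.\<close>

definition horiz_coeff :: "nat \<Rightarrow> int \<Rightarrow> real" where
  "horiz_coeff l m = sqrt ((real l + of_int m) * (real l + of_int m - 1) / ((2 * real l - 1) *
      (2 * real l + 1)))"

text \<open>Reduces each comparison of normalising constants below to a rational identity between
  squares.\<close>

lemma sqrt_mult_eqI: "0 \<le> c \<Longrightarrow> A * c\<^sup>2 = B * C \<Longrightarrow> sqrt A * c = sqrt B * sqrt C"
proof -
  assume "0 \<le> c" "A * c\<^sup>2 = B * C"
  then have "sqrt A * sqrt (c\<^sup>2) = sqrt B * sqrt C" by (simp only: flip: real_sqrt_mult)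
  then show ?thesis using \<open>0 \<le> c\<close> by simp
qed

section \<open>Ratios of normalising constants at neighbouring degrees and orders\<close>

lemma sph_norm_vert_up:
  assumes "k \<le> l"
  shows "sph_norm l k * ((real l + 1 - real k) / (2 * real l + 1)) = vert_coeff (Suc l) (int k) *
      sph_norm (Suc l) k"
proof -
  obtain j where l: "l = k + j" using assms le_Suc_ex by blast
  define K J where KJ: "K = real k" "J = real j"
  have f: "fact (Suc l - k) = (J + 1) * (fact j :: real)"
      "fact (Suc l + k) = (2 * K + J + 1) * (fact (l + k) :: real)" "l - k = j"
    by (simp_all add: l KJ algebra_simps Suc_diff_le)
  have nn: "K \<ge> 0" "J \<ge> 0" by (simp_all add: KJ)
  have r: "real l = K + J" "real (Suc l) = K + J + 1" "real k = K" by (simp_all add: l KJ)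
  show ?thesis
    unfolding sph_norm_def vert_coeff_def of_int_of_nat_eq f r
  proof (rule sqrt_mult_eqI)
    show "0 \<le> (K + J + 1 - K) / (2 * (K + J) + 1)" using nn by simp
    show "(2 * (K + J) + 1) * fact j / (4 * pi * fact (l + k)) * ((K + J + 1 - K) / (2 * (K + J) +
        1))\<^sup>2 =
      (K + J + 1 + K) * (K + J + 1 - K) / ((2 * (K + J + 1) - 1) * (2 * (K + J + 1) + 1)) *
      ((2 * (K + J + 1) + 1) * ((J + 1) * fact j) / (4 * pi * ((2 * K + J + 1) * fact (l + k))))"
    proof -
      \<comment> \<open>The linear factors are kept as atoms so that they cancel before being
        multiplied out; the same device serves the five lemmas that follow.\<close>
      define A D E E' where d: "A = 2 * K + 2 * J + 1" "D = 2 * K + 2 * J + 3" "E = 2 * K + J + 1"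
          "E' = 2 * K + J + 2"
      have e: "2 * (K + J) + 1 = A" "2 * (K + J + 1) - 1 = A" "2 * (K + J + 1) + 1 = D"
          "K + J + 1 + K = E" "K + J + 1 - K = J + 1"
        "2 * K + J + 1 = E" "2 * K + J + 2 = E'" "K + J + 1 + (K + 1) = E'" "E' - 1 = E" "E + 1 = E'"
        by (simp_all add: d)
      have "A \<noteq> 0" "D \<noteq> 0" "E \<noteq> 0" "E' \<noteq> 0" using nn by (simp_all add: d)
      then show ?thesis unfolding e by (simp add: power2_eq_square mult_ac)
    qed
  qed
qed

lemma sph_norm_vert_down:
  assumes "k \<le> l"
  shows "sph_norm (Suc l) k * ((real (Suc l) + real k) / (2 * real (Suc l) + 1)) =
      vert_coeff (Suc l) (int k) * sph_norm l k"
proof -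
  obtain j where l: "l = k + j" using assms le_Suc_ex by blast
  define K J where KJ: "K = real k" "J = real j"
  have f: "fact (Suc l - k) = (J + 1) * (fact j :: real)"
      "fact (Suc l + k) = (2 * K + J + 1) * (fact (l + k) :: real)" "l - k = j"
    by (simp_all add: l KJ algebra_simps Suc_diff_le)
  have nn: "K \<ge> 0" "J \<ge> 0" by (simp_all add: KJ)
  have r: "real l = K + J" "real (Suc l) = K + J + 1" "real k = K" by (simp_all add: l KJ)
  show ?thesis
    unfolding sph_norm_def vert_coeff_def of_int_of_nat_eq f r
  proof (rule sqrt_mult_eqI)
    show "0 \<le> (K + J + 1 + K) / (2 * (K + J + 1) + 1)" using nn by simp
    show "(2 * (K + J + 1) + 1) * ((J + 1) * fact j) / (4 * pi * ((2 * K + J + 1) * fact (l + k))) *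
        ((K + J + 1 + K) / (2 * (K + J + 1) + 1))\<^sup>2 =
      (K + J + 1 + K) * (K + J + 1 - K) / ((2 * (K + J + 1) - 1) * (2 * (K + J + 1) + 1)) *
      ((2 * (K + J) + 1) * fact j / (4 * pi * fact (l + k)))"
    proof -
      define A D E E' where d: "A = 2 * K + 2 * J + 1" "D = 2 * K + 2 * J + 3" "E = 2 * K + J + 1"
          "E' = 2 * K + J + 2"
      have e: "2 * (K + J) + 1 = A" "2 * (K + J + 1) - 1 = A" "2 * (K + J + 1) + 1 = D"
          "K + J + 1 + K = E" "K + J + 1 - K = J + 1"
        "2 * K + J + 1 = E" "2 * K + J + 2 = E'" "K + J + 1 + (K + 1) = E'" "E' - 1 = E" "E + 1 = E'"
        by (simp_all add: d)
      have "A \<noteq> 0" "D \<noteq> 0" "E \<noteq> 0" "E' \<noteq> 0" using nn by (simp_all add: d)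
      then show ?thesis unfolding e by (simp add: power2_eq_square mult_ac)
    qed
  qed
qed

lemma sph_norm_raise_up:
  assumes "k \<le> l"
  shows "sph_norm l k * (1 / (2 * real l + 1)) = horiz_coeff (Suc l) (int k + 1) * sph_norm (Suc l)
      (Suc k)"
proof -
  obtain j where l: "l = k + j" using assms le_Suc_ex by blast
  define K J where KJ: "K = real k" "J = real j"
  have f: "Suc l - Suc k = j" "fact (Suc l + Suc k) = (2 * K + J + 2) * ((2 * K + J + 1) * (fact (l +
      k) :: real))" "l - k = j"
    by (simp_all add: l KJ algebra_simps)
  have nn: "K \<ge> 0" "J \<ge> 0" by (simp_all add: KJ)
  have r: "real l = K + J" "real (Suc l) = K + J + 1" "real_of_int (int k + 1) = K + 1"
      by (simp_all add: l KJ)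
  show ?thesis
    unfolding sph_norm_def horiz_coeff_def f r
  proof (rule sqrt_mult_eqI)
    show "0 \<le> 1 / (2 * (K + J) + 1)" using nn by simp
    show "(2 * (K + J) + 1) * fact j / (4 * pi * fact (l + k)) * (1 / (2 * (K + J) + 1))\<^sup>2 =
      (K + J + 1 + (K + 1)) * (K + J + 1 + (K + 1) - 1) / ((2 * (K + J + 1) - 1) *
          (2 * (K + J + 1) + 1)) *
      ((2 * (K + J + 1) + 1) * fact j / (4 * pi * ((2 * K + J + 2) * ((2 * K + J + 1) * fact
          (l + k)))))"
    proof -
      define A D E E' where d: "A = 2 * K + 2 * J + 1" "D = 2 * K + 2 * J + 3" "E = 2 * K + J + 1"
          "E' = 2 * K + J + 2"
      have e: "2 * (K + J) + 1 = A" "2 * (K + J + 1) - 1 = A" "2 * (K + J + 1) + 1 = D"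
          "K + J + 1 + K = E" "K + J + 1 - K = J + 1"
        "2 * K + J + 1 = E" "2 * K + J + 2 = E'" "K + J + 1 + (K + 1) = E'" "E' - 1 = E" "E + 1 = E'"
        by (simp_all add: d)
      have "A \<noteq> 0" "D \<noteq> 0" "E \<noteq> 0" "E' \<noteq> 0" using nn by (simp_all add: d)
      then show ?thesis unfolding e by (simp add: power2_eq_square mult_ac)
    qed
  qed
qed

lemma sph_norm_raise_down:
  assumes "Suc k \<le> l"
  shows "sph_norm (Suc l) k * (1 / (2 * real (Suc l) + 1)) = horiz_coeff (Suc l) (- int k) * sph_norm l
      (Suc k)"
proof -
  obtain j where l: "l = Suc k + j" using assms le_Suc_ex by blast
  define K J where KJ: "K = real k" "J = real j"
  have f: "l - Suc k = j" "Suc l + k = l + Suc k"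
      "fact (Suc l - k) = (J + 2) * ((J + 1) * (fact j :: real))"
    by (simp_all add: l KJ algebra_simps Suc_diff_le)
  have nn: "K \<ge> 0" "J \<ge> 0" by (simp_all add: KJ)
  have r: "real l = K + J + 1" "real (Suc l) = K + J + 2" "real_of_int (- int k) = - K"
      by (simp_all add: l KJ)
  show ?thesis
    unfolding sph_norm_def horiz_coeff_def f r
  proof (rule sqrt_mult_eqI)
    show "0 \<le> 1 / (2 * (K + J + 2) + 1)" using nn by simp
    show "(2 * (K + J + 2) + 1) * ((J + 2) * ((J + 1) * fact j)) / (4 * pi * fact (l +
        Suc k)) * (1 / (2 * (K + J + 2) + 1))\<^sup>2 =
      (K + J + 2 + - K) * (K + J + 2 + - K - 1) / ((2 * (K + J + 2) - 1) * (2 * (K + J + 2) + 1)) *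
      ((2 * (K + J + 1) + 1) * fact j / (4 * pi * fact (l + Suc k)))"
    proof -
      define A D where d: "A = 2 * K + 2 * J + 3" "D = 2 * K + 2 * J + 5"
      have e: "2 * (K + J + 1) + 1 = A" "2 * (K + J + 2) - 1 = A" "2 * (K + J + 2) + 1 = D"
          "K + J + 1 - K = J + 1"
        "K + J + 1 + 1 - K = J + 2" "K + J + 2 + - K - 1 = J + 1" "K + J + 2 + - K = J + 2"
            "J + 2 - 1 = J + 1"
        by (simp_all add: d)
      have "A \<noteq> 0" "D \<noteq> 0" "J + 1 \<noteq> 0" "J + 2 \<noteq> 0" using nn by (simp_all add: d)
      then show ?thesis unfolding e by (simp add: power2_eq_square mult_ac)
    qed
  qed
qed

lemma sph_norm_lower_up:
  assumes "Suc k \<le> l"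
  shows "sph_norm l (Suc k) * ((real l - real k) * (real l + 1 - real k) / (2 * real l + 1)) =
      horiz_coeff (Suc l) (- int k) * sph_norm (Suc l) k"
proof -
  obtain j where l: "l = Suc k + j" using assms le_Suc_ex by blast
  define K J where KJ: "K = real k" "J = real j"
  have f: "l - Suc k = j" "Suc l + k = l + Suc k"
      "fact (Suc l - k) = (J + 2) * ((J + 1) * (fact j :: real))"
    by (simp_all add: l KJ algebra_simps Suc_diff_le)
  have nn: "K \<ge> 0" "J \<ge> 0" by (simp_all add: KJ)
  have r: "real l = K + J + 1" "real (Suc l) = K + J + 2" "real_of_int (- int k) = - K" "real k = K"
      by (simp_all add: l KJ)
  show ?thesis
    unfolding sph_norm_def horiz_coeff_def f r
  proof (rule sqrt_mult_eqI)
    show "0 \<le> (K + J + 1 - K) * (K + J + 1 + 1 - K) / (2 * (K + J + 1) + 1)" using nn by simp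
    show "(2 * (K + J + 1) + 1) * fact j / (4 * pi * fact (l + Suc k)) * ((K + J + 1 - K) * (K + J +
        1 + 1 - K) / (2 * (K + J + 1) + 1))\<^sup>2 =
      (K + J + 2 + - K) * (K + J + 2 + - K - 1) / ((2 * (K + J + 2) - 1) * (2 * (K + J + 2) + 1)) *
      ((2 * (K + J + 2) + 1) * ((J + 2) * ((J + 1) * fact j)) / (4 * pi * fact (l + Suc k)))"
    proof -
      define A D where d: "A = 2 * K + 2 * J + 3" "D = 2 * K + 2 * J + 5"
      have e: "2 * (K + J + 1) + 1 = A" "2 * (K + J + 2) - 1 = A" "2 * (K + J + 2) + 1 = D"
          "K + J + 1 - K = J + 1"
        "K + J + 1 + 1 - K = J + 2" "K + J + 2 + - K - 1 = J + 1" "K + J + 2 + - K = J + 2"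
            "J + 2 - 1 = J + 1"
        by (simp_all add: d)
      have "A \<noteq> 0" "D \<noteq> 0" "J + 1 \<noteq> 0" "J + 2 \<noteq> 0" using nn by (simp_all add: d)
      then show ?thesis unfolding e by (simp add: power2_eq_square mult_ac)
    qed
  qed
qed

lemma sph_norm_lower_down:
  assumes "k \<le> l"
  shows "sph_norm (Suc l) (Suc k) * ((real (Suc l) + real k + 1) * (real (Suc l) +
      real k) / (2 * real (Suc l) + 1)) =
     horiz_coeff (Suc l) (int k + 1) * sph_norm l k"
proof -
  obtain j where l: "l = k + j" using assms le_Suc_ex by blast
  define K J where KJ: "K = real k" "J = real j"
  have f: "Suc l - Suc k = j" "fact (Suc l + Suc k) = (2 * K + J + 2) * ((2 * K + J + 1) * (fact (l +
      k) :: real))" "l - k = j"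
    by (simp_all add: l KJ algebra_simps)
  have nn: "K \<ge> 0" "J \<ge> 0" by (simp_all add: KJ)
  have r: "real l = K + J" "real (Suc l) = K + J + 1" "real_of_int (int k + 1) = K + 1" "real k = K"
      by (simp_all add: l KJ)
  show ?thesis
    unfolding sph_norm_def horiz_coeff_def f r
  proof (rule sqrt_mult_eqI)
    show "0 \<le> (K + J + 1 + K + 1) * (K + J + 1 + K) / (2 * (K + J + 1) + 1)" using nn by simp
    show "(2 * (K + J + 1) + 1) * fact j / (4 * pi * ((2 * K + J + 2) * ((2 * K + J + 1) * fact (l +
        k)))) *
        ((K + J + 1 + K + 1) * (K + J + 1 + K) / (2 * (K + J + 1) + 1))\<^sup>2 =
      (K + J + 1 + (K + 1)) * (K + J + 1 + (K + 1) - 1) / ((2 * (K + J + 1) - 1) *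
          (2 * (K + J + 1) + 1)) *
      ((2 * (K + J) + 1) * fact j / (4 * pi * fact (l + k)))"
    proof -
      define A D E E' where d: "A = 2 * K + 2 * J + 1" "D = 2 * K + 2 * J + 3" "E = 2 * K + J + 1"
          "E' = 2 * K + J + 2"
      have e: "2 * (K + J) + 1 = A" "2 * (K + J + 1) - 1 = A" "2 * (K + J + 1) + 1 = D"
          "K + J + 1 + K = E" "K + J + 1 - K = J + 1"
        "2 * K + J + 1 = E" "2 * K + J + 2 = E'" "K + J + 1 + (K + 1) = E'" "E' - 1 = E" "E + 1 = E'"
        by (simp_all add: d)
      have "A \<noteq> 0" "D \<noteq> 0" "E \<noteq> 0" "E' \<noteq> 0" using nn by (simp_all add: d)
      then show ?thesis unfolding e by (simp add: power2_eq_square mult_ac)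
    qed
  qed
qed

section \<open>Shift relations for the three coordinate functions\<close>

lemma poly_legendre_X':
  assumes "k \<le> l"
  shows "x * poly (legendre_deriv l k) x = (real l + 1 - real k) / (2 * real l +
      1) * poly (legendre_deriv (Suc l) k) x
     + (real l + real k) / (2 * real l + 1) * poly (legendre_deriv (l - 1) k) x"
proof (cases l)
  case 0
  then show ?thesis using assms by (simp add: legendre_deriv_def legendre_poly_0 legendre_poly_1)
next
  case (Suc n)
  have "2 * real n + 3 \<noteq> 0" by linarith
  then show ?thesis using poly_legendre_X[of n x k] Suc by (simp add: divide_simps)
      (simp add: algebra_simps)
qed

lemma poly_legendre_deriv_diff':
  "poly (legendre_deriv l k) x = 1 / (2 * real l + 1) * poly (legendre_deriv (Suc l) (Suc k)) x
     - 1 / (2 * real l + 1) * poly (legendre_deriv (l - 1) (Suc k)) x"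
proof (cases l)
  case 0
  have "legendre_deriv 1 (Suc k) = legendre_deriv 0 k"
    unfolding legendre_deriv_def One_nat_def legendre_poly_0 legendre_poly_1 funpow_Suc_right o_apply
        by (simp add: pderiv_poly_X)
  then show ?thesis using 0 by (simp add: legendre_deriv_0_0)
next
  case (Suc n)
  have "2 * real n + 3 \<noteq> 0" by linarith
  then show ?thesis using poly_legendre_deriv_diff[of n k x] Suc by (simp add: divide_simps)
      (simp add: algebra_simps)
qed

lemma sph_poly_X:
  assumes "\<bar>m\<bar> \<le> int l"
  shows "x * poly (sph_poly l m) x = vert_coeff (Suc l) m * poly (sph_poly (Suc l) m) x
     + vert_coeff l m * poly (sph_poly (l - 1) m) x"
proof -
  define k where "k = nat \<bar>m\<bar>"
  have k: "k \<le> l" using assms by (simp add: k_def nat_le_iff)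
  have vc: "vert_coeff j m = vert_coeff j (int k)" for j
    by (auto simp: vert_coeff_def k_def abs_if mult.commute)
  \<comment> \<open>For \<open>k = l > 0\<close> there is no harmonic of degree \<open>l - 1\<close>
    and order \<open>k\<close>, but \<open>legendre_deriv (l - 1) k\<close> is zero; at
    \<open>l = 0\<close> the coefficients on both sides are zero.\<close>
  have "sph_norm l k * ((real l + real k) / (2 * real l + 1)) * poly (legendre_deriv (l - 1) k) x =
      vert_coeff l (int k) * sph_norm (l - 1) k * poly (legendre_deriv (l - 1) k) x"
  proof (cases l)
    case 0
    then show ?thesis using k by (simp add: vert_coeff_def)
  next
    case (Suc n)
    then show ?thesis
      using sph_norm_vert_down[of k n] k by (cases "k \<le> n") (simp_all add: legendre_deriv_eq_0)
  qed
  moreover have "x * (sph_norm l k * poly (legendre_deriv l k) x) =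
     sph_norm l k * ((real l + 1 - real k) / (2 * real l + 1)) * poly (legendre_deriv (Suc l) k) x
     + sph_norm l k * ((real l + real k) / (2 * real l + 1)) * poly (legendre_deriv (l - 1) k) x"
    using poly_legendre_X'[OF k, of x] by algebra
  ultimately have "x * (sph_norm l k * poly (legendre_deriv l k) x) =
     vert_coeff (Suc l) m * (sph_norm (Suc l) k * poly (legendre_deriv (Suc l) k) x)
     + vert_coeff l m * (sph_norm (l - 1) k * poly (legendre_deriv (l - 1) k) x)"
    using sph_norm_vert_up[OF k] by (simp only: vc mult.assoc)
  then have "(if m \<ge> 0 then (-1) ^ nat m else 1) * (x * (sph_norm l k * poly (legendre_deriv l k) x)) =
      (if m \<ge> 0 then (-1) ^ nat m else 1) *
     (vert_coeff (Suc l) m * (sph_norm (Suc l) k * poly (legendre_deriv (Suc l) k) x)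
     + vert_coeff l m * (sph_norm (l - 1) k * poly (legendre_deriv (l - 1) k) x))"
    by (rule arg_cong)
  then show ?thesis
    by (simp only: sph_poly_def poly_smult distrib_left mult_ac flip: k_def)
qed

lemma sph_harm_vert:
  assumes "\<bar>m\<bar> \<le> int l" "x \<in> S2"
  shows "of_real (x $ 3) * sph_harm l m x = of_real (vert_coeff (Suc l) m) * sph_harm (Suc l) m x
     + of_real (vert_coeff l m) * sph_harm (l - 1) m x"
proof -
  have "of_real (x $ 3) * sph_harm l m x = azimuthal m x * of_real (x $ 3 * poly (sph_poly l m)
      (x $ 3))"
    using assms by (simp add: sph_harm_eq)
  then show ?thesis
    unfolding sph_poly_X[OF assms(1)] using assms by (simp add: sph_harm_eq algebra_simps)
qed

text \<open>The factor \<open>zonal_var x\<close> already supplies the power of the sine for order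
  \<open>k + 1\<close>; \<open>poly_legendre_deriv_diff'\<close> rewrites the polynomial part with
  derivatives of that order.\<close>

lemma sph_harm_raise_nonneg:
  assumes "k \<le> l" "x \<in> S2"
  shows "zonal_var x * sph_harm l (int k) x = - of_real (horiz_coeff (Suc l) (int k + 1)) * sph_harm
      (Suc l) (int k + 1) x
     + of_real (horiz_coeff l (- int k)) * sph_harm (l - 1) (int k + 1) x"
proof -
  let ?t = "x $ 3"
  have "sph_norm l k * (1 / (2 * real l + 1)) * poly (legendre_deriv (l - 1) (Suc k)) ?t =
      horiz_coeff l (- int k) * sph_norm (l - 1) (Suc k) * poly (legendre_deriv (l - 1) (Suc k)) ?t"
  proof (cases l)
    case 0
    then show ?thesis using assms by (simp add: legendre_deriv_0_0)
  next
    case (Suc n)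
    then show ?thesis
      using sph_norm_raise_down[of k n] by (cases "Suc k \<le> n") (simp_all add: legendre_deriv_eq_0)
  qed
  moreover have "sph_norm l k * poly (legendre_deriv l k) ?t =
     sph_norm l k * (1 / (2 * real l + 1)) * poly (legendre_deriv (Suc l) (Suc k)) ?t
     - sph_norm l k * (1 / (2 * real l + 1)) * poly (legendre_deriv (l - 1) (Suc k)) ?t"
    using poly_legendre_deriv_diff'[of l k ?t] by algebra
  ultimately have *: "sph_norm l k * poly (legendre_deriv l k) ?t =
     horiz_coeff (Suc l) (int k + 1) * (sph_norm (Suc l) (Suc k) * poly (legendre_deriv (Suc l)
         (Suc k)) ?t)
     - horiz_coeff l (- int k) * (sph_norm (l - 1) (Suc k) * poly (legendre_deriv (l - 1) (Suc k)) ?t)"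
    using sph_norm_raise_up[OF assms(1)] by (simp only: mult.assoc)
  have n: "nat (int k + 1) = Suc k" "nat (1 + int k) = Suc k" "nat \<bar>int k + 1\<bar> = Suc k"
      "nat \<bar>1 + int k\<bar> = Suc k" by linarith+
  have "zonal_var x * sph_harm l (int k) x = zonal_var x ^ Suc k * of_real ((-1) ^ k * (sph_norm l k *
      poly (legendre_deriv l k) ?t))"
    using assms by (simp add: sph_harm_eq azimuthal_def sph_poly_def mult_ac)
  also have "\<dots> = - of_real (horiz_coeff (Suc l) (int k + 1)) * sph_harm (Suc l) (int k + 1) x
     + of_real (horiz_coeff l (- int k)) * sph_harm (l - 1) (int k + 1) x"
    unfolding * using assms by (simp add: sph_harm_eq azimuthal_def sph_poly_def n algebra_simps)
  finally show ?thesis .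
qed

text \<open>On the sphere \<open>cnj (zonal_var x) * zonal_var x\<close> is
  \<open>1 - (x $ 3)^2\<close>, exactly the weight that \<open>poly_legendre_lower\<close>
  absorbs.\<close>

lemma sph_harm_lower_pos:
  assumes "Suc k \<le> l" "x \<in> S2"
  shows "cnj (zonal_var x) * sph_harm l (int k + 1) x = of_real (horiz_coeff (Suc l) (- int k)) *
      sph_harm (Suc l) (int k) x
     - of_real (horiz_coeff l (int k + 1)) * sph_harm (l - 1) (int k) x"
proof -
  let ?t = "x $ 3"
  obtain n where l: "l = Suc n" "k \<le> n" using assms by (metis Suc_le_D Suc_le_mono)
  have "(1 - ?t\<^sup>2) * poly (legendre_deriv l (Suc k)) ?t =
     (real l + real k + 1) * (real l + real k) / (2 * real l + 1) * poly (legendre_deriv (l - 1) k) ?t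
     - (real l - real k) * (real l + 1 - real k) / (2 * real l + 1) * poly (legendre_deriv
         (Suc l) k) ?t"
  proof -
    have "2 * real n + 3 \<noteq> 0" by linarith
    then show ?thesis using poly_legendre_lower[of n ?t k] l by (simp add: divide_simps)
        (simp add: algebra_simps)
  qed
  then have "(1 - ?t\<^sup>2) * (sph_norm l (Suc k) * poly (legendre_deriv l (Suc k)) ?t) =
     sph_norm l (Suc k) * ((real l + real k + 1) * (real l + real k) / (2 * real l + 1)) * poly
         (legendre_deriv (l - 1) k) ?t
     - sph_norm l (Suc k) * ((real l - real k) * (real l + 1 - real k) / (2 * real l + 1)) * poly
         (legendre_deriv (Suc l) k) ?t"
    by algebra
  note e = this
  have l1: "l - 1 = n" using l by simp
  have *: "(1 - ?t\<^sup>2) * (sph_norm l (Suc k) * poly (legendre_deriv l (Suc k)) ?t) =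
     horiz_coeff l (int k + 1) * (sph_norm (l - 1) k * poly (legendre_deriv (l - 1) k) ?t)
     - horiz_coeff (Suc l) (- int k) * (sph_norm (Suc l) k * poly (legendre_deriv (Suc l) k) ?t)"
    by (simp only: e sph_norm_lower_up[OF assms(1)] sph_norm_lower_down[OF l(2), folded l(1)] l1
        mult.assoc)
  have "cnj (zonal_var x) * zonal_var x = of_real (1 - ?t\<^sup>2)"
  proof -
    have "(x $ 1)\<^sup>2 + (x $ 2)\<^sup>2 = 1 - ?t\<^sup>2" using S2_eq[OF assms(2)] by linarith
    then show ?thesis by (simp add: zonal_var_def complex_eq_iff power2_eq_square)
  qed
  moreover have n: "nat (int k + 1) = Suc k" "nat (1 + int k) = Suc k" "nat \<bar>int k + 1\<bar> = Suc k"
      "nat \<bar>1 + int k\<bar> = Suc k" by linarith+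
  ultimately have "cnj (zonal_var x) * sph_harm l (int k + 1) x = zonal_var x ^ k * of_real ((-1) ^ Suc
      k * ((1 - ?t\<^sup>2) * (sph_norm l (Suc k) * poly (legendre_deriv l (Suc k)) ?t)))"
    using assms by (simp add: sph_harm_eq azimuthal_def sph_poly_def)
  also have "\<dots> = of_real (horiz_coeff (Suc l) (- int k)) * sph_harm (Suc l) (int k) x
     - of_real (horiz_coeff l (int k + 1)) * sph_harm (l - 1) (int k) x"
    unfolding * using assms by (simp add: sph_harm_eq azimuthal_def sph_poly_def algebra_simps)
  finally show ?thesis .
qed

lemma sign_nat_abs: "(-1) ^ nat \<bar>m\<bar> = ((-1) powi m :: 'a::field)"
  by (simp add: power_int_minus_left uminus_power_if even_nat_iff)

text \<open>At negative order this is the complex conjugate of the lowering relation at the opposite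
  order.\<close>

lemma sph_harm_raise:
  assumes m: "\<bar>m\<bar> \<le> int l" and x: "x \<in> S2"
  shows "zonal_var x * sph_harm l m x = - of_real (horiz_coeff (Suc l) (m + 1)) * sph_harm (Suc l) (m +
      1) x
     + of_real (horiz_coeff l (- m)) * sph_harm (l - 1) (m + 1) x"
proof (cases "m \<ge> 0")
  case True
  then show ?thesis using sph_harm_raise_nonneg[of "nat m" l x] m x by simp
next
  case False
  define k where "k = nat (- m - 1)"
  have mk: "m = - (int k + 1)" using False by (simp add: k_def)
  have k: "Suc k \<le> l" using m mk by linarith
  define s :: complex where "s = (-1) ^ k"
  have sq: "s * s = 1" by (simp add: s_def flip: power_mult_distrib)
  have c1: "cnj (sph_harm j (int k) x) = s * sph_harm j (- int k) x" for j
    using cnj_sph_harm[OF x, of j "int k"] by (simp add: s_def)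
  have c2: "cnj (sph_harm l (int k + 1) x) = - s * sph_harm l m x"
  proof -
    have "nat \<bar>int k + 1\<bar> = Suc k" by linarith
    then show ?thesis using cnj_sph_harm[OF x, of l "int k + 1"] by (simp add: s_def mk)
  qed
  have "cnj (cnj (zonal_var x) * sph_harm l (int k + 1) x) =
      cnj (of_real (horiz_coeff (Suc l) (- int k)) * sph_harm (Suc l) (int k) x
     - of_real (horiz_coeff l (int k + 1)) * sph_harm (l - 1) (int k) x)"
    using sph_harm_lower_pos[OF k x] by (rule arg_cong)
  then have "zonal_var x * (- s * sph_harm l m x) = of_real (horiz_coeff (Suc l) (- int k)) *
      (s * sph_harm (Suc l) (- int k) x)
     - of_real (horiz_coeff l (int k + 1)) * (s * sph_harm (l - 1) (- int k) x)"
    by (simp add: c1 c2)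
  then have "zonal_var x * sph_harm l m x = - of_real (horiz_coeff (Suc l) (- int k)) * sph_harm
      (Suc l) (- int k) x
     + of_real (horiz_coeff l (int k + 1)) * sph_harm (l - 1) (- int k) x"
    using sq by algebra
  moreover have "- int k = m + 1" "int k + 1 = - m" by (simp_all add: mk)
  ultimately show ?thesis by (simp only:)
qed

text \<open>Conjugate of the raising relation at order \<open>- m\<close>.\<close>

lemma sph_harm_lower:
  assumes m: "\<bar>m\<bar> \<le> int l" and x: "x \<in> S2"
  shows "cnj (zonal_var x) * sph_harm l m x = of_real (horiz_coeff (Suc l) (1 - m)) * sph_harm (Suc l)
      (m - 1) x
     - of_real (horiz_coeff l m) * sph_harm (l - 1) (m - 1) x"
proof -
  define s :: complex where "s = (-1) powi m"
  have sq: "s * s = 1" by (simp add: s_def power_int_minus_left)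
  have c1: "cnj (sph_harm j (- m + 1) x) = - s * sph_harm j (m - 1) x" for j
    using cnj_sph_harm[OF x, of j "- m + 1"] unfolding sign_nat_abs by
        (simp add: s_def power_int_minus_left)
  have c2: "cnj (sph_harm l (- m) x) = s * sph_harm l m x"
    using cnj_sph_harm[OF x, of l "- m"] unfolding sign_nat_abs by
        (simp add: s_def power_int_minus_left)
  have "cnj (zonal_var x * sph_harm l (- m) x) = cnj (- of_real (horiz_coeff (Suc l) (- m +
      1)) * sph_harm (Suc l) (- m + 1) x
     + of_real (horiz_coeff l (- (- m))) * sph_harm (l - 1) (- m + 1) x)"
    using sph_harm_raise[of "- m" l x] m x by (intro arg_cong[where f=cnj]) auto
  then have "cnj (zonal_var x) * (s * sph_harm l m x) = of_real (horiz_coeff (Suc l) (1 - m)) *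
      (s * sph_harm (Suc l) (m - 1) x)
     - of_real (horiz_coeff l m) * (s * sph_harm (l - 1) (m - 1) x)"
    by (simp only: complex_cnj_mult complex_cnj_add complex_cnj_minus complex_cnj_complex_of_real c1
        c2) simp
  then show ?thesis using sq by algebra
qed

section \<open>Isotropic kernels are diagonal in the spherical harmonics\<close>

interpretation surface_pair: pair_sigma_finite surface_measure surface_measure ..

abbreviation surface2 :: "((real^3) \<times> (real^3)) measure" where
  "surface2 \<equiv> surface_measure \<Otimes>\<^sub>M surface_measure"

lemma borel_measurable_cnj [measurable]: "cnj \<in> borel_measurable borel"
  by (intro borel_measurable_continuous_onI continuous_intros)

definition kernel_form :: "(real \<Rightarrow> real) \<Rightarrow> (real^3 \<Rightarrow> complex) \<Rightarrow> (real^3 \<Rightarrow> complex) \<Rightarrow> complex" where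
  "kernel_form F f g = (\<integral>z. of_real (F (fst z \<bullet> snd z)) * (f (fst z) * cnj (g (snd z))) \<partial>surface2)"

lemma finite_measure_surface2: "finite_measure surface2"
  by (rule finite_measure_pair_measure) (rule finite_measure_surface)+

lemma inner_measurable_surface2 [measurable]: "(\<lambda>z. fst z \<bullet> snd z) \<in> borel_measurable surface2"
proof -
  have i: "(\<lambda>x. x) \<in> borel_measurable surface_measure"
    by (simp add: measurable_restrict_space1 cong: measurable_cong_sets)
  have "(\<lambda>z. fst z) \<in> borel_measurable surface2" "(\<lambda>z. snd z) \<in> borel_measurable surface2"
    using measurable_compose[OF measurable_fst i] measurable_compose[OF measurable_snd i] by auto
  then show ?thesis by simp
qed

lemma S2_inner_bound: "x \<in> S2 \<Longrightarrow> y \<in> S2 \<Longrightarrow> \<bar>x \<bullet> y\<bar> \<le> 1"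
  using Cauchy_Schwarz_ineq2[of x y] by simp

lemma kernel_form_integrable:
  assumes F: "continuous_on UNIV F" and f: "continuous_on S2 f" and g: "continuous_on S2 g"
  shows "integrable surface2 (\<lambda>z. of_real (F (fst z \<bullet> snd z)) * (f (fst z) * cnj (g (snd z))))"
proof -
  interpret p: finite_measure surface2 by (rule finite_measure_surface2)
  have "compact (F ` {-1..1})" using F by (intro compact_continuous_image)
      (auto intro: continuous_on_subset)
  then obtain B where B: "\<And>s. s \<in> {-1..1} \<Longrightarrow> \<bar>F s\<bar> \<le> B"
    using compact_imp_bounded bounded_iff by (metis image_eqI real_norm_def)
  have "\<exists>B. \<forall>x\<in>S2. norm (h x) \<le> B" if "continuous_on S2 h" for h :: "real^3 \<Rightarrow> complex"
  proof -
    have "compact (h ` S2)" using that by (intro compact_continuous_image) auto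
    then show ?thesis using compact_imp_bounded bounded_iff by (metis image_eqI)
  qed
  from this[OF f] this[OF g] obtain Bf Bg where Bf: "\<And>x. x \<in> S2 \<Longrightarrow> norm (f x) \<le> Bf"
      and Bg: "\<And>x. x \<in> S2 \<Longrightarrow> norm (g x) \<le> Bg"
    by blast
  have [measurable]: "f \<in> borel_measurable surface_measure" "g \<in> borel_measurable surface_measure"
    using f g sphere_borel_measurable_continuous by (simp_all cong: measurable_cong_sets)
  have [measurable]: "F \<in> borel_measurable borel" using F by (rule borel_measurable_continuous_onI)
  have [measurable]: "(\<lambda>z. f (fst z)) \<in> borel_measurable surface2"
      "(\<lambda>z. g (snd z)) \<in> borel_measurable surface2"
    by measurable
  show ?thesis
  proof (rule p.integrable_const_bound[of _ "B * (Bf * Bg)"])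
    show "AE z in surface2. norm (of_real (F (fst z \<bullet> snd z)) * (f (fst z) * cnj (g (snd z)))) \<le>
        B * (Bf * Bg)"
    proof (rule AE_I2)
      fix z assume "z \<in> space surface2"
      then have z: "fst z \<in> S2" "snd z \<in> S2" by (auto simp: space_pair_measure)
      have "\<bar>F (fst z \<bullet> snd z)\<bar> \<le> B" using B S2_inner_bound[OF z] by (auto simp: abs_le_iff)
      then show "norm (of_real (F (fst z \<bullet> snd z)) * (f (fst z) * cnj (g (snd z)))) \<le> B * (Bf * Bg)"
        using Bf[OF z(1)] Bg[OF z(2)]
        by (auto simp: norm_mult intro!: mult_mono mult_nonneg_nonneg) (meson norm_ge_zero order_trans)+
    qed
  qed measurable
qed

lemma kernel_form_cong:
  assumes "\<And>x. x \<in> S2 \<Longrightarrow> f x = f' x" "\<And>x. x \<in> S2 \<Longrightarrow> g x = g' x" "\<And>s. \<bar>s\<bar> \<le> 1 \<Longrightarrow> F s = F' s"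
  shows "kernel_form F f g = kernel_form F' f' g'"
  unfolding kernel_form_def using assms S2_inner_bound
  by (intro Bochner_Integration.integral_cong) (auto simp: space_pair_measure)

lemma kernel_form_left:
  assumes "continuous_on UNIV F" "continuous_on S2 f1" "continuous_on S2 f2" "continuous_on S2 g"
  shows "kernel_form F (\<lambda>x. a * f1 x + b * f2 x) g = a * kernel_form F f1 g + b * kernel_form F f2 g"
proof -
  have "kernel_form F (\<lambda>x. a * f1 x + b * f2 x) g =
    (\<integral>z. a * (of_real (F (fst z \<bullet> snd z)) * (f1 (fst z) * cnj (g (snd z)))) + b * (of_real
        (F (fst z \<bullet> snd z)) * (f2 (fst z) * cnj (g (snd z)))) \<partial>surface2)"
    unfolding kernel_form_def by (intro Bochner_Integration.integral_cong) (auto simp: algebra_simps)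
  then show ?thesis
    using assms by (simp add: kernel_form_def kernel_form_integrable)
qed

lemma kernel_form_right:
  assumes "continuous_on UNIV F" "continuous_on S2 g1" "continuous_on S2 g2" "continuous_on S2 f"
  shows "kernel_form F f (\<lambda>x. of_real a * g1 x + of_real b * g2 x) = of_real a * kernel_form F f g1 +
      of_real b * kernel_form F f g2"
proof -
  have "kernel_form F f (\<lambda>x. of_real a * g1 x + of_real b * g2 x) =
    (\<integral>z. of_real a * (of_real (F (fst z \<bullet> snd z)) * (f (fst z) * cnj (g1 (snd z)))) + of_real b *
        (of_real (F (fst z \<bullet> snd z)) * (f (fst z) * cnj (g2 (snd z)))) \<partial>surface2)"
    unfolding kernel_form_def by (intro Bochner_Integration.integral_cong) (auto simp: algebra_simps)
  then show ?thesis
    using assms by (simp add: kernel_form_def kernel_form_integrable)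
qed

lemma kernel_form_power_Suc:
  assumes f: "continuous_on S2 f" and g: "continuous_on S2 g"
  shows "kernel_form (\<lambda>s. s ^ Suc n) f g =
     kernel_form (\<lambda>s. s ^ n) (\<lambda>x. of_real (x $ 3) * f x) (\<lambda>x. of_real (x $ 3) * g x)
     + (kernel_form (\<lambda>s. s ^ n) (\<lambda>x. zonal_var x * f x) (\<lambda>x. zonal_var x * g x)
     + kernel_form (\<lambda>s. s ^ n) (\<lambda>x. cnj (zonal_var x) * f x) (\<lambda>x. cnj (zonal_var x) * g x)) / 2"
proof -
  let ?I = "\<lambda>f g z. of_real ((fst z \<bullet> snd z) ^ n) * (f (fst z) * cnj (g (snd z))) :: complex"
  have F: "continuous_on UNIV (\<lambda>s::real. s ^ n)" by (intro continuous_intros)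
  have inn: "of_real (x \<bullet> y) = of_real (x $ 3) * of_real (y $ 3) + (zonal_var x * cnj (zonal_var y) +
      cnj (zonal_var x) * zonal_var y) / 2" for x y :: "real^3"
    by (simp add: inner_vec_def sum_3 zonal_var_def complex_eq_iff)
  have "kernel_form (\<lambda>s. s ^ Suc n) f g =
    (\<integral>z. ?I (\<lambda>x. of_real (x $ 3) * f x) (\<lambda>x. of_real (x $ 3) * g x) z
      + (?I (\<lambda>x. zonal_var x * f x) (\<lambda>x. zonal_var x * g x) z + ?I (\<lambda>x. cnj (zonal_var x) * f x)
          (\<lambda>x. cnj (zonal_var x) * g x) z) / 2 \<partial>surface2)"
    unfolding kernel_form_def
    by (intro Bochner_Integration.integral_cong refl) (simp add: inn field_simps)
  moreover have "integrable surface2 (?I (\<lambda>x. of_real (x $ 3) * f x) (\<lambda>x. of_real (x $ 3) * g x))"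
    "integrable surface2 (?I (\<lambda>x. zonal_var x * f x) (\<lambda>x. zonal_var x * g x))"
    "integrable surface2 (?I (\<lambda>x. cnj (zonal_var x) * f x) (\<lambda>x. cnj (zonal_var x) * g x))"
    by (intro kernel_form_integrable[OF F] continuous_intros f g)+
  ultimately show ?thesis
    by (simp only: kernel_form_def Bochner_Integration.integral_add integral_divide_zero
        Bochner_Integration.integrable_add integrable_divide_zero)
qed

section \<open>Identities between the shift coefficients\<close>

lemma vert_coeff_sq: "\<bar>m\<bar> \<le> int l \<Longrightarrow>
    (vert_coeff l m)\<^sup>2 = (real l + of_int m) * (real l - of_int m) / ((2 * real l - 1) *
        (2 * real l + 1))"
proof -
  assume "\<bar>m\<bar> \<le> int l"
  then have "\<bar>real_of_int m\<bar> \<le> real l" by (metis of_int_abs of_int_le_iff of_int_of_nat_eq)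
  then show ?thesis
    by (cases "l = 0") (auto simp: vert_coeff_def real_sqrt_pow2_iff intro!: real_sqrt_pow2
        divide_nonneg_nonneg mult_nonneg_nonneg)
qed

lemma horiz_coeff_sq: "- int l \<le> m \<Longrightarrow> m \<le> int l \<Longrightarrow>
    (horiz_coeff l m)\<^sup>2 = (real l + of_int m) * (real l + of_int m - 1) / ((2 * real l - 1) *
        (2 * real l + 1))"
proof -
  assume m: "- int l \<le> m" "m \<le> int l"
  define j where "j = nat (int l + m)"
  have j: "real j = real l + of_int m" using m by (simp add: j_def)
  show ?thesis
  proof (cases "l = 0 \<or> j = 0")
    case True
    then have "l = 0 \<and> m = 0 \<or> j = 0" using m by auto
    then show ?thesis using j by (auto simp: horiz_coeff_def)
  next
    case False
    then have "real l \<ge> 1" "real j \<ge> 1" by simp_all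
    then show ?thesis unfolding horiz_coeff_def j[symmetric] by (intro real_sqrt_pow2) simp
  qed
qed

text \<open>Where the harmonic of lower degree does not exist, the coefficient leading to it is
  zero. Together with its two horizontal analogues this ensures that the guard in
  \<open>diag_entry\<close> drops no contribution.\<close>

lemma vert_coeff_guard: "\<bar>m\<bar> \<le> int l \<Longrightarrow> \<not> \<bar>m\<bar> \<le> int (l - 1) \<Longrightarrow> vert_coeff l m = 0"
proof -
  assume "\<bar>m\<bar> \<le> int l" "\<not> \<bar>m\<bar> \<le> int (l - 1)"
  then have "m = int l \<or> m = - int l" by linarith
  then show ?thesis by (auto simp: vert_coeff_def)
qed

lemma horiz_coeff_guard: "\<bar>m\<bar> \<le> int l \<Longrightarrow> \<not> \<bar>m + 1\<bar> \<le> int (l - 1) \<Longrightarrow> horiz_coeff l (- m) = 0"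
proof -
  assume "\<bar>m\<bar> \<le> int l" "\<not> \<bar>m + 1\<bar> \<le> int (l - 1)"
  then have "m = int l \<or> m = int l - 1" by linarith
  then show ?thesis by (auto simp: horiz_coeff_def)
qed

lemma horiz_coeff_guard': "\<bar>m\<bar> \<le> int l \<Longrightarrow> \<not> \<bar>m - 1\<bar> \<le> int (l - 1) \<Longrightarrow> horiz_coeff l m = 0"
  using horiz_coeff_guard[of "- m" l] by (simp add: abs_minus_commute)

text \<open>The dependence on \<open>m\<close> cancels between the vertical and the two horizontal
  parts; with \<open>coeff_sum_down\<close> this is why the diagonal entries stay independent of the
  order.\<close>

lemma coeff_sum_up:
  assumes "\<bar>m\<bar> \<le> int l"
  shows "(vert_coeff (Suc l) m)\<^sup>2 + ((horiz_coeff (Suc l) (m + 1))\<^sup>2 + (horiz_coeff (Suc l) (1 - m))\<^sup>2) /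
      2 = (real l + 1) / (2 * real l + 1)"
proof -
  define L M where LM: "L = real l" "M = real_of_int m"
  have 1: "(vert_coeff (Suc l) m)\<^sup>2 = (L + 1 + M) * (L + 1 - M) / ((2 * L + 1) * (2 * L + 3))"
    using assms by (subst vert_coeff_sq) (auto simp: LM algebra_simps)
  have 2: "(horiz_coeff (Suc l) (m + 1))\<^sup>2 = (L + 2 + M) * (L + 1 + M) / ((2 * L + 1) * (2 * L + 3))"
    using assms by (subst horiz_coeff_sq) (auto simp: LM algebra_simps)
  have 3: "(horiz_coeff (Suc l) (1 - m))\<^sup>2 = (L + 2 - M) * (L + 1 - M) / ((2 * L + 1) * (2 * L + 3))"
    using assms by (subst horiz_coeff_sq) (auto simp: LM algebra_simps)
  have nz: "2 * L + 1 \<noteq> 0" "2 * L + 3 \<noteq> 0" unfolding LM by linarith+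
  have "(vert_coeff (Suc l) m)\<^sup>2 + ((horiz_coeff (Suc l) (m + 1))\<^sup>2 + (horiz_coeff (Suc l) (1 - m))\<^sup>2) / 2
      =
    ((L + 1 + M) * (L + 1 - M) + ((L + 2 + M) * (L + 1 + M) + (L + 2 - M) * (L + 1 - M)) / 2) /
        ((2 * L + 1) * (2 * L + 3))"
    unfolding 1 2 3 by (simp add: add_divide_distrib)
  also have "(L + 1 + M) * (L + 1 - M) + ((L + 2 + M) * (L + 1 + M) + (L + 2 - M) * (L + 1 - M)) / 2 =
      (L + 1) * (2 * L + 3)"
    by (simp add: field_simps)
  also have "(L + 1) * (2 * L + 3) / ((2 * L + 1) * (2 * L + 3)) = (L + 1) / (2 * L + 1)"
    using nz by simp
  finally show ?thesis by (simp add: LM)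
qed

lemma coeff_sum_down:
  assumes "\<bar>m\<bar> \<le> int l"
  shows "(vert_coeff l m)\<^sup>2 + ((horiz_coeff l (- m))\<^sup>2 + (horiz_coeff l m)\<^sup>2) / 2 = real l / (2 * real l +
      1)"
proof -
  define L M where LM: "L = real l" "M = real_of_int m"
  have 1: "(vert_coeff l m)\<^sup>2 = (L + M) * (L - M) / ((2 * L - 1) * (2 * L + 1))"
    using assms by (subst vert_coeff_sq) (auto simp: LM)
  have 2: "(horiz_coeff l (- m))\<^sup>2 = (L - M) * (L - M - 1) / ((2 * L - 1) * (2 * L + 1))"
    using assms by (subst horiz_coeff_sq) (auto simp: LM)
  have 3: "(horiz_coeff l m)\<^sup>2 = (L + M) * (L + M - 1) / ((2 * L - 1) * (2 * L + 1))"
    using assms by (subst horiz_coeff_sq) (auto simp: LM)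
  have nz: "2 * L - 1 \<noteq> 0"
  proof
    assume "2 * L - 1 = 0"
    then have "real (2 * l) = real 1" by (simp add: LM)
    then have "2 * l = 1" by (simp only: of_nat_eq_iff)
    then show False by presburger
  qed
  have "(vert_coeff l m)\<^sup>2 + ((horiz_coeff l (- m))\<^sup>2 + (horiz_coeff l m)\<^sup>2) / 2 =
    ((L + M) * (L - M) + ((L - M) * (L - M - 1) + (L + M) * (L + M - 1)) / 2) / ((2 * L - 1) *
        (2 * L + 1))"
    unfolding 1 2 3 by (simp add: add_divide_distrib)
  also have "(L + M) * (L - M) + ((L - M) * (L - M - 1) + (L + M) * (L + M - 1)) / 2 = (2 * L - 1) * L"
    by (simp add: field_simps)
  also have "(2 * L - 1) * L / ((2 * L - 1) * (2 * L + 1)) = L / (2 * L + 1)"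
    using nz by simp
  finally show ?thesis by (simp add: LM)
qed

text \<open>All three products are the same square root. In the inductive step the horizontal ones
  enter with a minus sign, so the entries between degrees \<open>l\<close> and \<open>l + 2\<close>
  cancel.\<close>

lemma coeff_cross:
  "vert_coeff (Suc l) m * vert_coeff (Suc (Suc l)) m =
     (horiz_coeff (Suc l) (m + 1) * horiz_coeff (Suc (Suc l)) (- m) + horiz_coeff (Suc l)
         (1 - m) * horiz_coeff (Suc (Suc l)) m) / 2"
proof -
  define L M where LM: "L = real l" "M = real_of_int m"
  let ?D = "(2 * L + 1) * (2 * L + 3) * ((2 * L + 3) * (2 * L + 5))"
  let ?N = "sqrt ((L + 1 + M) * (L + 1 - M) * (L + 2 + M) * (L + 2 - M) / ?D)"
  have "vert_coeff (Suc l) m * vert_coeff (Suc (Suc l)) m = ?N"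
    "horiz_coeff (Suc l) (m + 1) * horiz_coeff (Suc (Suc l)) (- m) = ?N"
    "horiz_coeff (Suc l) (1 - m) * horiz_coeff (Suc (Suc l)) m = ?N"
    unfolding vert_coeff_def horiz_coeff_def real_sqrt_mult[symmetric] times_divide_times_eq
    by (auto intro!: arg_cong[where f=sqrt] arg_cong2[where f="(/)"] simp: LM algebra_simps)
  then show ?thesis by simp
qed

text \<open>The bound on \<open>m\<close> belongs to the entry because shifts can lead to orders
  beyond the degree, where the harmonic is zero.\<close>

definition diag_entry :: "(nat \<Rightarrow> real) \<Rightarrow> nat \<Rightarrow> int \<Rightarrow> nat \<Rightarrow> int \<Rightarrow> real" where
  "diag_entry \<mu> l m l' m' = (if l = l' \<and> m = m' \<and> \<bar>m\<bar> \<le> int l then \<mu> l else 0)"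

text \<open>The left side is the effect of one more factor \<open>x \<bullet> y\<close>, expanded on
  both arguments: \<open>A\<close> for the third coordinate, the two groups with \<open>B\<close>
  for raising and lowering. The new diagonal carries the weights of Bonnet's recurrence.\<close>

lemma diag_entry_step:
  fixes \<mu> :: "nat \<Rightarrow> real"
  assumes m: "\<bar>m\<bar> \<le> int l" "\<bar>m'\<bar> \<le> int l'"
  defines "d \<equiv> diag_entry \<mu>" and "A \<equiv> vert_coeff" and "B \<equiv> horiz_coeff"
  shows "A (Suc l) m * A (Suc l') m' * d (Suc l) m (Suc l') m' + A (Suc l) m * A l' m' * d (Suc l) m
      (l' - 1) m'
      + A l m * A (Suc l') m' * d (l - 1) m (Suc l') m' + A l m * A l' m' * d (l - 1) m (l' - 1) m'
      + ((B (Suc l) (m + 1) * B (Suc l') (m' + 1) * d (Suc l) (m + 1) (Suc l') (m' + 1)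
          - B (Suc l) (m + 1) * B l' (- m') * d (Suc l) (m + 1) (l' - 1) (m' + 1)
          - B l (- m) * B (Suc l') (m' + 1) * d (l - 1) (m + 1) (Suc l') (m' + 1)
          + B l (- m) * B l' (- m') * d (l - 1) (m + 1) (l' - 1) (m' + 1))
       + (B (Suc l) (1 - m) * B (Suc l') (1 - m') * d (Suc l) (m - 1) (Suc l') (m' - 1)
          - B (Suc l) (1 - m) * B l' m' * d (Suc l) (m - 1) (l' - 1) (m' - 1)
          - B l m * B (Suc l') (1 - m') * d (l - 1) (m - 1) (Suc l') (m' - 1)
          + B l m * B l' m' * d (l - 1) (m - 1) (l' - 1) (m' - 1))) / 2
      = diag_entry (\<lambda>l. ((real l + 1) * \<mu> (Suc l) + real l * \<mu> (l - 1)) / (2 * real l + 1)) l m l' m'"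
proof (cases "m = m'")
  case False
  then show ?thesis by (simp add: d_def diag_entry_def)
next
  case mm: True
  consider "l = l'" | "l' = Suc (Suc l)" | "l = Suc (Suc l')" | "l \<noteq> l'" "l' \<noteq> Suc (Suc l)"
      "l \<noteq> Suc (Suc l')" by blast
  then show ?thesis
  proof cases
    case 1
    have n: "Suc l \<noteq> l - 1" "l - 1 \<noteq> Suc l" by linarith+
    have g1: "A l m * A l m * d (l - 1) m (l - 1) m = (A l m)\<^sup>2 * \<mu> (l - 1)"
      using vert_coeff_guard[OF m(1)] by (auto simp: d_def A_def diag_entry_def power2_eq_square)
    have g2: "B l (- m) * B l (- m) * d (l - 1) (m + 1) (l - 1) (m + 1) = (B l (- m))\<^sup>2 * \<mu> (l - 1)"
      using horiz_coeff_guard[OF m(1)] by (auto simp: d_def B_def diag_entry_def power2_eq_square)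
    have g3: "B l m * B l m * d (l - 1) (m - 1) (l - 1) (m - 1) = (B l m)\<^sup>2 * \<mu> (l - 1)"
      using horiz_coeff_guard'[OF m(1)] by (auto simp: d_def B_def diag_entry_def power2_eq_square)
    have h: "d (Suc l) m (Suc l) m = \<mu> (Suc l)" "d (Suc l) (m + 1) (Suc l) (m + 1) = \<mu> (Suc l)"
        "d (Suc l) (m - 1) (Suc l) (m - 1) = \<mu> (Suc l)"
      using m by (auto simp: d_def diag_entry_def)
    have z: "d (Suc l) k (l - 1) k' = 0" "d (l - 1) k (Suc l) k' = 0" for k k'
      using n by (simp_all add: d_def diag_entry_def)
    define a b where ab: "a = \<mu> (Suc l)" "b = \<mu> (l - 1)"
    have "((A (Suc l) m)\<^sup>2 + ((B (Suc l) (m + 1))\<^sup>2 + (B (Suc l) (1 - m))\<^sup>2) / 2) * a + ((A l m)\<^sup>2 +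
        ((B l (- m))\<^sup>2 + (B l m)\<^sup>2) / 2) * b
      = diag_entry (\<lambda>l. ((real l + 1) * \<mu> (Suc l) + real l * \<mu> (l - 1)) / (2 * real l + 1)) l m l m"
      unfolding A_def B_def coeff_sum_up[OF m(1)] coeff_sum_down[OF m(1)]
      using m by (simp add: diag_entry_def ab flip: add_divide_distrib)
    then show ?thesis
      unfolding 1[symmetric] mm[symmetric] g1 g2 g3 h z ab by (simp add: field_simps power2_eq_square)
  next
    case 2
    have z: "d (Suc l) k (Suc l') k' = 0" "d (l - 1) k (Suc l') k' = 0"
        "d (l - 1) k (l' - 1) k' = 0" for k k'
    proof -
      have "Suc l \<noteq> Suc l'" "l - 1 \<noteq> Suc l'" "l - 1 \<noteq> l' - 1" using 2 by linarith+
      then show "d (Suc l) k (Suc l') k' = 0" "d (l - 1) k (Suc l') k' = 0"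
          "d (l - 1) k (l' - 1) k' = 0"
        unfolding d_def diag_entry_def by metis+
    qed
    have h: "d (Suc l) m (Suc l) m = \<mu> (Suc l)" "d (Suc l) (m + 1) (Suc l) (m + 1) = \<mu> (Suc l)"
        "d (Suc l) (m - 1) (Suc l) (m - 1) = \<mu> (Suc l)"
      using m by (auto simp: d_def diag_entry_def)
    have z': "d (l - 1) k (Suc l) k' = 0" for k k'
    proof -
      have "l - 1 \<noteq> Suc l" by linarith
      then show ?thesis unfolding d_def diag_entry_def by metis
    qed
    have l': "l' - 1 = Suc l" using 2 by simp
    have r: "diag_entry f l m l' m = 0" for f using 2 by (simp add: diag_entry_def)
    show ?thesis
      unfolding mm[symmetric] z z' l' h r using arg_cong[OF coeff_cross[of l m], of "\<lambda>t. t * \<mu> (Suc l)"]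
      by (simp add: A_def B_def 2 field_simps)
  next
    case 3
    have z: "d (Suc l) k (Suc l') k' = 0" "d (Suc l) k (l' - 1) k' = 0"
        "d (l - 1) k (l' - 1) k' = 0" for k k'
    proof -
      have "Suc l \<noteq> Suc l'" "Suc l \<noteq> l' - 1" "l - 1 \<noteq> l' - 1" using 3 by linarith+
      then show "d (Suc l) k (Suc l') k' = 0" "d (Suc l) k (l' - 1) k' = 0"
          "d (l - 1) k (l' - 1) k' = 0"
        unfolding d_def diag_entry_def by metis+
    qed
    have h: "d (Suc l') m (Suc l') m = \<mu> (Suc l')" "d (Suc l') (m + 1) (Suc l') (m + 1) = \<mu> (Suc l')"
        "d (Suc l') (m - 1) (Suc l') (m - 1) = \<mu> (Suc l')"
      using m mm by (auto simp: d_def diag_entry_def)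
    have z': "d (Suc l') k (l' - 1) k' = 0" for k k'
    proof -
      have "Suc l' \<noteq> l' - 1" by linarith
      then show ?thesis unfolding d_def diag_entry_def by metis
    qed
    have l': "l - 1 = Suc l'" using 3 by simp
    have r: "diag_entry f l m l' m = 0" for f using 3 by (simp add: diag_entry_def)
    show ?thesis
      unfolding mm[symmetric] z z' l' h r using arg_cong[OF coeff_cross[of l' m], of
          "\<lambda>t. t * \<mu> (Suc l')"]
      by (simp add: A_def B_def 3 field_simps)
  next
    case 4
    have z: "d (Suc l) k (Suc l') k' = 0" "d (Suc l) k (l' - 1) k' = 0"
        "d (l - 1) k (Suc l') k' = 0" for k k'
      using 4 by (auto simp: d_def diag_entry_def)
    have w: "A l m * A l' m' * d (l - 1) k (l' - 1) k' = 0"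
        "B l (- m) * B l' (- m') * d (l - 1) k (l' - 1) k' = 0"
        "B l m * B l' m' * d (l - 1) k (l' - 1) k' = 0" for k k'
    proof -
      \<comment> \<open>Truncation gives the distinct degrees 0 and 1 the common predecessor 0; the
        coefficients at degree 0 are zero.\<close>
      consider "l = 0" | "l' = 0" | "l - 1 \<noteq> l' - 1" using 4 by linarith
      then have "A l m * A l' m' * d (l - 1) k (l' - 1) k' = 0 \<and> B l (- m) * B l' (- m') * d (l - 1) k
          (l' - 1) k' = 0 \<and> B l m * B l' m' * d (l - 1) k (l' - 1) k' = 0"
        using m by cases (auto simp: A_def B_def vert_coeff_def horiz_coeff_def d_def diag_entry_def)
      then show "A l m * A l' m' * d (l - 1) k (l' - 1) k' = 0"
          "B l (- m) * B l' (- m') * d (l - 1) k (l' - 1) k' = 0"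
          "B l m * B l' m' * d (l - 1) k (l' - 1) k' = 0"
        by blast+
    qed
    have r: "diag_entry f l m l' m' = 0" for f using 4 by (simp add: diag_entry_def)
    show ?thesis unfolding z w r by simp
  qed
qed

lemma kernel_form_bilinear:
  assumes F: "continuous_on UNIV F" and c: "continuous_on S2 f1" "continuous_on S2 f2"
      "continuous_on S2 g1" "continuous_on S2 g2"
  shows "kernel_form F (\<lambda>x. of_real a * f1 x + of_real b * f2 x) (\<lambda>x. of_real c * g1 x +
      of_real d * g2 x) =
    of_real (a * c) * kernel_form F f1 g1 + of_real (a * d) * kernel_form F f1 g2 +
    of_real (b * c) * kernel_form F f2 g1 + of_real (b * d) * kernel_form F f2 g2"
proof -
  have "continuous_on S2 (\<lambda>x. of_real c * g1 x + of_real d * g2 x)" by (intro continuous_intros c)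
  from kernel_form_left[OF F c(1,2) this, of "of_real a" "of_real b"] show ?thesis
    using kernel_form_right[OF F c(3,4,1), of c d] kernel_form_right[OF F c(3,4,2), of c d]
    by (simp add: algebra_simps)
qed

text \<open>Integration is, up to a constant, the inner product with the constant harmonic
  \<open>sph_harm 0 0\<close>.\<close>

lemma integral_sph_harm:
  assumes "\<bar>m\<bar> \<le> int l"
  shows "(\<integral>x. sph_harm l m x \<partial>surface_measure) = (if l = 0 then of_real (sqrt (4 * pi)) else 0)"
proof -
  have Y: "cnj (sph_harm 0 0 x) = of_real (1 / sqrt (4 * pi))" if "x \<in> S2" for x
    using that by (simp add: sph_harm_eq azimuthal_def sph_poly_def sph_norm_def legendre_deriv_0_0
        real_sqrt_divide)
  have "(if l = 0 \<and> m = 0 then 1 else 0) = (\<integral>x. sph_harm l m x * cnj (sph_harm 0 0 x) \<partial>surface_measure)"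
    using sph_harm_orthonormal[of m l 0 0] assms by simp
  also have "\<dots> = (\<integral>x. sph_harm l m x * of_real (1 / sqrt (4 * pi)) \<partial>surface_measure)"
    by (intro Bochner_Integration.integral_cong) (simp_all add: Y)
  also have "\<dots> = (\<integral>x. sph_harm l m x \<partial>surface_measure) * of_real (1 / sqrt (4 * pi))"
    by (rule integral_mult_left_zero)
  finally have "(\<integral>x. sph_harm l m x \<partial>surface_measure) * of_real (1 / sqrt (4 * pi)) = (if l = 0 \<and> m =
      0 then 1 else 0)"
    by simp
  then have "(\<integral>x. sph_harm l m x \<partial>surface_measure) = (if l = 0 \<and> m = 0 then of_real (sqrt (4 * pi))
      else 0)"
    by (auto simp: divide_eq_eq)
  then show ?thesis using assms by auto
qed

lemma kernel_form_power_diag: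
  "\<exists>\<mu>. \<forall>l l' m m'. kernel_form (\<lambda>s. s ^ n) (sph_harm l m) (sph_harm l' m') =
      of_real (diag_entry \<mu> l m l' m')"
proof (induction n)
  case 0
  \<comment> \<open>For the constant kernel the form is a product of two integrals; it is nonzero
    only in degree 0, where it equals the area \<open>4 * pi\<close>.\<close>
  have "kernel_form (\<lambda>s. s ^ 0) (sph_harm l m) (sph_harm l' m') = of_real (diag_entry (\<lambda>l. if l =
      0 then 4 * pi else 0) l m l' m')" for l l' m m'
  proof (cases "\<bar>m\<bar> \<le> int l \<and> \<bar>m'\<bar> \<le> int l'")
    case True
    have "kernel_form (\<lambda>s. s ^ 0) (sph_harm l m) (sph_harm l' m') = (\<integral>z. sph_harm l m (fst z) * cnj
        (sph_harm l' m' (snd z)) \<partial>surface2)"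
      by (simp add: kernel_form_def)
    also have "\<dots> = (\<integral>x. sph_harm l m x \<partial>surface_measure) * (\<integral>y. cnj (sph_harm l' m' y)
        \<partial>surface_measure)"
      by (rule surface_pair.integral_mult_pair)
          (auto intro!: surface_integrable_continuous continuous_intros continuous_on_sph_harm)
    also have "\<dots> = (\<integral>x. sph_harm l m x \<partial>surface_measure) * cnj (\<integral>y. sph_harm l' m' y \<partial>surface_measure)"
      by simp
    also have "\<dots> = of_real (diag_entry (\<lambda>l. if l = 0 then 4 * pi else 0) l m l' m')"
    proof -
      have "complex_of_real (sqrt (4 * pi)) * complex_of_real (sqrt (4 * pi)) = of_real (4 * pi)"
        by (simp del: of_real_mult flip: of_real_mult)
      then show ?thesis
        using True by (auto simp: integral_sph_harm diag_entry_def simp del: of_real_mult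
            real_sqrt_four)
    qed
    finally show ?thesis .
  next
    case False
    then have "(\<forall>x\<in>S2. sph_harm l m x = 0) \<or> (\<forall>x\<in>S2. sph_harm l' m' x = 0)"
      using sph_harm_eq_0 not_le by metis
    then have "kernel_form (\<lambda>s. s ^ 0) (sph_harm l m) (sph_harm l' m') = (\<integral>z. 0 \<partial>surface2)"
      unfolding kernel_form_def by (intro Bochner_Integration.integral_cong)
          (auto simp: space_pair_measure)
    then show ?thesis using False by (auto simp: diag_entry_def)
  qed
  then show ?case by blast
next
  case (Suc n)
  then obtain \<mu> where IH: "\<And>l l' m m'. kernel_form (\<lambda>s. s ^ n) (sph_harm l m) (sph_harm l' m') =
      of_real (diag_entry \<mu> l m l' m')"
    by blast
  let ?\<mu>' = "\<lambda>l. ((real l + 1) * \<mu> (Suc l) + real l * \<mu> (l - 1)) / (2 * real l + 1)"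
  have F: "continuous_on UNIV (\<lambda>s::real. s ^ n)" by (intro continuous_intros)
  note cY = continuous_on_sph_harm
  note bil = kernel_form_bilinear[OF F cY cY cY cY]
  have "kernel_form (\<lambda>s. s ^ Suc n) (sph_harm l m) (sph_harm l' m') = of_real (diag_entry ?\<mu>' l m l'
      m')" for l l' m m'
  proof (cases "\<bar>m\<bar> \<le> int l \<and> \<bar>m'\<bar> \<le> int l'")
    case True
    then have m: "\<bar>m\<bar> \<le> int l" and m': "\<bar>m'\<bar> \<le> int l'" by auto
    have 1: "kernel_form (\<lambda>s. s ^ n) (\<lambda>x. of_real (x $ 3) * sph_harm l m x) (\<lambda>x. of_real (x $ 3) *
        sph_harm l' m' x) =
      kernel_form (\<lambda>s. s ^ n) (\<lambda>x. of_real (vert_coeff (Suc l) m) * sph_harm (Suc l) m x + of_real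
          (vert_coeff l m) * sph_harm (l - 1) m x)
       (\<lambda>x. of_real (vert_coeff (Suc l') m') * sph_harm (Suc l') m' x + of_real
           (vert_coeff l' m') * sph_harm (l' - 1) m' x)"
      by (intro kernel_form_cong sph_harm_vert m m' refl)
    have 2: "kernel_form (\<lambda>s. s ^ n) (\<lambda>x. zonal_var x * sph_harm l m x) (\<lambda>x. zonal_var x * sph_harm l'
        m' x) =
      kernel_form (\<lambda>s. s ^ n) (\<lambda>x. of_real (- horiz_coeff (Suc l) (m + 1)) * sph_harm (Suc l)
          (m + 1) x + of_real (horiz_coeff l (- m)) * sph_harm (l - 1) (m + 1) x)
       (\<lambda>x. of_real (- horiz_coeff (Suc l') (m' + 1)) * sph_harm (Suc l') (m' + 1) x + of_real
           (horiz_coeff l' (- m')) * sph_harm (l' - 1) (m' + 1) x)"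
      by (intro kernel_form_cong) (simp_all add: sph_harm_raise[OF m] sph_harm_raise[OF m'])
    have 3: "kernel_form (\<lambda>s. s ^ n) (\<lambda>x. cnj (zonal_var x) * sph_harm l m x) (\<lambda>x. cnj (zonal_var x) *
        sph_harm l' m' x) =
      kernel_form (\<lambda>s. s ^ n) (\<lambda>x. of_real (horiz_coeff (Suc l) (1 - m)) * sph_harm (Suc l)
          (m - 1) x + of_real (- horiz_coeff l m) * sph_harm (l - 1) (m - 1) x)
       (\<lambda>x. of_real (horiz_coeff (Suc l') (1 - m')) * sph_harm (Suc l') (m' - 1) x + of_real
           (- horiz_coeff l' m') * sph_harm (l' - 1) (m' - 1) x)"
      by (intro kernel_form_cong) (simp_all add: sph_harm_lower[OF m] sph_harm_lower[OF m'])
    show ?thesis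
      unfolding kernel_form_power_Suc[OF cY cY] 1 2 3 bil IH diag_entry_step[OF m m', symmetric]
      by simp
  next
    case False
    then have "(\<forall>x\<in>S2. sph_harm l m x = 0) \<or> (\<forall>x\<in>S2. sph_harm l' m' x = 0)"
      using sph_harm_eq_0 not_le by metis
    then have "kernel_form (\<lambda>s. s ^ Suc n) (sph_harm l m) (sph_harm l' m') = (\<integral>z. 0 \<partial>surface2)"
      unfolding kernel_form_def by (intro Bochner_Integration.integral_cong)
          (auto simp: space_pair_measure)
    then show ?thesis using False by (auto simp: diag_entry_def)
  qed
  then show ?case by blast
qed

lemma kernel_form_poly_diag:
  "\<exists>\<mu>. \<forall>l l' m m'. kernel_form (\<lambda>s. \<Sum>i\<le>n. a i * s ^ i) (sph_harm l m) (sph_harm l' m') =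
      of_real (diag_entry \<mu> l m l' m')"
proof -
  obtain \<mu> where \<mu>: "\<And>i l l' m m'. kernel_form (\<lambda>s. s ^ i) (sph_harm l m) (sph_harm l' m') =
      of_real (diag_entry (\<mu> i) l m l' m')"
    using kernel_form_power_diag by metis
  have "kernel_form (\<lambda>s. \<Sum>i\<le>n. a i * s ^ i) (sph_harm l m) (sph_harm l' m') =
      of_real (diag_entry (\<lambda>l. \<Sum>i\<le>n. a i * \<mu> i l) l m l' m')" for l l' m m'
  proof -
    have F: "continuous_on UNIV (\<lambda>s::real. s ^ i)" for i by (intro continuous_intros)
    have "kernel_form (\<lambda>s. \<Sum>i\<le>n. a i * s ^ i) (sph_harm l m) (sph_harm l' m') =
      (\<integral>z. (\<Sum>i\<le>n. of_real (a i) * (of_real ((fst z \<bullet> snd z) ^ i) * (sph_harm l m (fst z) * cnj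
          (sph_harm l' m' (snd z))))) \<partial>surface2)"
      unfolding kernel_form_def by (simp add: sum_distrib_right mult.assoc)
    also have "\<dots> = (\<Sum>i\<le>n. of_real (a i) * kernel_form (\<lambda>s. s ^ i) (sph_harm l m) (sph_harm l' m'))"
      unfolding kernel_form_def
      using kernel_form_integrable[OF F continuous_on_sph_harm continuous_on_sph_harm]
      by (subst Bochner_Integration.integral_sum) (simp_all del: of_real_power)
    also have "\<dots> = of_real (diag_entry (\<lambda>l. \<Sum>i\<le>n. a i * \<mu> i l) l m l' m')"
      by (cases "l = l' \<and> m = m' \<and> \<bar>m\<bar> \<le> int l") (auto simp: \<mu> diag_entry_def intro!: sum.neutral)
    finally show ?thesis .
  qed
  then show ?thesis by blast
qed

lemma kernel_form_diag:
  assumes F: "continuous_on UNIV F"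
  obtains C :: "nat \<Rightarrow> real" where "\<And>l l' m m'. \<bar>m\<bar> \<le> int l \<Longrightarrow> \<bar>m'\<bar> \<le> int l' \<Longrightarrow>
    kernel_form F (sph_harm l m) (sph_harm l' m') = (if l = l' \<and> m = m' then of_real (C l) else 0)"
proof -
  have "\<exists>p a n. p = (\<lambda>s. \<Sum>i\<le>n. a i * s ^ i) \<and> (\<forall>s\<in>{-1..1}. \<bar>F s - p s\<bar> < 1 / real (Suc k))" for k
  proof -
    have "compact {-1..1::real}" "continuous_on {-1..1} F" "0 < 1 / real (Suc k)"
      using F by (auto intro: continuous_on_subset)
    from Stone_Weierstrass_real_polynomial_function[OF this] obtain g where
      g: "real_polynomial_function g" "\<And>s. s \<in> {-1..1} \<Longrightarrow> \<bar>F s - g s\<bar> < 1 / real (Suc k)"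
      by metis
    from g(1) obtain a :: "nat \<Rightarrow> real" and n where "g = (\<lambda>s. \<Sum>i\<le>n. a i * s ^ i)"
      unfolding real_polynomial_function_iff_sum by blast
    with g(2) show ?thesis by (intro exI[of _ g] exI[of _ a] exI[of _ n] conjI ballI)
  qed
  then have "\<forall>k. \<exists>p. \<exists>a n. p = (\<lambda>s. \<Sum>i\<le>n. a i * s ^ i) \<and> (\<forall>s\<in>{-1..1}. \<bar>F s - p s\<bar> < 1 / real (Suc k))"
      ..
  from choice[OF this] obtain p where
    p': "\<forall>k. \<exists>a n. p k = (\<lambda>s. \<Sum>i\<le>n. a i * s ^ i) \<and> (\<forall>s\<in>{-1..1}. \<bar>F s - p k s\<bar> < 1 / real (Suc k))" ..
  have p: "\<exists>a n. p k = (\<lambda>s. \<Sum>i\<le>n. a i * s ^ i)" for k using spec[OF p', of k] by blast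
  have close: "\<bar>F s - p k s\<bar> < 1 / real (Suc k)" if "s \<in> {-1..1}" for k s
    using spec[OF p', of k] that by blast
  have "\<exists>\<mu>. \<forall>l l' m m'. kernel_form (p k) (sph_harm l m) (sph_harm l' m') =
      of_real (diag_entry \<mu> l m l' m')" for k
  proof -
    from p obtain a n where "p k = (\<lambda>s. \<Sum>i\<le>n. a i * s ^ i)" by blast
    then show ?thesis using kernel_form_poly_diag[where n = n and a = a] by (simp only:)
  qed
  then have "\<forall>k. \<exists>\<mu>. \<forall>l l' m m'. kernel_form (p k) (sph_harm l m) (sph_harm l' m') =
      of_real (diag_entry \<mu> l m l' m')" ..
  from choice[OF this] obtain \<mu> where
    \<mu>: "\<And>k l l' m m'. kernel_form (p k) (sph_harm l m) (sph_harm l' m') =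
        of_real (diag_entry (\<mu> k) l m l' m')"
    by blast
  have cp: "continuous_on UNIV (p k)" for k
    using p[of k] by (auto intro!: continuous_intros)
  have lim: "(\<lambda>k. kernel_form (p k) (sph_harm l m) (sph_harm l' m')) \<longlonglongrightarrow> kernel_form F (sph_harm l m)
      (sph_harm l' m')" for l l' m m'
    unfolding kernel_form_def
  proof (rule integral_dominated_convergence)
    let ?g = "\<lambda>z. sph_harm l m (fst z) * cnj (sph_harm l' m' (snd z))"
    \<comment> \<open>On \<open>[-1, 1]\<close>, which contains all inner products, each
      approximating polynomial differs from \<open>F\<close> by less than 1.\<close>
    let ?w = "\<lambda>z. (\<bar>F (fst z \<bullet> snd z)\<bar> + 1) * norm (?g z)"
    have cF: "continuous_on UNIV (\<lambda>s. \<bar>F s\<bar> + 1)" using F by (intro continuous_intros)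
    from kernel_form_integrable[OF this continuous_on_sph_harm continuous_on_sph_harm, of l m l' m']
    have "integrable surface2 (\<lambda>z. norm (of_real (\<bar>F (fst z \<bullet> snd z)\<bar> + 1) * ?g z))"
      by (rule integrable_norm)
    then show "integrable surface2 ?w" by (simp add: norm_mult abs_of_nonneg del: of_real_add)
    show "(\<lambda>z. of_real (F (fst z \<bullet> snd z)) * ?g z) \<in> borel_measurable surface2"
      using kernel_form_integrable[OF F continuous_on_sph_harm continuous_on_sph_harm] by
          (rule borel_measurable_integrable)
    show "(\<lambda>z. of_real (p k (fst z \<bullet> snd z)) * ?g z) \<in> borel_measurable surface2" for k
      using kernel_form_integrable[OF cp continuous_on_sph_harm continuous_on_sph_harm] by
          (rule borel_measurable_integrable)
    have s: "fst z \<bullet> snd z \<in> {-1..1}" if "z \<in> space surface2" for z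
      using that S2_inner_bound[of "fst z" "snd z"] by (auto simp: space_pair_measure abs_le_iff)
    show "AE z in surface2. (\<lambda>k. of_real (p k (fst z \<bullet> snd z)) * ?g z) \<longlonglongrightarrow> of_real (F (fst z \<bullet> snd z)) *
        ?g z"
    proof (rule AE_I2)
      fix z assume z: "z \<in> space surface2"
      have "(\<lambda>k. p k (fst z \<bullet> snd z)) \<longlonglongrightarrow> F (fst z \<bullet> snd z)"
      proof (rule LIM_zero_cancel, rule Lim_null_comparison)
        show "\<forall>\<^sub>F k in sequentially. norm (p k (fst z \<bullet> snd z) - F (fst z \<bullet> snd z)) \<le> 1 / real (Suc k)"
          using close[OF s[OF z]] by (simp add: abs_minus_commute less_imp_le)
      qed (rule LIMSEQ_Suc[OF lim_1_over_n])
      then show "(\<lambda>k. of_real (p k (fst z \<bullet> snd z)) * ?g z) \<longlonglongrightarrow> of_real (F (fst z \<bullet> snd z)) * ?g z"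
        by (intro tendsto_intros)
    qed
    show "AE z in surface2. norm (of_real (p k (fst z \<bullet> snd z)) * ?g z) \<le> ?w z" for k
    proof (rule AE_I2)
      fix z assume z: "z \<in> space surface2"
      have "1 / real (Suc k) \<le> 1" by simp
      then have "\<bar>p k (fst z \<bullet> snd z)\<bar> \<le> \<bar>F (fst z \<bullet> snd z)\<bar> + 1"
        using close[OF s[OF z], of k] by linarith
      then show "norm (of_real (p k (fst z \<bullet> snd z)) * ?g z) \<le> ?w z"
        by (simp only: norm_mult norm_of_real) (intro mult_right_mono; simp)
    qed
  qed
  \<comment> \<open>The entries of the approximating polynomials are real and do not depend on the
    order, so their limit at order 0 serves for all orders.\<close>
  define C where "C l = Re (kernel_form F (sph_harm l 0) (sph_harm l 0))" for l
  show ?thesis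
  proof (rule that[of C])
    fix l l' :: nat and m m' :: int
    assume m: "\<bar>m\<bar> \<le> int l" "\<bar>m'\<bar> \<le> int l'"
    show "kernel_form F (sph_harm l m) (sph_harm l' m') = (if l = l' \<and> m = m' then of_real (C l) else
        0)"
    proof (cases "l = l' \<and> m = m'")
      case True
      have "(\<lambda>k. complex_of_real (\<mu> k l)) \<longlonglongrightarrow> kernel_form F (sph_harm l m) (sph_harm l m)"
        using lim[of l m l m] m by (simp add: \<mu> diag_entry_def)
      moreover have "(\<lambda>k. complex_of_real (\<mu> k l)) \<longlonglongrightarrow> kernel_form F (sph_harm l 0) (sph_harm l 0)"
        using lim[of l 0 l 0] by (simp add: \<mu> diag_entry_def)
      from tendsto_of_real[OF tendsto_Re[OF this]]
      have "(\<lambda>k. complex_of_real (\<mu> k l)) \<longlonglongrightarrow> of_real (C l)"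
        by (simp add: C_def)
      ultimately have "kernel_form F (sph_harm l m) (sph_harm l m) = of_real (C l)"
        by (rule LIMSEQ_unique)
      then show ?thesis using True by simp
    next
      case False
      then show ?thesis
        using lim[of l m l' m'] by (auto simp: \<mu> diag_entry_def LIMSEQ_const_iff)
    qed
  qed
qed

section \<open>Finite expansions in spherical harmonics\<close>

text \<open>Only the degree varies, since multiplication by functions of \<open>x $ 3\<close>
  preserves the order. Degrees below \<open>\<bar>m\<bar>\<close> may occur and contribute
  zero.\<close>

definition finite_expansion :: "int \<Rightarrow> (real^3 \<Rightarrow> complex) \<Rightarrow> bool" where
  "finite_expansion m f \<longleftrightarrow> (\<exists>N c. \<forall>x\<in>S2. f x = (\<Sum>k<N. c k * sph_harm k m x))"

lemma finite_expansion_harm: "finite_expansion m (\<lambda>x. c * sph_harm l m x)"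
proof -
  have "c * sph_harm l m x = (\<Sum>k<Suc l. (if k = l then c else 0) * sph_harm k m x)" for x
  proof -
    have "(\<Sum>k<Suc l. (if k = l then c else 0) * sph_harm k m x) = (\<Sum>k<Suc l. if k =
        l then c * sph_harm k m x else 0)"
      by (rule sum.cong) auto
    then show ?thesis by simp
  qed
  then show ?thesis
    unfolding finite_expansion_def by (intro exI[of _ "Suc l"] exI[of _
        "\<lambda>k. if k = l then c else 0"] ballI)
qed

lemma finite_expansion_add:
  assumes "finite_expansion m f" "finite_expansion m g"
  shows "finite_expansion m (\<lambda>x. f x + g x)"
proof -
  obtain N c M d where f: "\<And>x. x \<in> S2 \<Longrightarrow> f x = (\<Sum>k<N. c k * sph_harm k m x)"
    and g: "\<And>x. x \<in> S2 \<Longrightarrow> g x = (\<Sum>k<M. d k * sph_harm k m x)"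
    using assms unfolding finite_expansion_def by metis
  have ext: "(\<Sum>k<n. e k * sph_harm k m x) = (\<Sum>k<max N M. (if k < n then e k else 0) * sph_harm k m x)"
      if "n \<le> max N M" for n e x
    using that by (intro sum.mono_neutral_cong_left) auto
  have "f x + g x = (\<Sum>k<max N M. ((if k < N then c k else 0) + (if k < M then d k else 0)) * sph_harm k
      m x)" if "x \<in> S2" for x
    using ext[of N c x] ext[of M d x] f[OF that] g[OF that] by (simp add: distrib_right sum.distrib)
  then show ?thesis
    unfolding finite_expansion_def
    by (intro exI[of _ "max N M"] exI[of _ "\<lambda>k. (if k < N then c k else 0) +
        (if k < M then d k else 0)"] ballI)
qed

lemma finite_expansion_cong:
  "finite_expansion m g \<Longrightarrow> (\<And>x. x \<in> S2 \<Longrightarrow> f x = g x) \<Longrightarrow> finite_expansion m f"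
  unfolding finite_expansion_def by simp

lemma finite_expansion_sum:
  "(\<And>i. i \<in> A \<Longrightarrow> finite_expansion m (f i)) \<Longrightarrow> finite_expansion m (\<lambda>x. \<Sum>i\<in>A. f i x)"
proof (induction A rule: infinite_finite_induct)
  case (insert a A)
  then show ?case by (auto intro: finite_expansion_add)
qed (use finite_expansion_harm[of m 0] in auto)

lemma finite_expansion_X:
  assumes "finite_expansion m f"
  shows "finite_expansion m (\<lambda>x. of_real (x $ 3) * f x)"
proof -
  obtain N c where f: "\<And>x. x \<in> S2 \<Longrightarrow> f x = (\<Sum>k<N. c k * sph_harm k m x)"
    using assms unfolding finite_expansion_def by metis
  have "finite_expansion m (\<lambda>x. of_real (x $ 3) * (c k * sph_harm k m x))" for k
  proof (cases "\<bar>m\<bar> \<le> int k")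
    case True
    have "finite_expansion m (\<lambda>x. c k * of_real (vert_coeff (Suc k) m) * sph_harm (Suc k) m x +
        c k * of_real (vert_coeff k m) * sph_harm (k - 1) m x)"
      by (intro finite_expansion_add finite_expansion_harm)
    then show ?thesis
    proof (rule finite_expansion_cong)
      fix x :: "real^3" assume "x \<in> S2"
      from sph_harm_vert[OF True this]
      show "of_real (x $ 3) * (c k * sph_harm k m x) =
        c k * of_real (vert_coeff (Suc k) m) * sph_harm (Suc k) m x + c k * of_real
            (vert_coeff k m) * sph_harm (k - 1) m x"
        by algebra
    qed
  next
    case False
    then show ?thesis
      using finite_expansion_harm[of m 0] by (auto intro!: finite_expansion_cong[of m
          "\<lambda>x. 0"] simp: sph_harm_eq_0)
  qed
  then have "finite_expansion m (\<lambda>x. \<Sum>k<N. of_real (x $ 3) * (c k * sph_harm k m x))"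
    by (intro finite_expansion_sum)
  then show ?thesis by (rule finite_expansion_cong) (simp add: f sum_distrib_left)
qed

lemma finite_expansion_poly: "finite_expansion m (\<lambda>x. of_real (poly p (x $ 3)) * sph_harm l m x)"
proof (induction p)
  case 0
  then show ?case using finite_expansion_harm[of m 0] by simp
next
  case (pCons a p)
  have "finite_expansion m (\<lambda>x. of_real a * sph_harm l m x +
      of_real (x $ 3) * (of_real (poly p (x $ 3)) * sph_harm l m x))"
    by (intro finite_expansion_add finite_expansion_harm finite_expansion_X pCons)
  then show ?case by (rule finite_expansion_cong) (simp add: algebra_simps)
qed

text \<open>A zonal harmonic is a polynomial in \<open>x $ 3\<close>, and multiplication by
  \<open>x $ 3\<close> keeps expansions finite.\<close>

lemma finite_expansion_zonal_mult: "finite_expansion m (\<lambda>x. sph_harm a 0 x * sph_harm l m x)"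
  by (rule finite_expansion_cong[OF finite_expansion_poly[of m "sph_poly a 0" l]])
    (simp add: sph_harm_eq[of _ a] azimuthal_def)

section \<open>Square-integrable functions\<close>

lemma L2_fun_measurable [dest]: "L2_fun M f \<Longrightarrow> f \<in> borel_measurable M"
  by (simp add: L2_fun_def)

lemma L2_fun_scale: "L2_fun M f \<Longrightarrow> L2_fun M (\<lambda>x. c * f x)"
  by (auto simp: L2_fun_def norm_mult power_mult_distrib)

lemma L2_fun_0: "L2_fun M (\<lambda>x. 0)"
  by (simp add: L2_fun_def)

lemma L2_fun_add:
  assumes "L2_fun M f" "L2_fun M g"
  shows "L2_fun M (\<lambda>x. f x + g x)"
proof -
  have [measurable]: "f \<in> borel_measurable M" "g \<in> borel_measurable M" using assms by auto
  have "integrable M (\<lambda>x. 2 * ((cmod (f x))\<^sup>2 + (cmod (g x))\<^sup>2))"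
    using assms by (auto simp: L2_fun_def)
  then have "integrable M (\<lambda>x. (cmod (f x + g x))\<^sup>2)"
  proof (rule Bochner_Integration.integrable_bound)
    have "(cmod (f x + g x))\<^sup>2 \<le> 2 * ((cmod (f x))\<^sup>2 + (cmod (g x))\<^sup>2)" for x
    proof -
      have "(cmod (f x + g x))\<^sup>2 \<le> (cmod (f x) + cmod (g x))\<^sup>2"
        by (intro power_mono norm_triangle_ineq) auto
      also have "\<dots> \<le> 2 * ((cmod (f x))\<^sup>2 + (cmod (g x))\<^sup>2)"
        using zero_le_power2[of "cmod (f x) - cmod (g x)"] by (simp add: power2_sum power2_diff)
      finally show ?thesis .
    qed
    then show "AE x in M. norm ((cmod (f x + g x))\<^sup>2) \<le> norm (2 * ((cmod (f x))\<^sup>2 + (cmod (g x))\<^sup>2))"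
      by auto
  qed measurable
  then show ?thesis by (simp add: L2_fun_def)
qed

lemma L2_fun_diff: "L2_fun M f \<Longrightarrow> L2_fun M g \<Longrightarrow> L2_fun M (\<lambda>x. f x - g x)"
  using L2_fun_add[of M f "\<lambda>x. - 1 * g x"] L2_fun_scale[of M g "- 1"] by simp

lemma L2_fun_sum: "(\<And>i. i \<in> A \<Longrightarrow> L2_fun M (f i)) \<Longrightarrow> L2_fun M (\<lambda>x. \<Sum>i\<in>A. f i x)"
  by (induction A rule: infinite_finite_induct) (auto intro: L2_fun_0 L2_fun_add)

lemma L2_fun_cnj: "L2_fun M f \<Longrightarrow> L2_fun M (\<lambda>x. cnj (f x))"
  unfolding L2_fun_def by auto

lemma L2_integrable_mult_norm:
  assumes "L2_fun M f" "L2_fun M g"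
  shows "integrable M (\<lambda>x. cmod (f x) * cmod (g x))"
proof -
  have [measurable]: "f \<in> borel_measurable M" "g \<in> borel_measurable M" using assms by auto
  have "integrable M (\<lambda>x. (cmod (f x))\<^sup>2 + (cmod (g x))\<^sup>2)"
    using assms by (auto simp: L2_fun_def)
  then show ?thesis
  proof (rule Bochner_Integration.integrable_bound)
    have "cmod (f x) * cmod (g x) \<le> (cmod (f x))\<^sup>2 + (cmod (g x))\<^sup>2" for x
    proof -
      have "0 \<le> cmod (f x) * cmod (g x)" by simp
      then show ?thesis
        using zero_le_power2[of "cmod (f x) - cmod (g x)"] unfolding power2_diff by linarith
    qed
    then show "AE x in M. norm (cmod (f x) * cmod (g x)) \<le> norm ((cmod (f x))\<^sup>2 + (cmod (g x))\<^sup>2)"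
      by auto
  qed measurable
qed

lemma L2_integrable_mult:
  assumes "L2_fun M f" "L2_fun M g"
  shows "integrable M (\<lambda>x. f x * g x)"
proof -
  have [measurable]: "f \<in> borel_measurable M" "g \<in> borel_measurable M" using assms by auto
  show ?thesis
    by (rule Bochner_Integration.integrable_bound[OF L2_integrable_mult_norm[OF assms]])
      (auto simp: norm_mult)
qed

lemma L2_integrable_cnj: "L2_fun M f \<Longrightarrow> L2_fun M g \<Longrightarrow> integrable M (\<lambda>x. f x * cnj (g x))"
  by (intro L2_integrable_mult L2_fun_cnj)

lemma L2_norm_nonneg: "0 \<le> L2_norm M f"
  by (simp add: L2_norm_def integral_nonneg)

lemma L2_norm_power2: "(L2_norm M f)\<^sup>2 = (\<integral>x. (cmod (f x))\<^sup>2 \<partial>M)"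
  by (simp add: L2_norm_def)

lemma of_real_L2_norm_power2: "of_real ((L2_norm M f)\<^sup>2) = (\<integral>x. f x * cnj (f x) \<partial>M)"
  unfolding L2_norm_power2 integral_complex_of_real[symmetric] complex_norm_square ..

lemma L2_norm_scale: "L2_norm M (\<lambda>x. c * f x) = cmod c * L2_norm M f"
  by (simp add: L2_norm_def norm_mult power_mult_distrib real_sqrt_mult)

lemma L2_norm_cong: "(\<And>x. x \<in> space M \<Longrightarrow> f x = g x) \<Longrightarrow> L2_norm M f = L2_norm M g"
  unfolding L2_norm_def by (intro arg_cong[where f=sqrt] Bochner_Integration.integral_cong) auto

lemma L2_norm_minus_commute: "L2_norm M (\<lambda>x. f x - g x) = L2_norm M (\<lambda>x. g x - f x)"
  by (simp add: L2_norm_def norm_minus_commute)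

text \<open>The weights \<open>b / a\<close> and \<open>a / b\<close> optimise the arithmetic-geometric mean inequality; adding \<open>e\<close>
    avoids the case distinction on vanishing norms.\<close>

lemma L2_Cauchy_Schwarz_norm:
  assumes "L2_fun M f" "L2_fun M g"
  shows "(\<integral>x. cmod (f x) * cmod (g x) \<partial>M) \<le> L2_norm M f * L2_norm M g"
proof -
  define F G where FG: "F = L2_norm M f" "G = L2_norm M g"
  have nn: "F \<ge> 0" "G \<ge> 0" by (simp_all add: FG L2_norm_nonneg)
  have i: "integrable M (\<lambda>x. (cmod (f x))\<^sup>2)" "integrable M (\<lambda>x. (cmod (g x))\<^sup>2)"
    using assms by (auto simp: L2_fun_def)
  have bound: "(\<integral>x. cmod (f x) * cmod (g x) \<partial>M) \<le> (F + e) * (G + e)" if e: "e > 0" for e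
  proof -
    define a b where ab: "a = F + e" "b = G + e"
    have p: "a > 0" "b > 0" using nn e by (simp_all add: ab)
    have "(\<integral>x. cmod (f x) * cmod (g x) \<partial>M) \<le> (\<integral>x. (b / a * (cmod (f x))\<^sup>2 + a / b * (cmod (g x))\<^sup>2) / 2
        \<partial>M)"
    proof (rule integral_mono)
      fix x
      have "0 \<le> (b * cmod (f x) - a * cmod (g x))\<^sup>2" by simp
      then have "2 * (a * b) * (cmod (f x) * cmod (g x)) \<le> b * b * (cmod (f x))\<^sup>2 +
          a * a * (cmod (g x))\<^sup>2"
        by (simp add: power2_eq_square algebra_simps)
      then show "cmod (f x) * cmod (g x) \<le> (b / a * (cmod (f x))\<^sup>2 + a / b * (cmod (g x))\<^sup>2) / 2"
        using p by (simp add: field_simps)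
    qed (use i L2_integrable_mult_norm[OF assms] in auto)
    also have "\<dots> = (b / a * F\<^sup>2 + a / b * G\<^sup>2) / 2"
      using i by (simp add: FG L2_norm_power2)
    also have "\<dots> \<le> (b / a * a\<^sup>2 + a / b * b\<^sup>2) / 2"
      using p nn e by (intro divide_right_mono add_mono mult_left_mono power_mono) (auto simp: ab)
    also have "\<dots> = a * b" using p by (simp add: power2_eq_square)
    finally show ?thesis by (simp add: ab)
  qed
  have "((\<lambda>e. (F + e) * (G + e)) \<longlongrightarrow> (F + 0) * (G + 0)) (at_right 0)"
    by (intro tendsto_intros)
  then have "(\<integral>x. cmod (f x) * cmod (g x) \<partial>M) \<le> (F + 0) * (G + 0)"
  proof (rule tendsto_lowerbound)
    show "\<forall>\<^sub>F e in at_right 0. (\<integral>x. cmod (f x) * cmod (g x) \<partial>M) \<le> (F + e) * (G + e)"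
      using bound by (auto simp: eventually_at_right_field intro!: exI[of _ 1])
  qed simp
  then show ?thesis by (simp add: FG)
qed

lemma L2_Cauchy_Schwarz:
  assumes "L2_fun M f" "L2_fun M g"
  shows "cmod (\<integral>x. f x * cnj (g x) \<partial>M) \<le> L2_norm M f * L2_norm M g"
proof -
  have "cmod (\<integral>x. f x * cnj (g x) \<partial>M) \<le> (\<integral>x. cmod (f x * cnj (g x)) \<partial>M)"
    by (rule integral_norm_bound)
  then show ?thesis using L2_Cauchy_Schwarz_norm[OF assms] by (simp add: norm_mult)
qed

lemma L2_norm_triangle:
  assumes "L2_fun M f" "L2_fun M g"
  shows "L2_norm M (\<lambda>x. f x + g x) \<le> L2_norm M f + L2_norm M g"
proof (rule power2_le_imp_le)
  have "(L2_norm M (\<lambda>x. f x + g x))\<^sup>2 \<le> (\<integral>x. (cmod (f x))\<^sup>2 + 2 * (cmod (f x) * cmod (g x)) +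
      (cmod (g x))\<^sup>2 \<partial>M)"
    unfolding L2_norm_power2
  proof (rule integral_mono)
    fix x
    have "(cmod (f x + g x))\<^sup>2 \<le> (cmod (f x) + cmod (g x))\<^sup>2"
      by (intro power_mono norm_triangle_ineq) auto
    then show "(cmod (f x + g x))\<^sup>2 \<le> (cmod (f x))\<^sup>2 + 2 * (cmod (f x) * cmod (g x)) + (cmod (g x))\<^sup>2"
      by (simp add: power2_sum)
  qed (use L2_fun_add[OF assms] L2_integrable_mult_norm[OF assms] assms in \<open>auto simp: L2_fun_def\<close>)
  also have "\<dots> = (L2_norm M f)\<^sup>2 + 2 * (\<integral>x. cmod (f x) * cmod (g x) \<partial>M) + (L2_norm M g)\<^sup>2"
    using L2_integrable_mult_norm[OF assms] assms by (simp add: L2_norm_power2 L2_fun_def)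
  also have "\<dots> \<le> (L2_norm M f + L2_norm M g)\<^sup>2"
    using L2_Cauchy_Schwarz_norm[OF assms] by (simp add: power2_sum)
  finally show "(L2_norm M (\<lambda>x. f x + g x))\<^sup>2 \<le> (L2_norm M f + L2_norm M g)\<^sup>2" .
qed (simp add: L2_norm_nonneg)

lemma (in finite_measure) L2_fun_bounded:
  assumes "f \<in> borel_measurable M" "\<And>x. x \<in> space M \<Longrightarrow> cmod (f x) \<le> B"
  shows "L2_fun M f"
  unfolding L2_fun_def
proof
  show "integrable M (\<lambda>x. (cmod (f x))\<^sup>2)"
    by (rule integrable_const_bound[of _ "B\<^sup>2"]) (use assms in \<open>auto intro!: power_mono\<close>)
qed (rule assms)

lemma (in finite_measure) L2_fun_1: "L2_fun M (\<lambda>x. 1)"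
  by (rule L2_fun_bounded[of _ 1]) auto

lemma (in finite_measure) L2_fun_integrable: "L2_fun M f \<Longrightarrow> integrable M f"
  using L2_integrable_mult[OF _ L2_fun_1] by simp

lemma (in finite_measure) integral_le_L2_norm:
  "L2_fun M f \<Longrightarrow> (\<integral>x. cmod (f x) \<partial>M) \<le> L2_norm M f * L2_norm M (\<lambda>x. 1)"
  using L2_Cauchy_Schwarz_norm[OF _ L2_fun_1, of f] by simp

text \<open>Riesz-Fischer at a geometric rate: the increments are summable in mean and hence almost
  everywhere, and Fatou's lemma shows that the pointwise limit is also the limit in mean
  square.\<close>

lemma (in prob_space) L2_complete:
  assumes J: "\<And>k. L2_fun M (J k)"
    and cauchy: "\<And>j k. L2_norm M (\<lambda>x. J j x - J k x) \<le> (1/2) ^ j + (1/2) ^ k"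
  obtains I where "L2_fun M I" "(\<lambda>k. L2_norm M (\<lambda>x. J k x - I x)) \<longlonglongrightarrow> 0"
proof -
  have [measurable]: "J k \<in> borel_measurable M" for k using J by auto
  define I where "I x = lim (\<lambda>k. J k x)" for x
  have I_meas [measurable]: "I \<in> borel_measurable M" unfolding I_def[abs_def] by measurable
  have one: "L2_norm M (\<lambda>x. 1) = 1" by (simp add: L2_norm_def prob_space)
  have eq: "(\<integral>\<^sup>+x. (\<Sum>k. ennreal (cmod (J (Suc k) x - J k x))) \<partial>M) =
      (\<Sum>k. \<integral>\<^sup>+x. ennreal (cmod (J (Suc k) x - J k x)) \<partial>M)"
    by (intro nn_integral_suminf) measurable
  have le: "(\<Sum>k. \<integral>\<^sup>+x. ennreal (cmod (J (Suc k) x - J k x)) \<partial>M) \<le> (\<Sum>k. ennreal (2 * (1/2) ^ k))"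
  proof (rule suminf_le[OF _ summableI summableI])
    fix k
    have D: "L2_fun M (\<lambda>x. J (Suc k) x - J k x)" by (intro L2_fun_diff J)
    have "(\<integral>\<^sup>+x. ennreal (cmod (J (Suc k) x - J k x)) \<partial>M) = ennreal (\<integral>x. cmod (J (Suc k) x - J k x) \<partial>M)"
      using L2_fun_integrable[OF D] by (intro nn_integral_eq_integral) auto
    also have "\<dots> \<le> ennreal (2 * (1/2) ^ k)"
    proof (rule ennreal_leI)
      have "(\<integral>x. cmod (J (Suc k) x - J k x) \<partial>M) \<le> (1/2) ^ Suc k + (1/2) ^ k"
        using integral_le_L2_norm[OF D] cauchy[of "Suc k" k] one by simp
      also have "\<dots> \<le> 2 * (1/2) ^ k" by simp
      finally show "(\<integral>x. cmod (J (Suc k) x - J k x) \<partial>M) \<le> 2 * (1/2) ^ k" .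
    qed
    finally show "(\<integral>\<^sup>+x. ennreal (cmod (J (Suc k) x - J k x)) \<partial>M) \<le> ennreal (2 * (1/2) ^ k)" .
  qed
  have "(\<Sum>k. ennreal (2 * (1/2) ^ k)) \<noteq> top"
  proof -
    have "summable (\<lambda>k. 2 * (1/2) ^ k :: real)" by (intro summable_mult summable_geometric) simp
    then show ?thesis by (rule ennreal_suminf_neq_top) simp
  qed
  then have "(\<integral>\<^sup>+x. (\<Sum>k. ennreal (cmod (J (Suc k) x - J k x))) \<partial>M) \<noteq> \<infinity>"
    unfolding eq infinity_ennreal_def using le by (metis top.extremum_uniqueI)
  then have "AE x in M. (\<Sum>k. ennreal (cmod (J (Suc k) x - J k x))) \<noteq> \<infinity>"
    by (intro nn_integral_PInf_AE) measurable
  then have AE: "AE x in M. (\<lambda>k. J k x) \<longlonglongrightarrow> I x"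
  proof eventually_elim
    fix x assume "(\<Sum>k. ennreal (cmod (J (Suc k) x - J k x))) \<noteq> \<infinity>"
    then have "summable (\<lambda>k. cmod (J (Suc k) x - J k x))"
      by (intro summable_suminf_not_top) auto
    then have "summable (\<lambda>k. J (Suc k) x - J k x)" by (rule summable_norm_cancel)
    then have "convergent (\<lambda>n. \<Sum>k<n. J (Suc k) x - J k x)" by (simp add: summable_iff_convergent)
    then have "convergent (\<lambda>n. J n x - J 0 x)" by (simp only: sum_lessThan_telescope[of "\<lambda>k. J k x"])
    then have "convergent (\<lambda>n. (J n x - J 0 x) + J 0 x)"
      by (intro convergent_add convergent_const)
    then have "convergent (\<lambda>n. J n x)" by simp
    then show "(\<lambda>k. J k x) \<longlonglongrightarrow> I x" unfolding I_def by (simp add: convergent_LIMSEQ_iff)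
  qed
  have fatou: "(\<integral>\<^sup>+x. ennreal ((cmod (J j x - I x))\<^sup>2) \<partial>M) \<le> ennreal (((1/2) ^ j)\<^sup>2)" for j
  proof -
    have "(\<integral>\<^sup>+x. ennreal ((cmod (J j x - I x))\<^sup>2) \<partial>M) =
        (\<integral>\<^sup>+x. liminf (\<lambda>k. ennreal ((cmod (J j x - J k x))\<^sup>2)) \<partial>M)"
    proof (rule nn_integral_cong_AE)
      show "AE x in M. ennreal ((cmod (J j x - I x))\<^sup>2) = liminf (\<lambda>k. ennreal ((cmod (J j x - J k x))\<^sup>2))"
        using AE
      proof eventually_elim
        fix x assume "(\<lambda>k. J k x) \<longlonglongrightarrow> I x"
        then have "(\<lambda>k. ennreal ((cmod (J j x - J k x))\<^sup>2)) \<longlonglongrightarrow> ennreal ((cmod (J j x - I x))\<^sup>2)"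
          by (intro tendsto_intros) 
        then show "ennreal ((cmod (J j x - I x))\<^sup>2) = liminf (\<lambda>k. ennreal ((cmod (J j x - J k x))\<^sup>2))"
          by (rule lim_imp_Liminf[OF trivial_limit_sequentially, symmetric])
      qed
    qed
    also have "\<dots> \<le> liminf (\<lambda>k. \<integral>\<^sup>+x. ennreal ((cmod (J j x - J k x))\<^sup>2) \<partial>M)"
      by (rule nn_integral_liminf) measurable
    also have "\<dots> \<le> liminf (\<lambda>k. ennreal (((1/2) ^ j + (1/2) ^ k)\<^sup>2))"
    proof (rule Liminf_mono, rule always_eventually, rule allI)
      fix k
      have "L2_fun M (\<lambda>x. J j x - J k x)" by (intro L2_fun_diff J)
      then have "(\<integral>\<^sup>+x. ennreal ((cmod (J j x - J k x))\<^sup>2) \<partial>M) =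
          ennreal ((L2_norm M (\<lambda>x. J j x - J k x))\<^sup>2)"
        unfolding L2_norm_power2 by (intro nn_integral_eq_integral) (auto simp: L2_fun_def)
      also have "\<dots> \<le> ennreal (((1/2) ^ j + (1/2) ^ k)\<^sup>2)"
        using cauchy[of j k] L2_norm_nonneg by (intro ennreal_leI power_mono) auto
      finally show "(\<integral>\<^sup>+x. ennreal ((cmod (J j x - J k x))\<^sup>2) \<partial>M) \<le> ennreal (((1/2) ^ j + (1/2) ^ k)\<^sup>2)" .
    qed
    also have "\<dots> = ennreal (((1/2) ^ j + 0)\<^sup>2)"
      by (intro lim_imp_Liminf tendsto_intros LIMSEQ_power_zero) auto
    finally show ?thesis by simp
  qed
  have D: "L2_fun M (\<lambda>x. J j x - I x)" for j
    unfolding L2_fun_def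
  proof
    have "(\<integral>\<^sup>+x. ennreal (norm ((cmod (J j x - I x))\<^sup>2)) \<partial>M) < \<infinity>"
      using fatou[of j] by (simp add: le_less_trans[OF _ ennreal_less_top])
    then show "integrable M (\<lambda>x. (cmod (J j x - I x))\<^sup>2)" by (intro integrableI_bounded) auto
  qed measurable
  have b: "L2_norm M (\<lambda>x. J j x - I x) \<le> (1/2) ^ j" for j
  proof (rule power2_le_imp_le)
    have "ennreal ((L2_norm M (\<lambda>x. J j x - I x))\<^sup>2) = (\<integral>\<^sup>+x. ennreal ((cmod (J j x - I x))\<^sup>2) \<partial>M)"
      unfolding L2_norm_power2 using D[of j] by (intro nn_integral_eq_integral[symmetric])
          (auto simp: L2_fun_def)
    from ord_eq_le_trans[OF this fatou[of j]]
    show "(L2_norm M (\<lambda>x. J j x - I x))\<^sup>2 \<le> ((1/2) ^ j)\<^sup>2"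
      by (subst (asm) ennreal_le_iff) auto
  qed simp
  have l: "(\<lambda>j. (1/2 :: real) ^ j) \<longlonglongrightarrow> 0" by (rule LIMSEQ_power_zero) simp
  have "(\<lambda>j. L2_norm M (\<lambda>x. J j x - I x)) \<longlonglongrightarrow> 0"
  proof (rule Lim_null_comparison[OF always_eventually l], rule allI)
    show "norm (L2_norm M (\<lambda>x. J j x - I x)) \<le> (1/2) ^ j" for j
      using b[of j] L2_norm_nonneg[of M "\<lambda>x. J j x - I x"] by simp
  qed
  moreover have "L2_fun M I"
    using L2_fun_diff[OF J[of 0] D[of 0]] by simp
  ultimately show ?thesis by (rule that[rotated])
qed

lemma L2_inner_tendsto:
  assumes L: "\<And>n. L2_fun M (f n)" "\<And>n. L2_fun M (g n)" "L2_fun M F" "L2_fun M G"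
    and f: "(\<lambda>n. L2_norm M (\<lambda>x. f n x - F x)) \<longlonglongrightarrow> 0" and g: "(\<lambda>n. L2_norm M (\<lambda>x. g n x - G x)) \<longlonglongrightarrow> 0"
  shows "(\<lambda>n. \<integral>x. f n x * cnj (g n x) \<partial>M) \<longlonglongrightarrow> (\<integral>x. F x * cnj (G x) \<partial>M)"
proof (rule LIM_zero_cancel)
  let ?a = "\<lambda>n. L2_norm M (\<lambda>x. f n x - F x)" and ?b = "\<lambda>n. L2_norm M (\<lambda>x. g n x - G x)"
  show "(\<lambda>n. (\<integral>x. f n x * cnj (g n x) \<partial>M) - (\<integral>x. F x * cnj (G x) \<partial>M)) \<longlonglongrightarrow> 0"
  proof (rule Lim_null_comparison)
    have "(\<lambda>n. ?a n * ?b n + ?a n * L2_norm M G + L2_norm M F * ?b n) \<longlonglongrightarrow> 0 * 0 + 0 * L2_norm M G +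
        L2_norm M F * 0"
      by (intro tendsto_intros f g)
    then show "(\<lambda>n. ?a n * ?b n + ?a n * L2_norm M G + L2_norm M F * ?b n) \<longlonglongrightarrow> 0" by simp
    show "\<forall>\<^sub>F n in sequentially. norm ((\<integral>x. f n x * cnj (g n x) \<partial>M) - (\<integral>x. F x * cnj (G x) \<partial>M)) \<le>
        ?a n * ?b n + ?a n * L2_norm M G + L2_norm M F * ?b n"
    proof (rule always_eventually, rule allI)
      fix n
      let ?A = "\<lambda>x. f n x - F x" and ?B = "\<lambda>x. g n x - G x"
      have AB: "L2_fun M ?A" "L2_fun M ?B" by (intro L2_fun_diff L)+
      have "(\<integral>x. f n x * cnj (g n x) \<partial>M) = (\<integral>x. ?A x * cnj (?B x) + ?A x * cnj (G x) +
          F x * cnj (?B x) + F x * cnj (G x) \<partial>M)"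
        by (intro Bochner_Integration.integral_cong) (auto simp: algebra_simps)
      also have "\<dots> = (\<integral>x. ?A x * cnj (?B x) \<partial>M) + (\<integral>x. ?A x * cnj (G x) \<partial>M) + (\<integral>x. F x * cnj (?B x) \<partial>M)
          + (\<integral>x. F x * cnj (G x) \<partial>M)"
        using L2_integrable_cnj[OF AB] L2_integrable_cnj[OF AB(1) L(4)] L2_integrable_cnj[OF L(3)
            AB(2)] L2_integrable_cnj[OF L(3,4)]
        by (simp only: Bochner_Integration.integral_add Bochner_Integration.integrable_add)
      finally have "norm ((\<integral>x. f n x * cnj (g n x) \<partial>M) - (\<integral>x. F x * cnj (G x) \<partial>M)) =
        norm ((\<integral>x. ?A x * cnj (?B x) \<partial>M) + (\<integral>x. ?A x * cnj (G x) \<partial>M) + (\<integral>x. F x * cnj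
            (?B x) \<partial>M))" by simp
      also have "\<dots> \<le> ?a n * ?b n + ?a n * L2_norm M G + L2_norm M F * ?b n"
        using L2_Cauchy_Schwarz[OF AB] L2_Cauchy_Schwarz[OF AB(1) L(4)] L2_Cauchy_Schwarz[OF L(3) AB(2)]
        by (intro order_trans[OF norm_triangle_ineq] add_mono) auto
      finally show "norm ((\<integral>x. f n x * cnj (g n x) \<partial>M) - (\<integral>x. F x * cnj (G x) \<partial>M)) \<le> ?a n * ?b n +
          ?a n * L2_norm M G + L2_norm M F * ?b n" .
    qed
  qed
qed

section \<open>Mean-square integrals of an isotropic field\<close>

text \<open>The working form of isotropy: the covariance is a continuous function of the inner
  product, extended to the whole line so that \<open>\<kappa>\<close> carries no domain
  conditions.\<close>

locale isotropic = prob_space P for P :: "'w measure" +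
  fixes T :: "real^3 \<Rightarrow> 'w \<Rightarrow> real" and \<kappa> :: "real \<Rightarrow> real"
  assumes T_L2: "x \<in> S2 \<Longrightarrow> L2_fun P (\<lambda>\<omega>. of_real (T x \<omega>))"
    and \<kappa>_cont: "continuous_on UNIV \<kappa>"
    and T_cov: "x \<in> S2 \<Longrightarrow> y \<in> S2 \<Longrightarrow> (\<integral>\<omega>. T x \<omega> * T y \<omega> \<partial>P) = \<kappa> (x \<bullet> y)"
begin

abbreviation Tc :: "real^3 \<Rightarrow> 'w \<Rightarrow> complex" where
  "Tc x \<equiv> (\<lambda>\<omega>. of_real (T x \<omega>))"

definition pairing :: "('w \<Rightarrow> complex) \<Rightarrow> real^3 \<Rightarrow> complex" where
  "pairing W x = (\<integral>\<omega>. Tc x \<omega> * cnj (W \<omega>) \<partial>P)"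

lemma \<kappa>_measurable [measurable]: "\<kappa> \<in> borel_measurable borel"
  using \<kappa>_cont by (rule borel_measurable_continuous_onI)

lemma pairing_T: "x \<in> S2 \<Longrightarrow> y \<in> S2 \<Longrightarrow> pairing (Tc x) y = of_real (\<kappa> (y \<bullet> x))"
  using T_cov[of y x] by (simp add: pairing_def flip: of_real_mult)

lemma S2_inner_self: "x \<in> S2 \<Longrightarrow> x \<bullet> x = 1"
  by (simp add: dot_square_norm)

text \<open>The square is expanded with common variance \<open>\<kappa> 1\<close>. This yields the
  norm of the field, its mean-square continuity, and a measurable formula for approximation
  errors.\<close>

lemma L2_norm_T_diff:
  assumes x: "x \<in> S2" and y: "y \<in> S2"
  shows "(L2_norm P (\<lambda>\<omega>. c * Tc x \<omega> - d * Tc y \<omega>))\<^sup>2 =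
    ((cmod c)\<^sup>2 + (cmod d)\<^sup>2) * \<kappa> 1 - 2 * Re (c * cnj d) * \<kappa> (x \<bullet> y)"
proof -
  note L = T_L2[OF x] T_L2[OF y]
  have cov: "(\<integral>\<omega>. Tc u \<omega> * Tc v \<omega> \<partial>P) = of_real (\<kappa> (u \<bullet> v))" if "u \<in> S2" "v \<in> S2" for u v
    using T_cov[OF that] by (simp flip: of_real_mult)
  have i: "integrable P (\<lambda>\<omega>. Tc u \<omega> * Tc v \<omega>)" if "u \<in> S2" "v \<in> S2" for u v
    using that by (intro L2_integrable_mult T_L2)
  have "of_real ((L2_norm P (\<lambda>\<omega>. c * Tc x \<omega> - d * Tc y \<omega>))\<^sup>2) =
    (\<integral>\<omega>. c * cnj c * (Tc x \<omega> * Tc x \<omega>) + d * cnj d * (Tc y \<omega> * Tc y \<omega>) - (c * cnj d + d * cnj c) *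
        (Tc x \<omega> * Tc y \<omega>) \<partial>P)"
    unfolding of_real_L2_norm_power2
    by (intro Bochner_Integration.integral_cong) (auto simp: algebra_simps)
  also have "\<dots> = c * cnj c * of_real (\<kappa> (x \<bullet> x)) + d * cnj d * of_real (\<kappa> (y \<bullet> y)) - (c * cnj d +
      d * cnj c) * of_real (\<kappa> (x \<bullet> y))"
    using i[OF x x] i[OF y y] i[OF x y] by
        (simp only: Bochner_Integration.integral_add Bochner_Integration.integral_diff
      Bochner_Integration.integrable_add integral_mult_right_zero integrable_mult_right cov[OF x x]
          cov[OF y y] cov[OF x y])
  also have "\<dots> = of_real (((cmod c)\<^sup>2 + (cmod d)\<^sup>2) * \<kappa> 1 - 2 * Re (c * cnj d) * \<kappa> (x \<bullet> y))"
    unfolding S2_inner_self[OF x] S2_inner_self[OF y]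
    by (simp add: complex_eq_iff cmod_power2) (simp add: power2_eq_square algebra_simps)
  finally show ?thesis by (simp only: of_real_eq_iff)
qed

lemma \<kappa>_1_nonneg: "0 \<le> \<kappa> 1"
proof -
  have "axis 1 1 \<in> (S2 :: (real^3) set)" by (simp add: norm_axis_1)
  from L2_norm_T_diff[OF this this, of 1 0]
  have "(L2_norm P (Tc (axis 1 1)))\<^sup>2 = \<kappa> 1" by simp
  then show ?thesis using zero_le_power2[of "L2_norm P (Tc (axis 1 1))"] by simp
qed

lemma L2_norm_T: "x \<in> S2 \<Longrightarrow> L2_norm P (Tc x) = sqrt (\<kappa> 1)"
  using L2_norm_T_diff[of x x 1 0] L2_norm_nonneg[of P "Tc x"] by (simp add: real_sqrt_unique)

lemma pairing_bound: "L2_fun P W \<Longrightarrow> x \<in> S2 \<Longrightarrow> cmod (pairing W x) \<le> sqrt (\<kappa> 1) * L2_norm P W"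
  unfolding pairing_def using L2_Cauchy_Schwarz[OF T_L2, of x W] by (simp add: L2_norm_T)

text \<open>Continuity of \<open>\<kappa>\<close> at 1 gives mean-square continuity of the field,
  which Cauchy-Schwarz transfers to the pairing.\<close>

lemma pairing_continuous:
  assumes W: "L2_fun P W"
  shows "continuous_on S2 (pairing W)"
  unfolding continuous_on_def
proof
  fix x :: "real^3" assume x: "x \<in> S2"
  let ?b = "\<lambda>y. sqrt (2 * \<kappa> 1 - 2 * \<kappa> (y \<bullet> x)) * L2_norm P W"
  show "(pairing W \<longlongrightarrow> pairing W x) (at x within S2)"
  proof (rule LIM_zero_cancel, rule Lim_null_comparison)
    have "isCont \<kappa> (x \<bullet> x)" using \<kappa>_cont by (simp add: continuous_on_eq_continuous_at)
    then have "((\<lambda>y. \<kappa> (y \<bullet> x)) \<longlongrightarrow> \<kappa> (x \<bullet> x)) (at x within S2)"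
      by (rule isCont_tendsto_compose) (intro tendsto_intros)
    then have "(?b \<longlongrightarrow> sqrt (2 * \<kappa> 1 - 2 * \<kappa> (x \<bullet> x)) * L2_norm P W) (at x within S2)"
      by (intro tendsto_intros)
    then show "(?b \<longlongrightarrow> 0) (at x within S2)" by (simp add: S2_inner_self[OF x])
    show "\<forall>\<^sub>F y in at x within S2. norm (pairing W y - pairing W x) \<le> ?b y"
      unfolding eventually_at_filter
    proof (rule always_eventually, intro allI impI)
      fix y assume y: "y \<in> S2"
      have D: "L2_fun P (\<lambda>\<omega>. Tc y \<omega> - Tc x \<omega>)" by (intro L2_fun_diff T_L2 x y)
      have "pairing W y - pairing W x = (\<integral>\<omega>. Tc y \<omega> * cnj (W \<omega>) - Tc x \<omega> * cnj (W \<omega>) \<partial>P)"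
        unfolding pairing_def by (rule Bochner_Integration.integral_diff[symmetric])
            (intro L2_integrable_cnj T_L2 x y W)+
      also have "\<dots> = (\<integral>\<omega>. (Tc y \<omega> - Tc x \<omega>) * cnj (W \<omega>) \<partial>P)" by (simp add: left_diff_distrib)
      finally have "norm (pairing W y - pairing W x) \<le> L2_norm P (\<lambda>\<omega>. Tc y \<omega> - Tc x \<omega>) * L2_norm P W"
        using L2_Cauchy_Schwarz[OF D W] by simp
      also have "L2_norm P (\<lambda>\<omega>. Tc y \<omega> - Tc x \<omega>) = sqrt (2 * \<kappa> 1 - 2 * \<kappa> (y \<bullet> x))"
        using L2_norm_T_diff[OF y x, of 1 1] L2_norm_nonneg[of P "\<lambda>\<omega>. Tc y \<omega> - Tc x \<omega>"] by
            (simp add: real_sqrt_unique)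
      finally show "norm (pairing W y - pairing W x) \<le> ?b y" .
    qed
  qed
qed

lemma pairing_integrable:
  assumes f: "integrable surface_measure f" and W: "L2_fun P W"
  shows "integrable surface_measure (\<lambda>x. f x * pairing W x)"
proof (rule Bochner_Integration.integrable_bound)
  have [measurable]: "pairing W \<in> borel_measurable surface_measure"
    using sphere_borel_measurable_continuous[OF pairing_continuous[OF W]] by
        (simp cong: measurable_cong_sets)
  have [measurable]: "f \<in> borel_measurable surface_measure" using f by auto
  show "integrable surface_measure (\<lambda>x. sqrt (\<kappa> 1) * L2_norm P W * norm (f x))" using f by simp
  show "(\<lambda>x. f x * pairing W x) \<in> borel_measurable surface_measure" by measurable
  show "AE x in surface_measure. norm (f x * pairing W x) \<le> norm (sqrt (\<kappa> 1) * L2_norm P W * norm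
      (f x))"
  proof (rule AE_I2)
    fix x assume "x \<in> space surface_measure"
    then have "norm (f x) * norm (pairing W x) \<le> norm (f x) * (sqrt (\<kappa> 1) * L2_norm P W)"
      using pairing_bound[OF W] by (intro mult_left_mono) auto
    then show "norm (f x * pairing W x) \<le> norm (sqrt (\<kappa> 1) * L2_norm P W * norm (f x))"
      using \<kappa>_1_nonneg L2_norm_nonneg[of P W] by (simp add: norm_mult abs_mult mult_ac)
  qed
qed

text \<open>Mean-square integrals are handled by duality: pairing with a square-integrable \<open>W\<close> turns
  them into ordinary integrals over the sphere.\<close>

definition weak_integral :: "(real^3 \<Rightarrow> complex) \<Rightarrow> ('w \<Rightarrow> complex) \<Rightarrow> bool" where
  "weak_integral f I \<longleftrightarrow> L2_fun P I \<and>
     (\<forall>W. L2_fun P W \<longrightarrow> (\<integral>\<omega>. I \<omega> * cnj (W \<omega>) \<partial>P) = (\<integral>x. f x * pairing W x \<partial>surface_measure))"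

abbreviation simple_sum :: "nat \<Rightarrow> (nat \<Rightarrow> (real^3) set) \<Rightarrow> (nat \<Rightarrow> 'w \<Rightarrow> complex) \<Rightarrow> real^3 \<Rightarrow> 'w \<Rightarrow> complex"
    where
  "simple_sum n A Z x \<omega> \<equiv> (\<Sum>i<n. indicator (A i) x * Z i \<omega>)"

abbreviation simple_int :: "nat \<Rightarrow> (nat \<Rightarrow> (real^3) set) \<Rightarrow> (nat \<Rightarrow> 'w \<Rightarrow> complex) \<Rightarrow> 'w \<Rightarrow> complex" where
  "simple_int n A Z \<omega> \<equiv> (\<Sum>i<n. of_real (measure surface_measure (A i)) * Z i \<omega>)"

text \<open>For a simple function, pairing with \<open>W\<close> commutes with integration exactly;
  for the field the defect is at most the integrated error times the norm of \<open>W\<close>. This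
  serves both to identify limits and to show that approximating integrals are Cauchy.\<close>

lemma simple_int_pairing:
  assumes f: "integrable surface_measure f"
    and A: "\<And>i. i < n \<Longrightarrow> A i \<in> sets surface_measure" and Z: "\<And>i. i < n \<Longrightarrow> L2_fun P (Z i)"
    and err: "(\<lambda>x. L2_norm P (\<lambda>\<omega>. Tc x \<omega> * f x - simple_sum n A Z x \<omega>)) \<in> borel_measurable
        surface_measure"
    and le: "(\<integral>\<^sup>+x. ennreal (L2_norm P (\<lambda>\<omega>. Tc x \<omega> * f x - simple_sum n A Z x \<omega>)) \<partial>surface_measure) \<le>
        ennreal e" "0 \<le> e"
    and W: "L2_fun P W"
  shows "cmod ((\<integral>\<omega>. simple_int n A Z \<omega> * cnj (W \<omega>) \<partial>P) - (\<integral>x. f x * pairing W x \<partial>surface_measure)) \<le>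
      e * L2_norm P W"
proof -
  let ?E = "\<lambda>x. L2_norm P (\<lambda>\<omega>. Tc x \<omega> * f x - simple_sum n A Z x \<omega>)"
  define z where "z i = (\<integral>\<omega>. Z i \<omega> * cnj (W \<omega>) \<partial>P)" for i
  have zi: "integrable P (\<lambda>\<omega>. Z i \<omega> * cnj (W \<omega>))" if "i < n" for i
    using Z[OF that] W by (rule L2_integrable_cnj)
  have ind: "integrable surface_measure (\<lambda>x. indicator (A i) x * z i)" if "i < n" for i
  proof -
    have "integrable surface_measure (\<lambda>x. indicator (A i) x *\<^sub>R z i)"
      using A[OF that] surface.emeasure_finite
      by (intro integrable_scaleR_left integrable_real_indicator) (auto simp: less_top[symmetric])
    then show ?thesis by (rule Bochner_Integration.integrable_cong[THEN iffD1, rotated 2])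
        (auto split: split_indicator)
  qed
  have 1: "(\<integral>\<omega>. simple_int n A Z \<omega> * cnj (W \<omega>) \<partial>P) = (\<Sum>i<n. of_real (measure surface_measure (A i)) * z
      i)"
  proof -
    have "(\<integral>\<omega>. simple_int n A Z \<omega> * cnj (W \<omega>) \<partial>P) = (\<integral>\<omega>. (\<Sum>i<n. of_real (measure surface_measure (A i))
        * (Z i \<omega> * cnj (W \<omega>))) \<partial>P)"
      by (simp add: sum_distrib_right mult.assoc)
    also have "\<dots> = (\<Sum>i<n. (\<integral>\<omega>. of_real (measure surface_measure (A i)) * (Z i \<omega> * cnj (W \<omega>)) \<partial>P))"
      using zi by (intro Bochner_Integration.integral_sum) auto
    finally show ?thesis by (simp add: z_def)
  qed
  have 2: "(\<integral>x. (\<Sum>i<n. indicator (A i) x * z i) \<partial>surface_measure) =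
      (\<Sum>i<n. of_real (measure surface_measure (A i)) * z i)"
  proof -
    have "(\<integral>x. (\<Sum>i<n. indicator (A i) x * z i) \<partial>surface_measure) = (\<Sum>i<n. \<integral>x. indicator (A i) x * z i
        \<partial>surface_measure)"
      using ind by (intro Bochner_Integration.integral_sum) auto
    also have "\<dots> = (\<Sum>i<n. of_real (measure surface_measure (A i)) * z i)"
    proof (rule sum.cong[OF refl])
      fix i assume "i \<in> {..<n}"
      then have i: "A i \<in> sets surface_measure" using A by auto
      have "(\<integral>x. indicator (A i) x * z i \<partial>surface_measure) =
          (\<integral>x. indicator (A i) x *\<^sub>R z i \<partial>surface_measure)"
        by (intro Bochner_Integration.integral_cong) (auto split: split_indicator)
      also have "\<dots> = measure surface_measure (A i) *\<^sub>R z i"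
        using i sets.sets_into_space[OF i] surface.emeasure_finite by
            (simp add: Int_absorb2 less_top[symmetric])
      finally show "(\<integral>x. indicator (A i) x * z i \<partial>surface_measure) = of_real (measure surface_measure
          (A i)) * z i"
        by (simp add: scaleR_conv_of_real)
    qed
    finally show ?thesis .
  qed
  have fi: "integrable surface_measure (\<lambda>x. f x * pairing W x)" using f W by (rule pairing_integrable)
  have si: "integrable surface_measure (\<lambda>x. (\<Sum>i<n. indicator (A i) x * z i))"
    using ind by (intro Bochner_Integration.integrable_sum) auto
  have pt: "cmod (f x * pairing W x - (\<Sum>i<n. indicator (A i) x * z i)) \<le> ?E x * L2_norm P W" if x:
      "x \<in> S2" for x
  proof -
    have L: "L2_fun P (\<lambda>\<omega>. Tc x \<omega> * f x)" using L2_fun_scale[OF T_L2[OF x], of "f x"] by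
        (simp add: mult.commute)
    have S: "L2_fun P (simple_sum n A Z x)" using Z by (intro L2_fun_sum L2_fun_scale) auto
    have "(\<Sum>i<n. indicator (A i) x * z i) = (\<integral>\<omega>. simple_sum n A Z x \<omega> * cnj (W \<omega>) \<partial>P)"
    proof -
      have "(\<integral>\<omega>. simple_sum n A Z x \<omega> * cnj (W \<omega>) \<partial>P) = (\<integral>\<omega>. (\<Sum>i<n. indicator (A i) x * (Z i \<omega> * cnj
          (W \<omega>))) \<partial>P)"
        by (simp add: sum_distrib_right mult.assoc)
      also have "\<dots> = (\<Sum>i<n. (\<integral>\<omega>. indicator (A i) x * (Z i \<omega> * cnj (W \<omega>)) \<partial>P))"
        using zi by (intro Bochner_Integration.integral_sum) auto
      finally show ?thesis by (simp add: z_def)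
    qed
    moreover have "f x * pairing W x = (\<integral>\<omega>. Tc x \<omega> * f x * cnj (W \<omega>) \<partial>P)"
    proof -
      have "(\<integral>\<omega>. Tc x \<omega> * f x * cnj (W \<omega>) \<partial>P) = (\<integral>\<omega>. f x * (Tc x \<omega> * cnj (W \<omega>)) \<partial>P)"
        by (simp add: mult_ac)
      then show ?thesis by (simp add: pairing_def)
    qed
    ultimately have "f x * pairing W x - (\<Sum>i<n. indicator (A i) x * z i) =
        (\<integral>\<omega>. Tc x \<omega> * f x * cnj (W \<omega>) - simple_sum n A Z x \<omega> * cnj (W \<omega>) \<partial>P)"
      using L2_integrable_cnj[OF L W] L2_integrable_cnj[OF S W] by simp
    also have "\<dots> = (\<integral>\<omega>. (Tc x \<omega> * f x - simple_sum n A Z x \<omega>) * cnj (W \<omega>) \<partial>P)"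
      by (simp add: left_diff_distrib)
    finally show ?thesis using L2_Cauchy_Schwarz[OF L2_fun_diff[OF L S] W] by simp
  qed
  have "ennreal (cmod (\<integral>x. f x * pairing W x - (\<Sum>i<n. indicator (A i) x * z i) \<partial>surface_measure))
    \<le> (\<integral>\<^sup>+x. ennreal (cmod (f x * pairing W x - (\<Sum>i<n. indicator (A i) x * z i))) \<partial>surface_measure)"
    using fi si by (intro integral_norm_bound_ennreal) auto
  also have "\<dots> \<le> (\<integral>\<^sup>+x. ennreal (L2_norm P W) * ennreal (?E x) \<partial>surface_measure)"
    using pt by (intro nn_integral_mono) (simp add: mult.commute L2_norm_nonneg flip: ennreal_mult)
  also have "\<dots> = ennreal (L2_norm P W) * (\<integral>\<^sup>+x. ennreal (?E x) \<partial>surface_measure)"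
    by (rule nn_integral_cmult[OF measurable_compose[OF err measurable_ennreal]])
  also have "\<dots> \<le> ennreal (L2_norm P W) * ennreal e"
    using le by (intro mult_left_mono) auto
  also have "\<dots> = ennreal (e * L2_norm P W)"
    using le by (simp add: mult.commute L2_norm_nonneg flip: ennreal_mult)
  finally have "cmod (\<integral>x. f x * pairing W x - (\<Sum>i<n. indicator (A i) x * z i) \<partial>surface_measure) \<le>
      e * L2_norm P W"
    using le L2_norm_nonneg[of P W] by simp
  then show ?thesis
    unfolding 1 2[symmetric] using fi si by (simp add: norm_minus_commute)
qed

lemma L2_fun_simple_int: "(\<And>i. i < n \<Longrightarrow> L2_fun P (Z i)) \<Longrightarrow> L2_fun P (simple_int n A Z)"
  by (intro L2_fun_sum L2_fun_scale) auto

text \<open>The statement covers every admissible \<open>I\<close>, so nothing has to be known about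
  the one that \<open>ms_integral\<close> selects.\<close>

lemma has_ms_integral_imp_weak:
  assumes f: "integrable surface_measure f"
    and I: "has_ms_integral P surface_measure (\<lambda>x \<omega>. Tc x \<omega> * f x) I"
  shows "weak_integral f I"
proof -
  from I have IL: "L2_fun P I" by (simp add: has_ms_integral_def)
  from I obtain n A Z where
    AZ: "\<And>k i. i < n k \<Longrightarrow> A k i \<in> sets surface_measure" "\<And>k i. i < n k \<Longrightarrow> L2_fun P (Z k i)"
    and err: "\<And>k. (\<lambda>x. L2_norm P (\<lambda>\<omega>. Tc x \<omega> * f x - simple_sum (n k) (A k) (Z k) x \<omega>)) \<in>
        borel_measurable surface_measure"
    and lim: "(\<lambda>k. \<integral>\<^sup>+x. ennreal (L2_norm P (\<lambda>\<omega>. Tc x \<omega> * f x - simple_sum (n k) (A k) (Z k) x \<omega>))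
        \<partial>surface_measure) \<longlonglongrightarrow> 0"
    and limI: "(\<lambda>k. L2_norm P (\<lambda>\<omega>. simple_int (n k) (A k) (Z k) \<omega> - I \<omega>)) \<longlonglongrightarrow> 0"
    unfolding has_ms_integral_def Let_def by blast
  define e where "e k = (\<integral>\<^sup>+x. ennreal (L2_norm P (\<lambda>\<omega>. Tc x \<omega> * f x - simple_sum (n k) (A k) (Z k) x \<omega>))
      \<partial>surface_measure)" for k
  have lim_e: "e \<longlonglongrightarrow> 0" using lim unfolding e_def[abs_def] .
  have "(\<lambda>k. enn2real (e k)) \<longlonglongrightarrow> enn2real 0" using lim_e by (intro tendsto_enn2real) auto
  then have lim_r: "(\<lambda>k. enn2real (e k)) \<longlonglongrightarrow> 0" by simp
  \<comment> \<open>The errors are extended reals; from some index on they are finite and can be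
    treated as reals.\<close>
  have fin: "\<forall>\<^sub>F k in sequentially. e k < 1" using lim_e by (rule order_tendstoD) simp
  have "(\<integral>\<omega>. I \<omega> * cnj (W \<omega>) \<partial>P) = (\<integral>x. f x * pairing W x \<partial>surface_measure)" if W: "L2_fun P W" for W
  proof (rule LIMSEQ_unique)
    let ?J = "\<lambda>k. simple_int (n k) (A k) (Z k)"
    have J: "L2_fun P (?J k)" for k using AZ by (intro L2_fun_simple_int)
    show "(\<lambda>k. \<integral>\<omega>. ?J k \<omega> * cnj (W \<omega>) \<partial>P) \<longlonglongrightarrow> (\<integral>\<omega>. I \<omega> * cnj (W \<omega>) \<partial>P)"
      by (rule L2_inner_tendsto[OF J W IL W limI]) (simp add: L2_norm_def)
    show "(\<lambda>k. \<integral>\<omega>. ?J k \<omega> * cnj (W \<omega>) \<partial>P) \<longlonglongrightarrow> (\<integral>x. f x * pairing W x \<partial>surface_measure)"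
    proof (rule LIM_zero_cancel, rule Lim_null_comparison)
      have "(\<lambda>k. enn2real (e k) * L2_norm P W) \<longlonglongrightarrow> 0 * L2_norm P W" by (intro tendsto_intros lim_r)
      then show "(\<lambda>k. enn2real (e k) * L2_norm P W) \<longlonglongrightarrow> 0" by simp
      show "\<forall>\<^sub>F k in sequentially. norm ((\<integral>\<omega>. ?J k \<omega> * cnj (W \<omega>) \<partial>P) - (\<integral>x. f x * pairing W x
          \<partial>surface_measure)) \<le> enn2real (e k) * L2_norm P W"
        using fin
      proof eventually_elim
        fix k assume "e k < 1"
        then have "e k < top" using ennreal_one_less_top by (rule less_trans)
        then have le: "(\<integral>\<^sup>+x. ennreal (L2_norm P (\<lambda>\<omega>. Tc x \<omega> * f x - simple_sum (n k) (A k) (Z k) x \<omega>))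
            \<partial>surface_measure) \<le> ennreal (enn2real (e k))"
          unfolding e_def[symmetric] by (simp add: ennreal_enn2real)
        show "norm ((\<integral>\<omega>. ?J k \<omega> * cnj (W \<omega>) \<partial>P) - (\<integral>x. f x * pairing W x \<partial>surface_measure)) \<le>
            enn2real (e k) * L2_norm P W"
          by (rule simple_int_pairing[OF f AZ(1) AZ(2) err le enn2real_nonneg W])
      qed
    qed
  qed
  then show ?thesis using IL by (simp add: weak_integral_def)
qed

end

section \<open>Existence of mean-square integrals\<close>

lemma simple_sphere_points:
  obtains b :: "nat \<Rightarrow> real^3 \<Rightarrow> real^3" where
    "\<And>i. simple_function surface_measure (b i)" "\<And>i x. b i x \<in> S2"
    "\<And>x. x \<in> S2 \<Longrightarrow> (\<lambda>i. b i x) \<longlonglongrightarrow> x"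
proof -
  have "(\<lambda>x. x) \<in> borel_measurable surface_measure"
    by (simp add: measurable_restrict_space1 cong: measurable_cong_sets)
  from borel_measurable_implies_sequence_metric[OF this, of 0] obtain F :: "nat \<Rightarrow> real^3 \<Rightarrow> real^3" where
    F': "\<forall>i. simple_function surface_measure (F i)" "\<forall>x\<in>space surface_measure. (\<lambda>i. F i x) \<longlonglongrightarrow> x"
    by blast
  have F: "simple_function surface_measure (F i)" "x \<in> S2 \<Longrightarrow> (\<lambda>i. F i x) \<longlonglongrightarrow> x" for i x
    using F' unfolding space_surface_measure by blast+
  \<comment> \<open>Simple approximations of the identity may leave the sphere, where nothing is
    known about the field. Radial projection brings them back, with an arbitrary unit vector as
    value at the origin.\<close>
  define u :: "real^3 \<Rightarrow> real^3" where "u y = (if y = 0 then axis 1 1 else y /\<^sub>R norm y)" for y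
  show ?thesis
  proof (rule that[of "\<lambda>i x. u (F i x)"])
    show "simple_function surface_measure (\<lambda>x. u (F i x))" for i
      using F(1) by (rule simple_function_compose1)
    show "u (F i x) \<in> S2" for i x
      by (simp add: u_def norm_axis_1)
    fix x :: "real^3" assume x: "x \<in> S2"
    then have nz: "norm x \<noteq> 0" by simp
    have "(\<lambda>i. F i x /\<^sub>R norm (F i x)) \<longlonglongrightarrow> x /\<^sub>R norm x"
      using nz by (intro tendsto_intros F(2) x)
    moreover have "\<forall>\<^sub>F i in sequentially. F i x \<noteq> 0"
      using F(2)[OF x] x by (intro tendsto_imp_eventually_ne) auto
    then have "\<forall>\<^sub>F i in sequentially. F i x /\<^sub>R norm (F i x) = u (F i x)"
      by eventually_elim (simp add: u_def)
    ultimately have "(\<lambda>i. u (F i x)) \<longlonglongrightarrow> x /\<^sub>R norm x" by (rule Lim_transform_eventually)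
    then show "(\<lambda>i. u (F i x)) \<longlonglongrightarrow> x" using x by simp
  qed
qed

context isotropic
begin

text \<open>The level sets of the pair \<open>(F x, b x)\<close> serve as the sets \<open>A\<close>,
  since the random variable on the right depends on \<open>x\<close> only through this pair.\<close>

lemma simple_function_sum:
  assumes F: "simple_function surface_measure F" and b: "simple_function surface_measure b"
      "\<And>x. b x \<in> S2"
  obtains n A Z where "\<And>i. i < n \<Longrightarrow> A i \<in> sets surface_measure" "\<And>i. i < n \<Longrightarrow> L2_fun P (Z i)"
    "\<And>x \<omega>. x \<in> S2 \<Longrightarrow> simple_sum n A Z x \<omega> = F x * Tc (b x) \<omega>"
proof -
  define G where "G x = (F x, b x)" for x
  have G: "simple_function surface_measure G"
    unfolding G_def[abs_def] by (rule simple_function_Pair[OF F b(1)])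
  define J where "J = G ` S2"
  have "finite J" using simple_functionD(1)[OF G] by (simp add: J_def)
  then obtain e where e: "bij_betw e {0..<card J} J" using ex_bij_betw_nat_finite by blast
  define A where "A i = G -` {e i} \<inter> S2" for i
  define Z where "Z i \<omega> = fst (e i) * Tc (snd (e i)) \<omega>" for i \<omega>
  show ?thesis
  proof (rule that[of "card J" A Z])
    fix i assume i: "i < card J"
    show "A i \<in> sets surface_measure"
      using simple_functionD(2)[OF G, of "{e i}"] by (simp add: A_def)
    have "e i \<in> J" using e i by (auto simp: bij_betw_def)
    then have "snd (e i) \<in> S2" using b(2) by (auto simp: J_def G_def)
    then show "L2_fun P (Z i)" unfolding Z_def[abs_def] by (intro L2_fun_scale T_L2)
  next
    fix x \<omega> assume x: "x \<in> S2"
    then have "G x \<in> e ` {0..<card J}" using e by (simp add: J_def bij_betw_def)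
    then obtain j where j: "j < card J" "e j = G x" by (metis atLeastLessThan_iff imageE)
    have "simple_sum (card J) A Z x \<omega> = (\<Sum>i<card J. if i = j then F x * Tc (b x) \<omega> else 0)"
    proof (rule sum.cong[OF refl])
      fix i assume "i \<in> {..<card J}"
      then have i: "i < card J" by simp
      show "indicator (A i) x * Z i \<omega> = (if i = j then F x * Tc (b x) \<omega> else 0)"
      proof (cases "i = j")
        case True
        then show ?thesis using x j by (simp add: A_def Z_def G_def)
      next
        case False
        then have "e i \<noteq> e j" using e i j(1) by (auto simp: bij_betw_def inj_on_def)
        then show ?thesis using False j by (simp add: A_def)
      qed
    qed
    then show "simple_sum (card J) A Z x \<omega> = F x * Tc (b x) \<omega>" using j by simp
  qed
qed

text \<open>The point is replaced by one from a finite subset of the sphere and the weight by a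
  simple function. The covariance gives the error in closed form; hence it is measurable in
  \<open>x\<close>, and dominated convergence applies.\<close>

lemma simple_approximation:
  assumes f: "integrable surface_measure f" and eps: "\<epsilon> > 0"
  shows "\<exists>n A Z. (\<forall>i<n. A i \<in> sets surface_measure \<and> L2_fun P (Z i)) \<and>
    (\<lambda>x. L2_norm P (\<lambda>\<omega>. Tc x \<omega> * f x - simple_sum n A Z x \<omega>)) \<in> borel_measurable surface_measure \<and>
    (\<integral>\<^sup>+x. ennreal (L2_norm P (\<lambda>\<omega>. Tc x \<omega> * f x - simple_sum n A Z x \<omega>)) \<partial>surface_measure) \<le> ennreal \<epsilon>"
proof -
  have fm [measurable]: "f \<in> borel_measurable surface_measure" using f by auto
  from borel_measurable_implies_sequence_metric[OF fm, of 0] obtain F where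
    F': "\<forall>i. simple_function surface_measure (F i)" "\<forall>x\<in>space surface_measure. (\<lambda>i. F i x) \<longlonglongrightarrow> f x"
      "\<forall>i. \<forall>x\<in>space surface_measure. dist (F i x) 0 \<le> 2 * dist (f x) 0"
    by blast
  have F: "simple_function surface_measure (F i)" "x \<in> S2 \<Longrightarrow> (\<lambda>i. F i x) \<longlonglongrightarrow> f x"
    "x \<in> S2 \<Longrightarrow> cmod (F i x) \<le> 2 * cmod (f x)" for i x
    using F' unfolding space_surface_measure dist_0_norm dist_norm diff_zero by blast+
  obtain b where b: "\<And>i. simple_function surface_measure (b i)" "\<And>i x. b i x \<in> S2"
    "\<And>x. x \<in> S2 \<Longrightarrow> (\<lambda>i. b i x) \<longlonglongrightarrow> x"
    by (rule simple_sphere_points) blast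
  have [measurable]: "F i \<in> borel_measurable surface_measure" "b i \<in> borel_measurable surface_measure"
      for i
    using F(1) b(1) by (auto intro: borel_measurable_simple_function)
  have idm [measurable]: "(\<lambda>x. x) \<in> borel_measurable surface_measure"
    by (simp add: measurable_restrict_space1 cong: measurable_cong_sets)
  define E where "E i x = L2_norm P (\<lambda>\<omega>. f x * Tc x \<omega> - F i x * Tc (b i x) \<omega>)" for i x
  define E2 where "E2 i x = ((cmod (f x))\<^sup>2 + (cmod (F i x))\<^sup>2) * \<kappa> 1 - 2 * Re (f x * cnj (F i x)) * \<kappa>
      (x \<bullet> b i x)" for i x
  have EE2: "E i x = sqrt (E2 i x)" if "x \<in> S2" for i x
    unfolding E_def E2_def by (rule real_sqrt_unique[OF L2_norm_T_diff[OF that b(2)] L2_norm_nonneg,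
        symmetric])
  have E2m: "(\<lambda>x. sqrt (E2 i x)) \<in> borel_measurable surface_measure" for i
  proof -
    have "(\<lambda>x. x \<bullet> b i x) \<in> borel_measurable surface_measure"
      by (rule borel_measurable_inner[OF idm]) measurable
    from measurable_compose[OF this \<kappa>_measurable]
    have [measurable]: "(\<lambda>x. \<kappa> (x \<bullet> b i x)) \<in> borel_measurable surface_measure" .
    have "(\<lambda>x. f x * cnj (F i x)) \<in> borel_measurable surface_measure" by measurable
    then have [measurable]: "(\<lambda>x. Re (f x * cnj (F i x))) \<in> borel_measurable surface_measure"
        by measurable
    show ?thesis unfolding E2_def by measurable
  qed
  have Em: "E i \<in> borel_measurable surface_measure" for i
    using E2m by (rule measurable_cong[THEN iffD1, rotated]) (simp add: EE2)
  \<comment> \<open>The constant 3 is \<open>1 + 2\<close>, from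
    \<open>cmod (F i x) \<le> 2 * cmod (f x)\<close>.\<close>
  have Ebound: "E i x \<le> 3 * sqrt (\<kappa> 1) * cmod (f x)" if x: "x \<in> S2" for i x
  proof -
    have "E i x \<le> L2_norm P (\<lambda>\<omega>. f x * Tc x \<omega>) + L2_norm P (\<lambda>\<omega>. (- F i x) * Tc (b i x) \<omega>)"
      using L2_norm_triangle[OF L2_fun_scale[OF T_L2[OF x]] L2_fun_scale[OF T_L2[OF b(2)]], of "f x"
          "- F i x" i x]
      by (simp add: E_def)
    also have "\<dots> = (cmod (f x) + cmod (F i x)) * sqrt (\<kappa> 1)"
      unfolding L2_norm_scale using x b(2) by (simp add: L2_norm_T distrib_right)
    also have "\<dots> \<le> (3 * cmod (f x)) * sqrt (\<kappa> 1)"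
      using F(3)[OF x, of i] \<kappa>_1_nonneg by (intro mult_right_mono) auto
    finally show ?thesis by (simp add: mult_ac)
  qed
  have Elim: "(\<lambda>i. E i x) \<longlonglongrightarrow> 0" if x: "x \<in> S2" for x
  proof -
    have "isCont \<kappa> (x \<bullet> x)" using \<kappa>_cont by (simp add: continuous_on_eq_continuous_at)
    then have "(\<lambda>i. \<kappa> (x \<bullet> b i x)) \<longlonglongrightarrow> \<kappa> (x \<bullet> x)"
      by (rule isCont_tendsto_compose) (intro tendsto_intros b x)
    then have "(\<lambda>i. sqrt (E2 i x)) \<longlonglongrightarrow> sqrt (((cmod (f x))\<^sup>2 + (cmod (f x))\<^sup>2) * \<kappa> 1 - 2 * Re (f x * cnj
        (f x)) * \<kappa> (x \<bullet> x))"
      unfolding E2_def by (intro tendsto_intros F x)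
    also have "((cmod (f x))\<^sup>2 + (cmod (f x))\<^sup>2) * \<kappa> 1 - 2 * Re (f x * cnj (f x)) * \<kappa> (x \<bullet> x) = 0"
      using x by (simp add: S2_inner_self cmod_power2 flip: power2_eq_square)
    finally show ?thesis using x by (simp add: EE2)
  qed
  have gi: "integrable surface_measure (\<lambda>x. 3 * sqrt (\<kappa> 1) * cmod (f x))" using f by simp
  have Enn: "0 \<le> E i x" for i x by (simp add: E_def L2_norm_nonneg)
  have nb: "AE x in surface_measure. norm (E i x) \<le> 3 * sqrt (\<kappa> 1) * cmod (f x)" for i
    using Ebound Enn by (intro AE_I2) simp
  have Ei: "integrable surface_measure (E i)" for i
    using nb[of i] by (intro Bochner_Integration.integrable_bound[OF gi Em])
        (auto elim!: eventually_mono)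
  have "(\<lambda>i. \<integral>x. E i x \<partial>surface_measure) \<longlonglongrightarrow> (\<integral>x. 0 \<partial>surface_measure)"
    by (rule integral_dominated_convergence[OF _ Em gi _ nb]) (auto intro!: AE_I2 Elim)
  then have "\<forall>\<^sub>F i in sequentially. (\<integral>x. E i x \<partial>surface_measure) < \<epsilon>"
    using eps by (intro order_tendstoD) auto
  then obtain i where i: "(\<integral>x. E i x \<partial>surface_measure) < \<epsilon>"
    by (auto simp: eventually_sequentially)
  obtain n A Z where AZ: "\<And>j. j < n \<Longrightarrow> A j \<in> sets surface_measure" "\<And>j. j < n \<Longrightarrow> L2_fun P (Z j)"
    "\<And>x \<omega>. x \<in> S2 \<Longrightarrow> simple_sum n A Z x \<omega> = F i x * Tc (b i x) \<omega>"
    by (rule simple_function_sum[OF F(1)[of i] b(1)[of i] b(2)]) blast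
  have eq: "L2_norm P (\<lambda>\<omega>. Tc x \<omega> * f x - simple_sum n A Z x \<omega>) = E i x" if "x \<in> S2" for x
    by (simp only: AZ(3)[OF that] E_def mult.commute[of "f x"])
  have 1: "(\<lambda>x. L2_norm P (\<lambda>\<omega>. Tc x \<omega> * f x - simple_sum n A Z x \<omega>)) \<in> borel_measurable surface_measure"
    using Em[of i] by (rule measurable_cong[THEN iffD1, rotated]) (simp only: eq space_surface_measure)
  have "(\<integral>\<^sup>+x. ennreal (L2_norm P (\<lambda>\<omega>. Tc x \<omega> * f x - simple_sum n A Z x \<omega>)) \<partial>surface_measure) =
      (\<integral>\<^sup>+x. ennreal (E i x) \<partial>surface_measure)"
    by (intro nn_integral_cong) (simp only: eq space_surface_measure)
  also have "\<dots> = ennreal (\<integral>x. E i x \<partial>surface_measure)"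
    by (rule nn_integral_eq_integral[OF Ei]) (simp add: Enn)
  also have "\<dots> \<le> ennreal \<epsilon>" using i by (intro ennreal_leI) simp
  finally have 2: "(\<integral>\<^sup>+x. ennreal (L2_norm P (\<lambda>\<omega>. Tc x \<omega> * f x - simple_sum n A Z x \<omega>))
      \<partial>surface_measure) \<le> ennreal \<epsilon>" .
  show ?thesis
    by (intro exI[of _ n] exI[of _ A] exI[of _ Z] conjI allI impI 1 2 AZ)
qed

text \<open>With integrated errors \<open>(1/2) ^ k\<close>, testing the difference of two
  approximating integrals against itself bounds its norm by the sum of their errors; completeness
  then gives the limit.\<close>

lemma ex_has_ms_integral:
  assumes f: "integrable surface_measure f"
  shows "\<exists>I. has_ms_integral P surface_measure (\<lambda>x \<omega>. Tc x \<omega> * f x) I"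
proof -
  define Q where "Q k n A Z \<longleftrightarrow> (\<forall>i<n. A i \<in> sets surface_measure \<and> L2_fun P (Z i)) \<and>
    (\<lambda>x. L2_norm P (\<lambda>\<omega>. Tc x \<omega> * f x - simple_sum n A Z x \<omega>)) \<in> borel_measurable surface_measure \<and>
    (\<integral>\<^sup>+x. ennreal (L2_norm P (\<lambda>\<omega>. Tc x \<omega> * f x - simple_sum n A Z x \<omega>)) \<partial>surface_measure) \<le> ennreal
        ((1/2) ^ k)"
    for k :: nat and n A Z
  have "\<exists>n A Z. Q k n A Z" for k
    unfolding Q_def by (rule simple_approximation[OF f]) simp
  then obtain n A Z where Q: "\<And>k. Q k (n k) (A k) (Z k)" by metis
  have AZ: "i < n k \<Longrightarrow> A k i \<in> sets surface_measure" "i < n k \<Longrightarrow> L2_fun P (Z k i)"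
    and err: "(\<lambda>x. L2_norm P (\<lambda>\<omega>. Tc x \<omega> * f x - simple_sum (n k) (A k) (Z k) x \<omega>)) \<in> borel_measurable
        surface_measure"
    and le: "(\<integral>\<^sup>+x. ennreal (L2_norm P (\<lambda>\<omega>. Tc x \<omega> * f x - simple_sum (n k) (A k) (Z k) x \<omega>))
        \<partial>surface_measure) \<le> ennreal ((1/2) ^ k)"
    for k i
    using Q[of k] unfolding Q_def by blast+
  let ?J = "\<lambda>k. simple_int (n k) (A k) (Z k)"
  have J: "L2_fun P (?J k)" for k using AZ by (intro L2_fun_simple_int)
  have cauchy: "L2_norm P (\<lambda>\<omega>. ?J j \<omega> - ?J k \<omega>) \<le> (1/2) ^ j + (1/2) ^ k" for j k
  proof -
    let ?D = "\<lambda>\<omega>. ?J j \<omega> - ?J k \<omega>"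
    have D: "L2_fun P ?D" by (intro L2_fun_diff J)
    let ?S = "\<integral>x. f x * pairing ?D x \<partial>surface_measure"
    have close: "cmod ((\<integral>\<omega>. ?J i \<omega> * cnj (?D \<omega>) \<partial>P) - ?S) \<le> (1/2) ^ i * L2_norm P ?D" for i
      by (rule simple_int_pairing[OF f AZ(1) AZ(2) err le _ D]) auto
    have "of_real ((L2_norm P ?D)\<^sup>2) = (\<integral>\<omega>. ?J j \<omega> * cnj (?D \<omega>) - ?J k \<omega> * cnj (?D \<omega>) \<partial>P)"
      unfolding of_real_L2_norm_power2 left_diff_distrib ..
    also have "\<dots> = ((\<integral>\<omega>. ?J j \<omega> * cnj (?D \<omega>) \<partial>P) - ?S) - ((\<integral>\<omega>. ?J k \<omega> * cnj (?D \<omega>) \<partial>P) - ?S)"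
      using L2_integrable_cnj[OF J D] by (subst Bochner_Integration.integral_diff) simp_all
    finally have e: "complex_of_real ((L2_norm P ?D)\<^sup>2) = ((\<integral>\<omega>. ?J j \<omega> * cnj (?D \<omega>) \<partial>P) - ?S) -
        ((\<integral>\<omega>. ?J k \<omega> * cnj (?D \<omega>) \<partial>P) - ?S)" .
    have "L2_norm P ?D * L2_norm P ?D = cmod (of_real ((L2_norm P ?D)\<^sup>2))"
      unfolding norm_of_real power2_eq_square by (rule abs_of_nonneg[symmetric])
          (intro mult_nonneg_nonneg L2_norm_nonneg)
    also have "\<dots> \<le> cmod ((\<integral>\<omega>. ?J j \<omega> * cnj (?D \<omega>) \<partial>P) - ?S) + cmod ((\<integral>\<omega>. ?J k \<omega> * cnj (?D \<omega>) \<partial>P) - ?S)"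
      unfolding e by (rule norm_triangle_ineq4)
    also have "\<dots> \<le> ((1/2) ^ j + (1/2) ^ k) * L2_norm P ?D"
      unfolding distrib_right by (intro add_mono close)
    finally have "L2_norm P ?D * L2_norm P ?D \<le> ((1/2) ^ j + (1/2) ^ k) * L2_norm P ?D" .
    moreover have "0 \<le> (1/2 :: real) ^ j + (1/2) ^ k" by simp
    moreover have "t \<le> c" if "t * t \<le> c * t" "0 \<le> c" "0 \<le> t" for t c :: real
      using that by (cases "t = 0") (simp_all add: mult_le_cancel_right)
    ultimately show ?thesis using L2_norm_nonneg by blast
  qed
  obtain I where I: "L2_fun P I" "(\<lambda>k. L2_norm P (\<lambda>\<omega>. ?J k \<omega> - I \<omega>)) \<longlonglongrightarrow> 0"
    by (rule L2_complete[OF J cauchy])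
  have lim: "(\<lambda>k. \<integral>\<^sup>+x. ennreal (L2_norm P (\<lambda>\<omega>. Tc x \<omega> * f x - simple_sum (n k) (A k) (Z k) x \<omega>))
      \<partial>surface_measure) \<longlonglongrightarrow> 0"
  proof (rule tendsto_sandwich[OF _ _ tendsto_const])
    have "(\<lambda>k. ennreal ((1/2) ^ k)) \<longlonglongrightarrow> ennreal 0"
      by (intro tendsto_ennrealI LIMSEQ_power_zero) simp
    then show "(\<lambda>k. ennreal ((1/2) ^ k)) \<longlonglongrightarrow> 0" by simp
  qed (use le in auto)
  have X: "L2_fun P (\<lambda>\<omega>. Tc x \<omega> * f x)" if "x \<in> S2" for x
    using L2_fun_scale[OF T_L2[OF that], of "f x"] by (simp add: mult.commute)
  have fin: "emeasure surface_measure B < \<infinity>" for B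
    using surface.emeasure_finite[of B] by (simp add: less_top[symmetric])
  have "has_ms_integral P surface_measure (\<lambda>x \<omega>. Tc x \<omega> * f x) I"
    unfolding has_ms_integral_def Let_def
  proof (intro conjI exI[of _ n] exI[of _ A] exI[of _ Z] allI impI ballI)
    show "L2_fun P (\<lambda>\<omega>. Tc x \<omega> * f x)" if "x \<in> space surface_measure" for x using that X by simp
  qed (use AZ err lim I fin in auto)
  then show ?thesis by (rule exI[of _ I])
qed

section \<open>Linear combinations, norm bound and covariance of weak integrals\<close>

lemma weak_integral_cong:
  "weak_integral f I \<Longrightarrow> (\<And>x. x \<in> S2 \<Longrightarrow> f x = g x) \<Longrightarrow> weak_integral g I"
  unfolding weak_integral_def
  by (auto intro!: Bochner_Integration.integral_cong cong: Bochner_Integration.integral_cong)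

lemma weak_integral_sum_diff:
  assumes f: "\<And>k. k < n \<Longrightarrow> integrable surface_measure (f k)" "\<And>k. k < n \<Longrightarrow> weak_integral (f k) (I k)"
    and g: "integrable surface_measure g" "weak_integral g J"
  shows "weak_integral (\<lambda>x. (\<Sum>k<n. c k * f k x) - g x) (\<lambda>\<omega>. (\<Sum>k<n. c k * I k \<omega>) - J \<omega>)"
  unfolding weak_integral_def
proof (intro conjI allI impI)
  have I: "L2_fun P (I k)" if "k < n" for k using f(2)[OF that] by (simp add: weak_integral_def)
  have J: "L2_fun P J" using g by (simp add: weak_integral_def)
  show "L2_fun P (\<lambda>\<omega>. (\<Sum>k<n. c k * I k \<omega>) - J \<omega>)"
    using I J by (intro L2_fun_diff L2_fun_sum L2_fun_scale) auto
  fix W assume W: "L2_fun P W"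
  have i: "integrable P (\<lambda>\<omega>. I k \<omega> * cnj (W \<omega>))" if "k < n" for k using I[OF that] W by
      (rule L2_integrable_cnj)
  have j: "integrable P (\<lambda>\<omega>. J \<omega> * cnj (W \<omega>))" using J W by (rule L2_integrable_cnj)
  have fi: "integrable surface_measure (\<lambda>x. f k x * pairing W x)" if "k < n" for k
      using f(1)[OF that] W by (rule pairing_integrable)
  have gi: "integrable surface_measure (\<lambda>x. g x * pairing W x)"
      using g(1) W by (rule pairing_integrable)
  have "(\<integral>\<omega>. ((\<Sum>k<n. c k * I k \<omega>) - J \<omega>) * cnj (W \<omega>) \<partial>P) = (\<integral>\<omega>. (\<Sum>k<n. c k * (I k \<omega> * cnj (W \<omega>))) - J \<omega>
      * cnj (W \<omega>) \<partial>P)"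
    by (simp add: left_diff_distrib sum_distrib_right mult.assoc)
  also have "\<dots> = (\<Sum>k<n. c k * (\<integral>\<omega>. I k \<omega> * cnj (W \<omega>) \<partial>P)) - (\<integral>\<omega>. J \<omega> * cnj (W \<omega>) \<partial>P)"
    using i j by (subst Bochner_Integration.integral_diff) (auto simp: Bochner_Integration.integral_sum)
  also have "\<dots> = (\<Sum>k<n. c k * (\<integral>x. f k x * pairing W x \<partial>surface_measure)) - (\<integral>x. g x * pairing W x
      \<partial>surface_measure)"
    using f(2) g(2) W by (simp add: weak_integral_def)
  also have "\<dots> = (\<integral>x. (\<Sum>k<n. c k * (f k x * pairing W x)) - g x * pairing W x \<partial>surface_measure)"
    using fi gi by (subst Bochner_Integration.integral_diff)
        (auto simp: Bochner_Integration.integral_sum)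
  also have "\<dots> = (\<integral>x. ((\<Sum>k<n. c k * f k x) - g x) * pairing W x \<partial>surface_measure)"
    by (simp add: left_diff_distrib sum_distrib_right mult.assoc)
  finally show "(\<integral>\<omega>. ((\<Sum>k<n. c k * I k \<omega>) - J \<omega>) * cnj (W \<omega>) \<partial>P) = (\<integral>x. ((\<Sum>k<n. c k * f k x) - g x) *
      pairing W x \<partial>surface_measure)" .
qed

text \<open>\<open>D\<close> is tested against itself, \<open>pairing_bound\<close> estimates the
  integrand, and one factor of the norm is cancelled.\<close>

lemma weak_integral_norm:
  assumes f: "integrable surface_measure f" and D: "weak_integral f D"
  shows "L2_norm P D \<le> sqrt (\<kappa> 1) * (\<integral>x. cmod (f x) \<partial>surface_measure)"
proof -
  have L: "L2_fun P D" using D by (simp add: weak_integral_def)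
  have "(L2_norm P D)\<^sup>2 = cmod (of_real ((L2_norm P D)\<^sup>2))" unfolding norm_of_real by simp
  also have "\<dots> = cmod (\<integral>x. f x * pairing D x \<partial>surface_measure)"
    unfolding of_real_L2_norm_power2 using D L by (simp add: weak_integral_def)
  also have "\<dots> \<le> (\<integral>x. sqrt (\<kappa> 1) * L2_norm P D * cmod (f x) \<partial>surface_measure)"
  proof (rule Bochner_Integration.integral_norm_bound_integral)
    fix x assume "x \<in> space surface_measure"
    then have "cmod (f x) * cmod (pairing D x) \<le> cmod (f x) * (sqrt (\<kappa> 1) * L2_norm P D)"
      using pairing_bound[OF L] by (intro mult_left_mono) auto
    then show "norm (f x * pairing D x) \<le> sqrt (\<kappa> 1) * L2_norm P D * cmod (f x)"
      by (simp add: norm_mult mult_ac)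
  qed (use pairing_integrable[OF f L] f in auto)
  also have "\<dots> = (sqrt (\<kappa> 1) * (\<integral>x. cmod (f x) \<partial>surface_measure)) * L2_norm P D"
    by simp
  finally have le: "L2_norm P D * L2_norm P D \<le> (sqrt (\<kappa> 1) * (\<integral>x. cmod (f x) \<partial>surface_measure)) *
      L2_norm P D"
    by (simp add: power2_eq_square)
  have nn: "0 \<le> sqrt (\<kappa> 1) * (\<integral>x. cmod (f x) \<partial>surface_measure)"
    using \<kappa>_1_nonneg by (intro mult_nonneg_nonneg integral_nonneg) auto
  show ?thesis
  proof (cases "L2_norm P D = 0")
    case False
    then have "L2_norm P D > 0" using L2_norm_nonneg[of P D] by linarith
    with le show ?thesis by (rule mult_right_le_imp_le)
  qed (use nn in simp)
qed

text \<open>Two tests: \<open>I\<close> against \<open>J\<close>, which leaves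
  \<open>pairing J\<close>, and then \<open>J\<close> against the field at a single point, which
  brings in the covariance.\<close>

lemma weak_integral_cov:
  assumes f: "weak_integral f I" and g: "weak_integral g J"
  shows "(\<integral>\<omega>. I \<omega> * cnj (J \<omega>) \<partial>P) =
    (\<integral>x. f x * (\<integral>y. cnj (g y) * of_real (\<kappa> (x \<bullet> y)) \<partial>surface_measure) \<partial>surface_measure)"
proof -
  have J: "L2_fun P J" using g by (simp add: weak_integral_def)
  have "pairing J x = (\<integral>y. cnj (g y) * of_real (\<kappa> (x \<bullet> y)) \<partial>surface_measure)" if x: "x \<in> S2" for x
  proof -
    have "pairing J x = (\<integral>\<omega>. cnj (J \<omega> * cnj (Tc x \<omega>)) \<partial>P)"
      unfolding pairing_def by (simp add: mult.commute)
    also have "\<dots> = cnj (\<integral>\<omega>. J \<omega> * cnj (Tc x \<omega>) \<partial>P)" by (rule Bochner_Integration.integral_cnj)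
    also have "(\<integral>\<omega>. J \<omega> * cnj (Tc x \<omega>) \<partial>P) = (\<integral>y. g y * pairing (Tc x) y \<partial>surface_measure)"
      using g T_L2[OF x] unfolding weak_integral_def by blast
    also have "cnj \<dots> = (\<integral>y. cnj (g y * pairing (Tc x) y) \<partial>surface_measure)"
      by (rule Bochner_Integration.integral_cnj[symmetric])
    also have "\<dots> = (\<integral>y. cnj (g y) * of_real (\<kappa> (x \<bullet> y)) \<partial>surface_measure)"
      using x by (intro Bochner_Integration.integral_cong) (auto simp: pairing_T inner_commute)
    finally show ?thesis .
  qed
  then have "(\<integral>x. f x * pairing J x \<partial>surface_measure) = (\<integral>x. f x * (\<integral>y. cnj (g y) * of_real (\<kappa> (x \<bullet> y))
      \<partial>surface_measure) \<partial>surface_measure)"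
    by (intro Bochner_Integration.integral_cong) auto
  then show ?thesis using f J by (simp add: weak_integral_def)
qed

text \<open>The coefficients integrate against conjugate harmonics, hence the conjugate of the form
  on the right.\<close>

lemma weak_integral_sph_harm_cov:
  assumes I: "weak_integral (\<lambda>x. cnj (sph_harm l m x)) I"
      and J: "weak_integral (\<lambda>x. cnj (sph_harm l' m' x)) J"
  shows "(\<integral>\<omega>. I \<omega> * cnj (J \<omega>) \<partial>P) = cnj (kernel_form \<kappa> (sph_harm l m) (sph_harm l' m'))"
proof -
  have "kernel_form \<kappa> (sph_harm l m) (sph_harm l' m') =
    (\<integral>x. (\<integral>y. of_real (\<kappa> (x \<bullet> y)) * (sph_harm l m x * cnj (sph_harm l' m' y)) \<partial>surface_measure)
        \<partial>surface_measure)"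
    unfolding kernel_form_def
    using surface_pair.integral_fst'[OF kernel_form_integrable[OF \<kappa>_cont continuous_on_sph_harm
        continuous_on_sph_harm], of l m l' m'] by simp
  also have "\<dots> = (\<integral>x. sph_harm l m x * (\<integral>y. cnj (sph_harm l' m' y) * of_real (\<kappa> (x \<bullet> y))
      \<partial>surface_measure) \<partial>surface_measure)"
    by (simp add: mult_ac flip: integral_mult_right_zero)
  also have "cnj \<dots> = (\<integral>x. cnj (sph_harm l m x) * (\<integral>y. sph_harm l' m' y * of_real (\<kappa> (x \<bullet> y))
      \<partial>surface_measure) \<partial>surface_measure)"
    by (simp flip: Bochner_Integration.integral_cnj)
  also have "\<dots> = (\<integral>\<omega>. I \<omega> * cnj (J \<omega>) \<partial>P)"
    by (simp add: weak_integral_cov[OF I J])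
  finally show ?thesis ..
qed

end

section \<open>Expansion of a zonal function times a spherical harmonic\<close>

lemma L2_fun_bounded_mult:
  assumes f: "L2_fun M f" and g: "g \<in> borel_measurable M" "\<And>x. x \<in> space M \<Longrightarrow> cmod (g x) \<le> B"
  shows "L2_fun M (\<lambda>x. f x * g x)" and "0 \<le> B \<Longrightarrow> L2_norm M (\<lambda>x. f x * g x) \<le> B * L2_norm M f"
proof -
  have [measurable]: "f \<in> borel_measurable M" using f by auto
  note g(1)[measurable]
  have i: "integrable M (\<lambda>x. B\<^sup>2 * (cmod (f x))\<^sup>2)" using f by (simp add: L2_fun_def)
  have le: "(cmod (f x * g x))\<^sup>2 \<le> B\<^sup>2 * (cmod (f x))\<^sup>2" if "x \<in> space M" for x
  proof -
    have "cmod (f x * g x) \<le> B * cmod (f x)"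
      using mult_left_mono[OF g(2)[OF that], of "cmod (f x)"] by (simp add: norm_mult mult.commute)
    then have "(cmod (f x * g x))\<^sup>2 \<le> (B * cmod (f x))\<^sup>2" by (intro power_mono) auto
    then show ?thesis by (simp add: power_mult_distrib)
  qed
  show L: "L2_fun M (\<lambda>x. f x * g x)"
    unfolding L2_fun_def
  proof
    show "integrable M (\<lambda>x. (cmod (f x * g x))\<^sup>2)"
      by (rule Bochner_Integration.integrable_bound[OF i]) (auto intro!: AE_I2 le)
  qed measurable
  show "L2_norm M (\<lambda>x. f x * g x) \<le> B * L2_norm M f" if B: "0 \<le> B"
  proof (rule power2_le_imp_le)
    have "(L2_norm M (\<lambda>x. f x * g x))\<^sup>2 \<le> (\<integral>x. B\<^sup>2 * (cmod (f x))\<^sup>2 \<partial>M)"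
      unfolding L2_norm_power2 using L le by (intro integral_mono i) (auto simp: L2_fun_def)
    also have "\<dots> = (B * L2_norm M f)\<^sup>2" by (simp add: L2_norm_power2 power_mult_distrib)
    finally show "(L2_norm M (\<lambda>x. f x * g x))\<^sup>2 \<le> (B * L2_norm M f)\<^sup>2" .
  qed (use B in \<open>simp add: L2_norm_nonneg\<close>)
qed

lemma L2_norm_pythagoras:
  assumes r: "L2_fun M r" and p: "L2_fun M p" and orth: "(\<integral>x. r x * cnj (p x) \<partial>M) = 0"
  shows "L2_norm M r \<le> L2_norm M (\<lambda>x. r x + p x)"
proof (rule power2_le_imp_le)
  have orth': "(\<integral>x. p x * cnj (r x) \<partial>M) = 0"
  proof -
    have "(\<integral>x. p x * cnj (r x) \<partial>M) = (\<integral>x. cnj (r x * cnj (p x)) \<partial>M)" by (simp add: mult.commute)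
    then show ?thesis using orth by (simp only: Bochner_Integration.integral_cnj) simp
  qed
  have "complex_of_real ((L2_norm M (\<lambda>x. r x + p x))\<^sup>2) = (\<integral>x. r x * cnj (r x) + r x * cnj (p x) +
      p x * cnj (r x) + p x * cnj (p x) \<partial>M)"
    unfolding of_real_L2_norm_power2 by (intro Bochner_Integration.integral_cong)
        (auto simp: algebra_simps)
  also have "\<dots> = (\<integral>x. r x * cnj (r x) \<partial>M) + (\<integral>x. r x * cnj (p x) \<partial>M) + (\<integral>x. p x * cnj (r x) \<partial>M) +
      (\<integral>x. p x * cnj (p x) \<partial>M)"
    using L2_integrable_cnj[OF r r] L2_integrable_cnj[OF r p] L2_integrable_cnj[OF p r]
        L2_integrable_cnj[OF p p]
    by (simp only: Bochner_Integration.integral_add Bochner_Integration.integrable_add)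
  also have "\<dots> = complex_of_real ((L2_norm M r)\<^sup>2 + (L2_norm M p)\<^sup>2)"
    unfolding orth orth' of_real_add of_real_L2_norm_power2 by simp
  finally have "(L2_norm M (\<lambda>x. r x + p x))\<^sup>2 = (L2_norm M r)\<^sup>2 + (L2_norm M p)\<^sup>2"
    by (simp only: of_real_eq_iff)
  then show "(L2_norm M r)\<^sup>2 \<le> (L2_norm M (\<lambda>x. r x + p x))\<^sup>2" by simp
qed (rule L2_norm_nonneg)

text \<open>Some of the \<open>e k\<close> may vanish, which accounts for the predicate \<open>Q\<close>.\<close>

lemma L2_orthonormal_expansion:
  fixes e :: "nat \<Rightarrow> 'a \<Rightarrow> complex"
  assumes f: "L2_fun M f" and e: "\<And>k. L2_fun M (e k)"
    and orth: "\<And>j k. (\<integral>x. e k x * cnj (e j x) \<partial>M) = (if k = j \<and> Q k then 1 else 0)"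
    and zero: "\<And>k. \<not> Q k \<Longrightarrow> (\<integral>x. f x * cnj (e k x) \<partial>M) = 0"
    and dense: "\<And>\<epsilon>. \<epsilon> > 0 \<Longrightarrow> \<exists>N d. L2_norm M (\<lambda>x. (\<Sum>k<N. d k * e k x) - f x) < \<epsilon>"
  shows "(\<lambda>n. L2_norm M (\<lambda>x. (\<Sum>k<n. (\<integral>x. f x * cnj (e k x) \<partial>M) * e k x) - f x)) \<longlonglongrightarrow> 0"
proof -
  define c where "c k = (\<integral>x. f x * cnj (e k x) \<partial>M)" for k
  define r where "r n x = f x - (\<Sum>k<n. c k * e k x)" for n x
  have rL: "L2_fun M (r n)" for n
    unfolding r_def[abs_def] by (intro L2_fun_diff L2_fun_sum L2_fun_scale f e)
  have ro: "(\<integral>x. r n x * cnj (e j x) \<partial>M) = 0" if "j < n" for n j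
  proof -
    have "(\<integral>x. r n x * cnj (e j x) \<partial>M) = (\<integral>x. f x * cnj (e j x) - (\<Sum>k<n. c k * (e k x * cnj (e j x)))
        \<partial>M)"
      by (simp add: r_def left_diff_distrib sum_distrib_right mult.assoc)
    also have "\<dots> = c j - (\<Sum>k<n. c k * (\<integral>x. e k x * cnj (e j x) \<partial>M))"
      using L2_integrable_cnj[OF f e] L2_integrable_cnj[OF e e]
      by (simp add: Bochner_Integration.integral_sum c_def)
    also have "(\<Sum>k<n. c k * (\<integral>x. e k x * cnj (e j x) \<partial>M)) = (\<Sum>k<n. if k =
        j then (if Q j then c j else 0) else 0)"
      by (rule sum.cong) (auto simp: orth)
    also have "\<dots> = (if Q j then c j else 0)" using that by simp
    finally show ?thesis using zero[of j] by (auto simp: c_def)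
  qed
  \<comment> \<open>The remainder \<open>r n\<close> is orthogonal to all combinations of the first
    \<open>n\<close> functions, so by Pythagoras no such combination is closer to \<open>f\<close>;
    density then forces convergence.\<close>
  have best: "L2_norm M (r n) \<le> L2_norm M (\<lambda>x. (\<Sum>k<N. d k * e k x) - f x)" if "N \<le> n" for n N d
  proof -
    define b where "b k = c k - (if k < N then d k else 0)" for k
    define p where "p x = (\<Sum>k<n. b k * e k x)" for x
    have pL: "L2_fun M p" unfolding p_def[abs_def] by (intro L2_fun_sum L2_fun_scale e)
    have "(\<integral>x. r n x * cnj (p x) \<partial>M) = (\<integral>x. (\<Sum>k<n. cnj (b k) * (r n x * cnj (e k x))) \<partial>M)"
      by (simp add: p_def sum_distrib_left mult_ac)
    also have "\<dots> = (\<Sum>k<n. cnj (b k) * (\<integral>x. r n x * cnj (e k x) \<partial>M))"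
      using L2_integrable_cnj[OF rL e] by (simp add: Bochner_Integration.integral_sum)
    also have "\<dots> = 0" using ro by simp
    finally have "L2_norm M (r n) \<le> L2_norm M (\<lambda>x. r n x + p x)" by (intro L2_norm_pythagoras rL pL)
    also have "(\<lambda>x. r n x + p x) = (\<lambda>x. f x - (\<Sum>k<N. d k * e k x))"
    proof
      fix x
      have "(\<Sum>k<n. (if k < N then d k else 0) * e k x) = (\<Sum>k<N. d k * e k x)"
        using that by (intro sum.mono_neutral_cong_right) auto
      then show "r n x + p x = f x - (\<Sum>k<N. d k * e k x)"
        by (simp add: r_def p_def b_def left_diff_distrib sum_subtractf)
    qed
    finally show ?thesis by (simp only: L2_norm_minus_commute)
  qed
  have "(\<lambda>n. L2_norm M (r n)) \<longlonglongrightarrow> 0"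
  proof (rule LIMSEQ_I)
    fix \<epsilon> :: real assume "\<epsilon> > 0"
    from dense[OF this] obtain N d where Nd: "L2_norm M (\<lambda>x. (\<Sum>k<N. d k * e k x) - f x) < \<epsilon>" by blast
    show "\<exists>no. \<forall>n\<ge>no. norm (L2_norm M (r n) - 0) < \<epsilon>"
      using order.strict_trans1[OF best Nd] L2_norm_nonneg[of M] by (intro exI[of _ N]) simp
  qed
  then show ?thesis unfolding r_def[abs_def] c_def[symmetric] by
      (simp only: L2_norm_minus_commute[of M f])
qed

lemma sph_harm_bounded: "\<exists>B\<ge>0. \<forall>x\<in>S2. cmod (sph_harm l m x) \<le> B"
proof -
  have "compact (sph_harm l m ` S2)"
      by (intro compact_continuous_image continuous_on_sph_harm compact_sphere)
  then obtain B where "\<And>x. x \<in> S2 \<Longrightarrow> cmod (sph_harm l m x) \<le> B"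
    using compact_imp_bounded bounded_iff by (metis image_eqI)
  then show ?thesis by (intro exI[of _ "max 0 B"]) (auto simp: le_max_iff_disj)
qed

lemma sph_harm_measurable [measurable]: "sph_harm l m \<in> borel_measurable surface_measure"
  using sphere_borel_measurable_continuous[OF continuous_on_sph_harm] by
      (simp cong: measurable_cong_sets)

lemma sph_harm_L2: "L2_fun surface_measure (sph_harm l m)"
proof -
  obtain B where "\<forall>x\<in>S2. cmod (sph_harm l m x) \<le> B" using sph_harm_bounded by blast
  then show ?thesis by (intro surface.L2_fun_bounded[of _ B]) auto
qed

lemma cnj_sph_harm_0: "x \<in> S2 \<Longrightarrow> cnj (sph_harm l 0 x) = sph_harm l 0 x"
  using cnj_sph_harm[of x l 0] by simp

text \<open>The coefficient of \<open>cnj (sph_harm k m x)\<close> in \<open>V\<close> times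
  \<open>cnj (sph_harm l m x)\<close>. The range of \<open>l1\<close> is the triangle rule, which
  makes the sum finite.\<close>

definition zonal_coeff :: "(nat \<Rightarrow> real) \<Rightarrow> nat \<Rightarrow> int \<Rightarrow> nat \<Rightarrow> real" where
  "zonal_coeff v l m k = (-1) powi m * (\<Sum>l1 = nat \<bar>int k - int l\<bar>..k + l. v l1 *
     (sqrt ((2 * real l1 + 1) * (2 * real k + 1) * (2 * real l + 1) / (4 * pi)) *
      wigner_3j l1 k l 0 0 0 * wigner_3j l1 k l 0 m (- m)))"

lemma zonal_coeff_eq_0: "int k < \<bar>m\<bar> \<Longrightarrow> zonal_coeff v l m k = 0"
  by (simp add: zonal_coeff_def wigner_3j_def)

lemma zonal_mult_L2:
  "L2_fun surface_measure (\<lambda>x. of_real (V x)) \<Longrightarrow> L2_fun surface_measure (\<lambda>x. of_real (V x) * cnj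
      (sph_harm l m x))"
proof -
  assume V: "L2_fun surface_measure (\<lambda>x. of_real (V x))"
  obtain B where "\<forall>x\<in>S2. cmod (sph_harm l m x) \<le> B" using sph_harm_bounded by blast
  then show ?thesis by (intro L2_fun_bounded_mult(1)[OF V, of _ B]) auto
qed

text \<open>Beyond \<open>k + l\<close> the partial sum contains every degree that the triangle rule
  admits, so the integral no longer depends on \<open>n\<close>.\<close>

lemma zonal_sum_integral:
  assumes m: "\<bar>m\<bar> \<le> int l" and k: "\<bar>m\<bar> \<le> int k" and n: "k + l < n"
  shows "(\<integral>x. (\<Sum>j<n. of_real (v j) * sph_harm j 0 x) * cnj (sph_harm l m x) * sph_harm k m x
      \<partial>surface_measure)
    = of_real (zonal_coeff v l m k)"
proof -
  let ?g = "\<lambda>j. sqrt ((2 * real j + 1) * (2 * real k + 1) * (2 * real l + 1) / (4 * pi)) *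
        wigner_3j j k l 0 0 0 * wigner_3j j k l 0 m (- m)"
  have i: "integrable surface_measure (\<lambda>x. sph_harm j 0 x * sph_harm k m x * cnj (sph_harm l m x))"
      for j
    by (intro surface_integrable_continuous continuous_intros continuous_on_sph_harm)
  have "(\<integral>x. (\<Sum>j<n. of_real (v j) * sph_harm j 0 x) * cnj (sph_harm l m x) * sph_harm k m x
      \<partial>surface_measure)
    = (\<integral>x. (\<Sum>j<n. of_real (v j) * (sph_harm j 0 x * sph_harm k m x * cnj
        (sph_harm l m x))) \<partial>surface_measure)"
    by (simp add: sum_distrib_left sum_distrib_right mult_ac)
  also have "\<dots> = (\<Sum>j<n. of_real (v j) * (\<integral>x. sph_harm j 0 x * sph_harm k m x * cnj (sph_harm l m x)
      \<partial>surface_measure))"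
    using i by (simp add: Bochner_Integration.integral_sum)
  also have "\<dots> = (\<Sum>j<n. of_real (v j * ((-1) powi m * ?g j)))"
    by (simp add: sph_harm_gaunt[OF k m])
  also have "\<dots> = of_real ((-1) powi m * (\<Sum>j<n. v j * ?g j))"
    by (simp add: sum_distrib_left mult_ac)
  also have "(\<Sum>j<n. v j * ?g j) = (\<Sum>j = nat \<bar>int k - int l\<bar>..k + l. v j * ?g j)"
  proof (rule sum.mono_neutral_right)
    show "\<forall>j\<in>{..<n} - {nat \<bar>int k - int l\<bar>..k + l}. v j * ?g j = 0"
    proof
      fix j assume "j \<in> {..<n} - {nat \<bar>int k - int l\<bar>..k + l}"
      then have "\<not> (\<bar>int j - int k\<bar> \<le> int l \<and> int l \<le> int j + int k)" by auto
      then have "wigner_3j j k l 0 0 0 = 0" unfolding wigner_3j_def Let_def by (subst if_not_P) blast+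
      then show "v j * ?g j = 0" by simp
    qed
  qed (use n in auto)
  finally show ?thesis by (simp only: zonal_coeff_def)
qed

text \<open>Multiplication by a bounded harmonic is continuous in mean square, so the products
  \<open>gN\<close> converge. Their coefficients are eventually constant, which identifies those of
  the limit; their finite expansions provide the density.\<close>

lemma zonal_mult_expansion:
  assumes V: "L2_fun surface_measure (\<lambda>x. of_real (V x))" and zon: "has_zonal_expansion V v"
      and m: "\<bar>m\<bar> \<le> int l"
  shows "(\<lambda>n. L2_norm surface_measure (\<lambda>x. (\<Sum>k<n. of_real (zonal_coeff v l m k) * cnj (sph_harm k m x))
      - of_real (V x) * cnj (sph_harm l m x))) \<longlonglongrightarrow> 0"
proof -
  let ?f = "\<lambda>x. of_real (V x) * cnj (sph_harm l m x)"
  let ?e = "\<lambda>k x. cnj (sph_harm k m x)"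
  define VN where "VN n x = (\<Sum>j<n. of_real (v j) * sph_harm j 0 x)" for n x
  define gN where "gN n x = VN n x * cnj (sph_harm l m x)" for n x
  have VL: "L2_fun surface_measure (VN n)" for n
    unfolding VN_def[abs_def] by (intro L2_fun_sum L2_fun_scale sph_harm_L2)
  obtain B where B: "B \<ge> 0" "\<forall>x\<in>S2. cmod (sph_harm l m x) \<le> B" using sph_harm_bounded by blast
  have Ym: "(\<lambda>x. cnj (sph_harm l m x)) \<in> borel_measurable surface_measure" by measurable
  have Yb: "cmod (cnj (sph_harm l m x)) \<le> B" if "x \<in> space surface_measure" for x using B that by simp
  have fL: "L2_fun surface_measure ?f" using V by (rule zonal_mult_L2)
  have gL: "L2_fun surface_measure (gN n)" for n
    unfolding gN_def[abs_def] by (rule L2_fun_bounded_mult(1)[OF VL Ym Yb])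
  have eL: "L2_fun surface_measure (?e k)" for k by (intro L2_fun_cnj sph_harm_L2)
  have lim: "(\<lambda>n. L2_norm surface_measure (\<lambda>x. gN n x - ?f x)) \<longlonglongrightarrow> 0"
  proof (rule Lim_null_comparison[OF always_eventually])
    have "(\<lambda>n. B * L2_norm surface_measure (\<lambda>x. VN n x - of_real (V x))) \<longlonglongrightarrow> B * 0"
      using zon unfolding has_zonal_expansion_def L2_sums_def VN_def by (intro tendsto_intros) simp
    then show "(\<lambda>n. B * L2_norm surface_measure (\<lambda>x. VN n x - of_real (V x))) \<longlonglongrightarrow> 0" by simp
    show "\<forall>n. norm (L2_norm surface_measure (\<lambda>x. gN n x - ?f x)) \<le> B * L2_norm surface_measure (\<lambda>x. VN
        n x - of_real (V x))"
    proof
      fix n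
      have "L2_norm surface_measure (\<lambda>x. (VN n x - of_real (V x)) * cnj (sph_harm l m x)) \<le>
          B * L2_norm surface_measure (\<lambda>x. VN n x - of_real (V x))"
        by (rule L2_fun_bounded_mult(2)[OF L2_fun_diff[OF VL V] Ym Yb B(1)])
      then show "norm (L2_norm surface_measure (\<lambda>x. gN n x - ?f x)) \<le> B * L2_norm surface_measure
          (\<lambda>x. VN n x - of_real (V x))"
        using L2_norm_nonneg[of surface_measure "\<lambda>x. gN n x - ?f x"] by
            (simp add: gN_def left_diff_distrib)
    qed
  qed
  have coeff: "(\<integral>x. ?f x * cnj (?e k x) \<partial>surface_measure) = of_real (zonal_coeff v l m k)" for k
  proof (cases "\<bar>m\<bar> \<le> int k")
    case True
    have "(\<lambda>n. \<integral>x. gN n x * cnj (?e k x) \<partial>surface_measure) \<longlonglongrightarrow> (\<integral>x. ?f x * cnj (?e k x) \<partial>surface_measure)"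
      by (rule L2_inner_tendsto[OF gL eL fL eL lim]) (simp add: L2_norm_def)
    moreover have "(\<lambda>n. \<integral>x. gN n x * cnj (?e k x) \<partial>surface_measure) \<longlonglongrightarrow> of_real (zonal_coeff v l m k)"
    proof (rule tendsto_eventually)
      show "\<forall>\<^sub>F n in sequentially. (\<integral>x. gN n x * cnj (?e k x) \<partial>surface_measure) =
          of_real (zonal_coeff v l m k)"
        using eventually_gt_at_top[of "k + l"]
        by eventually_elim (simp add: gN_def VN_def zonal_sum_integral[OF m True])
    qed
    ultimately show ?thesis by (rule LIMSEQ_unique)
  next
    case False
    then have "(\<integral>x. ?f x * cnj (?e k x) \<partial>surface_measure) = (\<integral>x. 0 \<partial>surface_measure)"
      by (intro Bochner_Integration.integral_cong) (auto simp: sph_harm_eq_0)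
    then show ?thesis using False by (simp add: zonal_coeff_eq_0)
  qed
  have "(\<lambda>n. L2_norm surface_measure (\<lambda>x. (\<Sum>k<n. (\<integral>x. ?f x * cnj (?e k x) \<partial>surface_measure) * ?e k x) -
      ?f x)) \<longlonglongrightarrow> 0"
  proof (rule L2_orthonormal_expansion[OF fL eL, where Q = "\<lambda>k. \<bar>m\<bar> \<le> int k"])
    show "(\<integral>x. ?e k x * cnj (?e j x) \<partial>surface_measure) = (if k = j \<and> \<bar>m\<bar> \<le> int k then 1 else 0)" for j k
    proof (cases "\<bar>m\<bar> \<le> int k \<and> \<bar>m\<bar> \<le> int j")
      case True
      have "(\<integral>x. ?e k x * cnj (?e j x) \<partial>surface_measure) = (\<integral>x. sph_harm j m x * cnj (sph_harm k m x)
          \<partial>surface_measure)"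
        by (simp add: mult.commute)
      then show ?thesis using sph_harm_orthonormal[of m j m k] True by auto
    next
      case False
      then have "(\<integral>x. ?e k x * cnj (?e j x) \<partial>surface_measure) = (\<integral>x. 0 \<partial>surface_measure)"
        by (intro Bochner_Integration.integral_cong) (auto simp: sph_harm_eq_0)
      then show ?thesis using False by auto
    qed
    show "(\<integral>x. ?f x * cnj (?e k x) \<partial>surface_measure) = 0" if "\<not> \<bar>m\<bar> \<le> int k" for k
      unfolding coeff using that by (simp add: zonal_coeff_eq_0)
    fix \<epsilon> :: real assume "\<epsilon> > 0"
    then have "\<forall>\<^sub>F n in sequentially. L2_norm surface_measure (\<lambda>x. gN n x - ?f x) < \<epsilon>"
      by (intro order_tendstoD[OF lim])
    then obtain n where n: "L2_norm surface_measure (\<lambda>x. gN n x - ?f x) < \<epsilon>"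
      unfolding eventually_sequentially by blast
    have "finite_expansion m (\<lambda>x. \<Sum>j<n. of_real (v j) * (sph_harm j 0 x * sph_harm l m x))"
    proof (rule finite_expansion_sum)
      fix j
      from finite_expansion_zonal_mult[of m j l] obtain N c where
        "\<forall>x\<in>S2. sph_harm j 0 x * sph_harm l m x = (\<Sum>k<N. c k * sph_harm k m x)"
        unfolding finite_expansion_def by blast
      then have "\<forall>x\<in>S2. of_real (v j) * (sph_harm j 0 x * sph_harm l m x) =
          (\<Sum>k<N. (of_real (v j) * c k) * sph_harm k m x)"
        by (simp add: sum_distrib_left mult.assoc)
      then show "finite_expansion m (\<lambda>x. of_real (v j) * (sph_harm j 0 x * sph_harm l m x))"
        unfolding finite_expansion_def by (intro exI[of _ N] exI[of _ "\<lambda>k. of_real (v j) * c k"])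
    qed
    then obtain N c where c: "\<forall>x\<in>S2. (\<Sum>j<n. of_real (v j) * (sph_harm j 0 x * sph_harm l m x)) =
        (\<Sum>k<N. c k * sph_harm k m x)"
      unfolding finite_expansion_def by blast
    have "gN n x = (\<Sum>k<N. cnj (c k) * ?e k x)" if x: "x \<in> S2" for x
    proof -
      have "gN n x = cnj (\<Sum>j<n. of_real (v j) * (sph_harm j 0 x * sph_harm l m x))"
        by (simp add: gN_def VN_def sum_distrib_right cnj_sph_harm_0[OF x] mult.assoc)
      also have "\<dots> = cnj (\<Sum>k<N. c k * sph_harm k m x)" using c x by simp
      finally show ?thesis by simp
    qed
    then have "L2_norm surface_measure (\<lambda>x. (\<Sum>k<N. cnj (c k) * ?e k x) - ?f x) =
        L2_norm surface_measure (\<lambda>x. gN n x - ?f x)"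
      by (intro L2_norm_cong) simp
    then show "\<exists>N d. L2_norm surface_measure (\<lambda>x. (\<Sum>k<N. d k * ?e k x) - ?f x) < \<epsilon>"
      using n by (intro exI[of _ N] exI[of _ "\<lambda>k. cnj (c k)"]) simp
  qed
  then show ?thesis unfolding coeff .
qed

section \<open>The harmonic coefficients of the modulated field\<close>

context isotropic
begin

text \<open>\<open>V\<close> times a bounded harmonic is square-integrable, hence integrable on a
  sphere of finite area. The integral therefore exists, and the choice in \<open>ms_integral\<close>
  has the chosen property.\<close>

lemma harmonic_coeff_modulated:
  assumes V: "L2_fun surface_measure (\<lambda>x. of_real (V x))" and m: "\<bar>m\<bar> \<le> int l"
  shows "has_ms_integral P surface_measure (\<lambda>x \<omega>. of_real (V x * T x \<omega>) * cnj (sph_harm l m x))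
      (harmonic_coeff P (\<lambda>x \<omega>. V x * T x \<omega>) l m)" (is ?ms)
    and "weak_integral (\<lambda>x. of_real (V x) * cnj (sph_harm l m x)) (harmonic_coeff P (\<lambda>x \<omega>. V x * T x \<omega>)
        l m)"
proof -
  let ?f = "\<lambda>x. of_real (V x) * cnj (sph_harm l m x)"
  have f: "integrable surface_measure ?f"
    by (rule surface.L2_fun_integrable[OF zonal_mult_L2[OF V]])
  have eq: "(\<lambda>x \<omega>. of_real (V x * T x \<omega>) * cnj (sph_harm l m x)) = (\<lambda>x \<omega>. Tc x \<omega> * ?f x)"
    by (simp add: fun_eq_iff mult_ac)
  have "\<exists>I. has_ms_integral P surface_measure (\<lambda>x \<omega>. of_real (V x * T x \<omega>) * cnj (sph_harm l m x)) I"
    unfolding eq by (rule ex_has_ms_integral[OF f])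
  from someI_ex[OF this] show ms: ?ms
    using m by (simp add: harmonic_coeff_def ms_integral_def)
  show "weak_integral ?f (harmonic_coeff P (\<lambda>x \<omega>. V x * T x \<omega>) l m)"
    using ms unfolding eq by (rule has_ms_integral_imp_weak[OF f])
qed

text \<open>The case of constant \<open>V\<close> with value 1. When \<open>\<bar>m\<bar>\<close>
  exceeds \<open>l\<close>, the harmonic and the coefficient are both zero.\<close>

lemma harmonic_coeff_weak:
  "weak_integral (\<lambda>x. cnj (sph_harm l m x)) (harmonic_coeff P T l m)"
proof (cases "\<bar>m\<bar> \<le> int l")
  case True
  then show ?thesis
    using harmonic_coeff_modulated(2)[of "\<lambda>x. 1" m l] surface.L2_fun_1 by simp
next
  case False
  have "weak_integral (\<lambda>x. 0) (\<lambda>\<omega>. 0)" by (simp add: weak_integral_def L2_fun_0)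
  then have "weak_integral (\<lambda>x. cnj (sph_harm l m x)) (\<lambda>\<omega>. 0)"
    by (rule weak_integral_cong) (use False in \<open>simp add: sph_harm_eq_0\<close>)
  then show ?thesis using False by (simp add: harmonic_coeff_def)
qed

text \<open>The diagonal entries of the kernel form have the property that defines the spectrum, and
  that property at order 0 admits no other sequence.\<close>

lemma coeff_cov_isotropic:
  assumes "\<bar>m\<bar> \<le> int l" "\<bar>m'\<bar> \<le> int l'"
  shows "coeff_cov P T l l' m m' = (if l = l' \<and> m = m' then of_real (angular_power_spectrum P T l) else
      0)"
proof -
  obtain C where C: "\<And>l l' m m'. \<bar>m\<bar> \<le> int l \<Longrightarrow> \<bar>m'\<bar> \<le> int l' \<Longrightarrow>
    kernel_form \<kappa> (sph_harm l m) (sph_harm l' m') = (if l = l' \<and> m = m' then of_real (C l) else 0)"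
    by (rule kernel_form_diag[OF \<kappa>_cont]) blast
  have cov: "coeff_cov P T l l' m m' = (if l = l' \<and> m = m' then of_real (C l) else 0)"
    if "\<bar>m\<bar> \<le> int l" "\<bar>m'\<bar> \<le> int l'" for l l' m m'
    unfolding coeff_cov_def weak_integral_sph_harm_cov[OF harmonic_coeff_weak harmonic_coeff_weak]
        C[OF that]
    by simp
  have "angular_power_spectrum P T = C"
    unfolding angular_power_spectrum_def
  proof (rule the_equality)
    show "\<forall>l l' m m'. \<bar>m\<bar> \<le> int l \<longrightarrow> \<bar>m'\<bar> \<le> int l' \<longrightarrow>
        coeff_cov P T l l' m m' = (if l = l' \<and> m = m' then of_real (C l) else 0)"
      using cov by blast
    fix D assume D: "\<forall>l l' m m'. \<bar>m\<bar> \<le> int l \<longrightarrow> \<bar>m'\<bar> \<le> int l' \<longrightarrow>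
        coeff_cov P T l l' m m' = (if l = l' \<and> m = m' then of_real (D l) else 0)"
    show "D = C"
    proof
      fix l
      have "coeff_cov P T l l 0 0 = of_real (D l)" using D[rule_format, of 0 l 0 l] by simp
      moreover have "coeff_cov P T l l 0 0 = of_real (C l)" using cov[of 0 l 0 l] by simp
      ultimately show "D l = C l" by simp
    qed
  qed
  then show ?thesis using cov assms by simp
qed

text \<open>The remainder of the series is the weak integral of the remainder on the sphere. Its
  norm is controlled by an integral of the modulus, and finite area bounds this by the mean-square
  norm, which tends to 0.\<close>

lemma harmonic_coeff_modulated_sums:
  assumes V: "L2_fun surface_measure (\<lambda>x. of_real (V x))" and zon: "has_zonal_expansion V v"
      and m: "\<bar>m\<bar> \<le> int l"
  shows "L2_sums P (\<lambda>k \<omega>. of_real (zonal_coeff v l m k) * harmonic_coeff P T k m \<omega>)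
     (harmonic_coeff P (\<lambda>x \<omega>. V x * T x \<omega>) l m)"
  unfolding L2_sums_def
proof (intro conjI allI)
  let ?f = "\<lambda>x. of_real (V x) * cnj (sph_harm l m x)"
  let ?g = "\<lambda>n x. (\<Sum>k<n. of_real (zonal_coeff v l m k) * cnj (sph_harm k m x)) - ?f x"
  let ?D = "\<lambda>n \<omega>. (\<Sum>k<n. of_real (zonal_coeff v l m k) * harmonic_coeff P T k m \<omega>) - harmonic_coeff P
      (\<lambda>x \<omega>. V x * T x \<omega>) l m \<omega>"
  have fL: "L2_fun surface_measure ?f" using V by (rule zonal_mult_L2)
  have gL: "L2_fun surface_measure (?g n)" for n
    by (intro L2_fun_diff L2_fun_sum L2_fun_scale L2_fun_cnj sph_harm_L2 fL)
  show "L2_fun P (\<lambda>\<omega>. of_real (zonal_coeff v l m k) * harmonic_coeff P T k m \<omega>)" for k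
    using harmonic_coeff_weak[of k m] unfolding weak_integral_def by (intro L2_fun_scale) blast
  show "L2_fun P (harmonic_coeff P (\<lambda>x \<omega>. V x * T x \<omega>) l m)"
    using harmonic_coeff_modulated(2)[OF V m] unfolding weak_integral_def by blast
  have w: "weak_integral (?g n) (?D n)" for n
    by (intro weak_integral_sum_diff harmonic_coeff_weak harmonic_coeff_modulated(2) V m
      surface.L2_fun_integrable[OF fL] surface.L2_fun_integrable[OF L2_fun_cnj[OF sph_harm_L2]])
  show "(\<lambda>n. L2_norm P (?D n)) \<longlonglongrightarrow> 0"
  proof (rule Lim_null_comparison[OF always_eventually])
    let ?c = "L2_norm surface_measure (\<lambda>x. 1)"
    have "(\<lambda>n. sqrt (\<kappa> 1) * (L2_norm surface_measure (?g n) * ?c)) \<longlonglongrightarrow> sqrt (\<kappa> 1) * (0 * ?c)"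
      by (intro tendsto_intros zonal_mult_expansion V zon m)
    then show "(\<lambda>n. sqrt (\<kappa> 1) * (L2_norm surface_measure (?g n) * ?c)) \<longlonglongrightarrow> 0" by simp
    show "\<forall>n. norm (L2_norm P (?D n)) \<le> sqrt (\<kappa> 1) * (L2_norm surface_measure (?g n) * ?c)"
    proof
      fix n
      have "norm (L2_norm P (?D n)) = L2_norm P (?D n)" using L2_norm_nonneg[of P "?D n"] by simp
      also have "\<dots> \<le> sqrt (\<kappa> 1) * (\<integral>x. cmod (?g n x) \<partial>surface_measure)"
        by (rule weak_integral_norm[OF surface.L2_fun_integrable[OF gL] w])
      also have "\<dots> \<le> sqrt (\<kappa> 1) * (L2_norm surface_measure (?g n) * ?c)"
        using \<kappa>_1_nonneg by (intro mult_left_mono surface.integral_le_L2_norm gL) simp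
      finally show "norm (L2_norm P (?D n)) \<le> sqrt (\<kappa> 1) * (L2_norm surface_measure (?g n) * ?c)" .
    qed
  qed
qed

text \<open>The inner product is continuous, so it suffices to compute it for partial sums;
  orthogonality of the coefficients reduces the double sum to its diagonal.\<close>

lemma coeff_cov_partial_sums:
  assumes V: "L2_fun surface_measure (\<lambda>x. of_real (V x))" and zon: "has_zonal_expansion V v"
    and m: "\<bar>m\<bar> \<le> int l" "\<bar>m'\<bar> \<le> int l'"
  shows "(\<lambda>k. if m = m' then of_real (zonal_coeff v l m k * zonal_coeff v l' m k *
      angular_power_spectrum P T k) else 0)
    sums coeff_cov P (\<lambda>x \<omega>. V x * T x \<omega>) l l' m m'"
proof -
  let ?a = "harmonic_coeff P T"
  define S where "S l m n \<omega> = (\<Sum>k<n. of_real (zonal_coeff v l m k) * ?a k m \<omega>)" for l m n \<omega>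
  let ?A = "harmonic_coeff P (\<lambda>x \<omega>. V x * T x \<omega>)"
  note s1 = harmonic_coeff_modulated_sums[OF V zon m(1), unfolded L2_sums_def]
  note s2 = harmonic_coeff_modulated_sums[OF V zon m(2), unfolded L2_sums_def]
  have aL: "L2_fun P (?a k m)" for k m using harmonic_coeff_weak unfolding weak_integral_def by blast
  have SL: "L2_fun P (S l m n)" for l m n unfolding S_def[abs_def] by (intro L2_fun_sum L2_fun_scale aL)
  have lim: "(\<lambda>n. \<integral>\<omega>. S l m n \<omega> * cnj (S l' m' n \<omega>) \<partial>P) \<longlonglongrightarrow> coeff_cov P (\<lambda>x \<omega>. V x * T x \<omega>) l l' m m'"
    unfolding coeff_cov_def
    by (rule L2_inner_tendsto[OF SL SL]) (use s1 s2 in \<open>simp_all add: S_def\<close>)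
  have "(\<integral>\<omega>. S l m n \<omega> * cnj (S l' m' n \<omega>) \<partial>P) =
    (\<Sum>k<n. if m = m' then of_real (zonal_coeff v l m k * zonal_coeff v l' m k * angular_power_spectrum
        P T k) else 0)" for n
  proof -
    have trm: "of_real (zonal_coeff v l m k * zonal_coeff v l' m' j) * coeff_cov P T k j m m' =
      (if j = k then (if m = m' then of_real (zonal_coeff v l m k * zonal_coeff v l' m k *
          angular_power_spectrum P T k) else 0) else 0)" for k j
    proof (cases "\<bar>m\<bar> \<le> int k \<and> \<bar>m'\<bar> \<le> int j")
      case True
      then show ?thesis by (auto simp: coeff_cov_isotropic)
    next
      \<comment> \<open>\<open>coeff_cov_isotropic\<close> speaks only of admissible orders; outside
        them one of the zonal coefficients is zero.\<close>
      case False
      then have "zonal_coeff v l m k = 0 \<or> zonal_coeff v l' m' j = 0" using zonal_coeff_eq_0 not_le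
          by metis
      then show ?thesis by auto
    qed
    have "(\<integral>\<omega>. S l m n \<omega> * cnj (S l' m' n \<omega>) \<partial>P) =
      (\<integral>\<omega>. (\<Sum>k<n. \<Sum>j<n. of_real (zonal_coeff v l m k * zonal_coeff v l' m' j) * (?a k m \<omega> * cnj
          (?a j m' \<omega>))) \<partial>P)"
      by (simp add: S_def sum_product mult_ac)
    also have "\<dots> = (\<Sum>k<n. \<Sum>j<n. of_real (zonal_coeff v l m k * zonal_coeff v l' m' j) * coeff_cov P T k
        j m m')"
      unfolding coeff_cov_def using L2_integrable_cnj[OF aL aL]
      by (simp add: Bochner_Integration.integral_sum)
    also have "\<dots> = (\<Sum>k<n. if m = m' then of_real (zonal_coeff v l m k * zonal_coeff v l' m k *
        angular_power_spectrum P T k) else 0)"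
      unfolding trm by (rule sum.cong) simp_all
    finally show ?thesis .
  qed
  then show ?thesis using lim unfolding sums_def by simp
qed

end

text \<open>The function \<open>g\<close> of the distance comes without regularity. Continuity is
  gained by writing \<open>\<kappa> s\<close> as the covariance between the north pole and the point
  at colatitude \<open>arccos s\<close>; clamping extends this to the whole line.\<close>

lemma isotropic_field_kernel:
  assumes "isotropic_field P T"
  shows "\<exists>\<kappa>. isotropic P T \<kappa>"
proof -
  from assms obtain g where field: "centred_second_order_field P T"
    and cont: "continuous_on (S2 \<times> S2) (\<lambda>(x, y). field_cov P T x y)"
    and g: "\<And>x y. x \<in> S2 \<Longrightarrow> y \<in> S2 \<Longrightarrow> field_cov P T x y = g (great_circle_dist x y)"
    unfolding isotropic_field_def by blast
  interpret prob_space P using field by (simp add: centred_second_order_field_def)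
  define clamp where "clamp s = max (-1) (min 1 s)" for s :: real
  define \<kappa> where "\<kappa> s = g (arccos (clamp s))" for s
  let ?p = "\<lambda>s. sphere_point (arccos (clamp s)) 0"
  have cl: "clamp s \<in> {-1..1}" for s by (auto simp: clamp_def)
  have inner: "sphere_point 0 0 \<bullet> ?p s = clamp s" for s
    using cl[of s] by (simp add: inner_vec_def sum_3 cos_arccos)
  have eq: "\<kappa> s = (\<lambda>(x, y). field_cov P T x y) (sphere_point 0 0, ?p s)" for s
    unfolding case_prod_conv g[OF sphere_point_in_S2 sphere_point_in_S2] great_circle_dist_def inner
        \<kappa>_def ..
  have "continuous_on UNIV (\<lambda>s. arccos (clamp s))"
  proof (rule continuous_on_compose2[OF continuous_on_arccos'])
    show "continuous_on UNIV clamp" unfolding clamp_def[abs_def] by (intro continuous_intros)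
  qed (use cl in auto)
  then have "continuous_on UNIV (\<lambda>s. (arccos (clamp s), 0 :: real))"
    by (rule continuous_on_Pair[OF _ continuous_on_const])
  from continuous_on_compose2[OF continuous_on_sphere_point this subset_UNIV]
  have "continuous_on UNIV ?p" by simp
  then have "continuous_on UNIV (\<lambda>s. (sphere_point 0 0, ?p s))" by (intro continuous_intros)
  then have "continuous_on UNIV (\<lambda>s. (\<lambda>(x, y). field_cov P T x y) (sphere_point 0 0, ?p s))"
    by (rule continuous_on_compose2[OF cont]) (use sphere_point_in_S2 in auto)
  then have \<kappa>c: "continuous_on UNIV \<kappa>" unfolding eq[symmetric] by simp
  have "isotropic P T \<kappa>"
  proof
    show "L2_fun P (\<lambda>\<omega>. of_real (T x \<omega>))" if "x \<in> S2" for x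
    proof -
      have T: "T x \<in> borel_measurable P" "integrable P (\<lambda>\<omega>. (T x \<omega>)\<^sup>2)"
        using field that unfolding centred_second_order_field_def by blast+
      show ?thesis
        unfolding L2_fun_def using measurable_compose[OF T(1) borel_measurable_of_real] T(2) by simp
    qed
    show "continuous_on UNIV \<kappa>" by (rule \<kappa>c)
    fix x y :: "real^3" assume xy: "x \<in> S2" "y \<in> S2"
    have "clamp (x \<bullet> y) = x \<bullet> y" using S2_inner_bound[OF xy] by (auto simp: clamp_def abs_le_iff)
    then show "(\<integral>\<omega>. T x \<omega> * T y \<omega> \<partial>P) = \<kappa> (x \<bullet> y)"
      using g[OF xy] by (simp add: \<kappa>_def field_cov_def great_circle_dist_def)
  qed
  then show ?thesis by (rule exI[of _ \<kappa>])
qed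

theorem theorem9:
  fixes P :: "'w measure" and T :: "real^3 \<Rightarrow> 'w \<Rightarrow> real"
    and V :: "real^3 \<Rightarrow> real" and v :: "nat \<Rightarrow> real"
    and T\<^sub>V :: "real^3 \<Rightarrow> 'w \<Rightarrow> real" and a :: "nat \<Rightarrow> int \<Rightarrow> 'w \<Rightarrow> complex" and C :: "nat \<Rightarrow> real"
  assumes "isotropic_field P T"
    and "L2_fun surface_measure (\<lambda>x. of_real (V x))"
    and "has_zonal_expansion V v"
  defines "a \<equiv> harmonic_coeff P T"
    and "C \<equiv> angular_power_spectrum P T"
    and "T\<^sub>V \<equiv> (\<lambda>x \<omega>. V x * T x \<omega>)"
  shows "(\<forall>l m. \<bar>m\<bar> \<le> int l \<longrightarrow>
            has_ms_integral P surface_measure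
              (\<lambda>x \<omega>. of_real (T\<^sub>V x \<omega>) * cnj (sph_harm l m x)) (harmonic_coeff P T\<^sub>V l m) \<and>
            L2_sums P
              (\<lambda>l2 \<omega>. (-1) powi m *
                 (\<Sum>l1 = nat \<bar>int l2 - int l\<bar>..l2 + l.
                    of_real (v l1) * a l2 m \<omega> *
                    of_real (sqrt ((2 * real l1 + 1) * (2 * real l2 + 1) * (2 * real l + 1) / (4 * pi)) *
                      wigner_3j l1 l2 l 0 0 0 * wigner_3j l1 l2 l 0 m (- m))))
              (harmonic_coeff P T\<^sub>V l m)) \<and>
         (\<forall>l l' m m'. \<bar>m\<bar> \<le> int l \<longrightarrow> \<bar>m'\<bar> \<le> int l' \<longrightarrow>
            (m \<noteq> m' \<longrightarrow> coeff_cov P T\<^sub>V l l' m m' = 0) \<and>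
            (m = m' \<longrightarrow>
              (\<lambda>l2. of_real
                 (\<Sum>l1 = nat \<bar>int l2 - int l\<bar>..l2 + l. \<Sum>l1' = nat \<bar>int l2 - int l'\<bar>..l2 + l'.
                    v l1 * v l1' * ((2 * real l2 + 1) / (4 * pi)) * C l2 *
                    sqrt ((2 * real l1 + 1) * (2 * real l1' + 1) * (2 * real l + 1) * (2 * real l' + 1)) *
                    wigner_3j l1 l2 l 0 0 0 * wigner_3j l1' l2 l' 0 0 0 *
                    wigner_3j l1 l2 l 0 m (- m) * wigner_3j l1' l2 l' 0 m (- m)))
              sums coeff_cov P T\<^sub>V l l' m m'))"
proof -
  obtain \<kappa> where "isotropic P T \<kappa>" using isotropic_field_kernel[OF assms(1)] by blast
  then interpret isotropic P T \<kappa> .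
  note V = assms(2) and zon = assms(3)
  show ?thesis
  proof (intro conjI allI impI)
    fix l :: nat and m :: int
    assume m: "\<bar>m\<bar> \<le> int l"
    show "has_ms_integral P surface_measure
        (\<lambda>x \<omega>. of_real (T\<^sub>V x \<omega>) * cnj (sph_harm l m x)) (harmonic_coeff P T\<^sub>V l m)"
      unfolding T\<^sub>V_def by (rule harmonic_coeff_modulated(1)[OF V m])
    have "(\<lambda>l2 \<omega>. (-1) powi m *
                 (\<Sum>l1 = nat \<bar>int l2 - int l\<bar>..l2 + l.
                    of_real (v l1) * a l2 m \<omega> *
                    of_real (sqrt ((2 * real l1 + 1) * (2 * real l2 + 1) * (2 * real l + 1) /
                        (4 * pi)) *
                      wigner_3j l1 l2 l 0 0 0 * wigner_3j l1 l2 l 0 m (- m)))) =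
      (\<lambda>k \<omega>. of_real (zonal_coeff v l m k) * harmonic_coeff P T k m \<omega>)"
      by (simp add: fun_eq_iff zonal_coeff_def a_def sum_distrib_left sum_distrib_right mult_ac)
    then show "L2_sums P
              (\<lambda>l2 \<omega>. (-1) powi m *
                 (\<Sum>l1 = nat \<bar>int l2 - int l\<bar>..l2 + l.
                    of_real (v l1) * a l2 m \<omega> *
                    of_real (sqrt ((2 * real l1 + 1) * (2 * real l2 + 1) * (2 * real l + 1) /
                        (4 * pi)) *
                      wigner_3j l1 l2 l 0 0 0 * wigner_3j l1 l2 l 0 m (- m))))
              (harmonic_coeff P T\<^sub>V l m)"
      unfolding T\<^sub>V_def using harmonic_coeff_modulated_sums[OF V zon m] by (simp only:)
  next
    fix l l' :: nat and m m' :: int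
    assume m: "\<bar>m\<bar> \<le> int l" "\<bar>m'\<bar> \<le> int l'"
    note sums = coeff_cov_partial_sums[OF V zon m, folded T\<^sub>V_def C_def]
    show "coeff_cov P T\<^sub>V l l' m m' = 0" if "m \<noteq> m'"
      using sums that sums_unique2[OF _ sums_zero] by auto
    assume mm: "m = m'"
    have "zonal_coeff v l m k * zonal_coeff v l' m k * C k =
      (\<Sum>l1 = nat \<bar>int k - int l\<bar>..k + l. \<Sum>l1' = nat \<bar>int k - int l'\<bar>..k + l'.
                    v l1 * v l1' * ((2 * real k + 1) / (4 * pi)) * C k *
                    sqrt ((2 * real l1 + 1) * (2 * real l1' + 1) * (2 * real l + 1) *
                        (2 * real l' + 1)) *
                    wigner_3j l1 k l 0 0 0 * wigner_3j l1' k l' 0 0 0 *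
                    wigner_3j l1 k l 0 m (- m) * wigner_3j l1' k l' 0 m (- m))" for k
    proof -
      \<comment> \<open>The signs of the two coefficients multiply to 1. In \<open>rt\<close> the
        factor of the common degree \<open>k\<close> and \<open>4 * pi\<close> occur squared under
        the root and are taken out.\<close>
      have sg: "(-1) powi m * (-1) powi m = (1 :: real)" by (simp add: power_int_minus_left)
      have rt: "sqrt ((2 * real i + 1) * (2 * real k + 1) * (2 * real l + 1) / (4 * pi)) *
          sqrt ((2 * real j + 1) * (2 * real k + 1) * (2 * real l' + 1) / (4 * pi)) =
        (2 * real k + 1) / (4 * pi) * sqrt ((2 * real i + 1) * (2 * real j + 1) * (2 * real l + 1) *
            (2 * real l' + 1))" for i j
      proof -
        have "sqrt ((2 * real i + 1) * (2 * real k + 1) * (2 * real l + 1) / (4 * pi)) *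
          sqrt ((2 * real j + 1) * (2 * real k + 1) * (2 * real l' + 1) / (4 * pi)) =
          sqrt (((2 * real k + 1) / (4 * pi))\<^sup>2 * ((2 * real i + 1) * (2 * real j + 1) *
              (2 * real l + 1) * (2 * real l' + 1)))"
          unfolding real_sqrt_mult[symmetric] by (simp add: power2_eq_square mult_ac)
        then show ?thesis by (simp only: real_sqrt_mult real_sqrt_abs) simp
      qed
      let ?s = "\<lambda>l l1. sqrt ((2 * real l1 + 1) * (2 * real k + 1) * (2 * real l + 1) / (4 * pi))"
      let ?w = "\<lambda>l l1. wigner_3j l1 k l 0 0 0 * wigner_3j l1 k l 0 m (- m)"
      have "zonal_coeff v l m k * zonal_coeff v l' m k * C k = ((-1) powi m * (-1) powi m) *
        ((\<Sum>l1 = nat \<bar>int k - int l\<bar>..k + l. v l1 * (?s l l1 * ?w l l1)) *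
         (\<Sum>l1' = nat \<bar>int k - int l'\<bar>..k + l'. v l1' * (?s l' l1' * ?w l' l1'))) * C k"
        by (simp add: zonal_coeff_def mult_ac)
      also have "\<dots> = (\<Sum>l1 = nat \<bar>int k - int l\<bar>..k + l. \<Sum>l1' = nat \<bar>int k - int l'\<bar>..k + l'.
          (v l1 * (?s l l1 * ?w l l1)) * (v l1' * (?s l' l1' * ?w l' l1')) * C k)"
        unfolding sg mult_1 sum_product by (simp only: sum_distrib_right)
      also have "\<dots> = (\<Sum>l1 = nat \<bar>int k - int l\<bar>..k + l. \<Sum>l1' = nat \<bar>int k - int l'\<bar>..k + l'.
          (?s l l1 * ?s l' l1') * (v l1 * v l1' * C k * (?w l l1 * ?w l' l1')))"
        by (intro sum.cong refl) (simp only: mult_ac)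
      finally show ?thesis unfolding rt by (simp only: mult_ac)
    qed
    then show "(\<lambda>l2. of_real
                 (\<Sum>l1 = nat \<bar>int l2 - int l\<bar>..l2 + l. \<Sum>l1' = nat \<bar>int l2 - int l'\<bar>..l2 + l'.
                    v l1 * v l1' * ((2 * real l2 + 1) / (4 * pi)) * C l2 *
                    sqrt ((2 * real l1 + 1) * (2 * real l1' + 1) * (2 * real l + 1) *
                        (2 * real l' + 1)) *
                    wigner_3j l1 l2 l 0 0 0 * wigner_3j l1' l2 l' 0 0 0 *
                    wigner_3j l1 l2 l 0 m (- m) * wigner_3j l1' l2 l' 0 m (- m)))
              sums coeff_cov P T\<^sub>V l l' m m'"
      using sums mm by simp
  qed
qed

end
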